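(* Let $\mu$ be a non-zero Lévy measure on $\mathbb{R}_{\ge 0}$ with $\int_1^\infty e^\xi\,\mu(d\xi)<\infty$, let $b=\int_0^\infty (e^\xi-1-\xi)\,\mu(d\xi)$, and let $X$ be the càdlàg Feller process with state space $\mathbb{R}_{\ge 0}$, deterministic starting point $X_0>0$, and generator $$\mathcal{A}f(x) = -b\,x f'(x) + x\int_0^\infty \bigl(f(x+\xi)-f(x)-f'(x)\xi\bigr)\,\mu(d\xi),\qquad f\in C_c^\infty(\mathbb{R}_{\ge 0}).$$ Define $$R(u)=\int_0^\infty \bigl(e^{u\xi}-1-u\xi\bigr)\,\mu(d\xi)-bu,\qquad u\in(-\infty,1].$$ Then $S=e^X-1$ is a local martingale, and the following are equivalent: (a) $S=e^X-1$ is a strict local martingale. (b) The ordinary differential equation $$\partial_t\, g(t)=R(g(t)),\qquad g(0)=1,$$ has more than one solution $g:[0,\infty)\to(-\infty,1]$. (c) The function $1/R(u)$ is integrable in a left neighborhood of $u=1$, i.e. there exists $\epsilon>0$ such that $$-\int_{1-\epsilon}^1\frac{d\eta}{R(\eta)}<\infty.$$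
   Context: A filtered probability space $(\Omega,\mathcal{F},(\mathcal{F}_t)_{t\ge 0},\mathbb{P})$ satisfying the usual conditions is given; $X$ is adapted to this filtration and is a Feller (Markov) process with respect to it. A Lévy measure on $\mathbb{R}_{\ge 0}$ is a Borel measure $\mu$ with $\mu(\{0\})=0$ and $\int_0^\infty \min(1,\xi^2)\,\mu(d\xi)<\infty$. The integrability condition makes $b$ finite, and $b>0$. $C_c^\infty(\mathbb{R}_{\ge 0})$ is a core of $\mathcal{A}$. Such a process $X$ exists, is non-explosive, and is unique in law (it is a conservative non-negative affine process). If $J(\omega,d\xi,ds)$ denotes the random measure of jumps of $X$ and $\overline{J}(\omega,X_{s-},d\xi,ds)=J(\omega,d\xi,ds)-X_{s-}\,\mu(d\xi)\,ds$ its compensated version, then $$X_t = X_0 + \int_{\mathbb{R}_{\ge 0}\times[0,t]}\xi\,\overline{J}(\omega,X_{s-},d\xi,ds) - b\int_0^t X_{s-}\,ds .$$ A strict local martingale is a local martingale that is not a true martingale. *)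

theory Defs
  imports "HOL-Probability.Probability"
begin

section \<open>Filtered probability spaces, martingales and local martingales\<close>

text \<open>Time is the half-line: families indexed by \<open>real\<close> are only ever inspected at indices
  \<open>t \<ge> 0\<close>. The library locale \<^locale>\<open>filtration\<close> is not used because its index set is a whole
  type. Stopping times are \<open>ennreal\<close>-valued, so that they may be infinite.\<close>

locale usual_filtered_prob_space = prob_space M + complete_measure M
  for M :: "'a measure" and F :: "real \<Rightarrow> 'a measure" +
  assumes subalgebra_F: "\<And>t. 0 \<le> t \<Longrightarrow> subalgebra M (F t)"
    and F_mono: "\<And>s t. 0 \<le> s \<Longrightarrow> s \<le> t \<Longrightarrow> sets (F s) \<subseteq> sets (F t)"
    and null_sets_F0: "null_sets M \<subseteq> sets (F 0)"
    and F_right_continuous: "\<And>t. 0 \<le> t \<Longrightarrow> sets (F t) = (\<Inter>s\<in>{t<..}. sets (F s))"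

definition adapted :: "(real \<Rightarrow> 'a measure) \<Rightarrow> (real \<Rightarrow> 'a \<Rightarrow> real) \<Rightarrow> bool" where
  "adapted F X \<longleftrightarrow> (\<forall>t\<ge>0. X t \<in> borel_measurable (F t))"

definition cadlag :: "(real \<Rightarrow> real) \<Rightarrow> bool" where
  "cadlag x \<longleftrightarrow>
     (\<forall>t\<ge>0. (x \<longlongrightarrow> x t) (at_right t)) \<and> (\<forall>t>0. \<exists>l. (x \<longlongrightarrow> l) (at_left t))"

definition martingale ::
    "'a measure \<Rightarrow> (real \<Rightarrow> 'a measure) \<Rightarrow> (real \<Rightarrow> 'a \<Rightarrow> real) \<Rightarrow> bool" where
  "martingale M F X \<longleftrightarrow>
     adapted F X \<and> (\<forall>t\<ge>0. integrable M (X t)) \<and>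
     (\<forall>s t. 0 \<le> s \<and> s \<le> t \<longrightarrow> (AE \<omega> in M. real_cond_exp M (F s) (X t) \<omega> = X s \<omega>))"

definition is_stopping_time ::
    "'a measure \<Rightarrow> (real \<Rightarrow> 'a measure) \<Rightarrow> ('a \<Rightarrow> ennreal) \<Rightarrow> bool" where
  "is_stopping_time M F \<tau> \<longleftrightarrow> (\<forall>t\<ge>0. {\<omega> \<in> space M. \<tau> \<omega> \<le> ennreal t} \<in> sets (F t))"

definition stopped ::
    "(real \<Rightarrow> 'a \<Rightarrow> real) \<Rightarrow> ('a \<Rightarrow> ennreal) \<Rightarrow> real \<Rightarrow> 'a \<Rightarrow> real" where
  "stopped X \<tau> t \<omega> = X (enn2real (min (ennreal t) (\<tau> \<omega>))) \<omega>"

definition local_martingale ::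
    "'a measure \<Rightarrow> (real \<Rightarrow> 'a measure) \<Rightarrow> (real \<Rightarrow> 'a \<Rightarrow> real) \<Rightarrow> bool" where
  "local_martingale M F X \<longleftrightarrow>
     adapted F X \<and> (\<forall>\<omega>\<in>space M. cadlag (\<lambda>t. X t \<omega>)) \<and>
     (\<exists>\<tau> :: nat \<Rightarrow> 'a \<Rightarrow> ennreal.
        (\<forall>n. is_stopping_time M F (\<tau> n)) \<and>
        (AE \<omega> in M. incseq (\<lambda>n. \<tau> n \<omega>) \<and> (\<lambda>n. \<tau> n \<omega>) \<longlonglongrightarrow> \<infinity>) \<and>
        (\<forall>n. martingale M F (stopped X (\<tau> n))))"

definition strict_local_martingale ::
    "'a measure \<Rightarrow> (real \<Rightarrow> 'a measure) \<Rightarrow> (real \<Rightarrow> 'a \<Rightarrow> real) \<Rightarrow> bool" where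
  "strict_local_martingale M F X \<longleftrightarrow> local_martingale M F X \<and> \<not> martingale M F X"


section \<open>Feller processes on the half-line\<close>

text \<open>A function on the state space $[0,\infty)$ is represented by a function on \<open>real\<close> whose
  values on the negative axis are irrelevant.\<close>

abbreviation borel_nonneg :: "real measure" where
  "borel_nonneg \<equiv> restrict_space borel {0..}"

definition C0_nonneg :: "(real \<Rightarrow> real) set" where
  "C0_nonneg = {f. continuous_on {0..} f \<and> (f \<longlongrightarrow> 0) at_top}"

text \<open>Smoothness at the boundary point 0 is understood with one-sided derivatives; the support
  is compact in $[0,\infty)$ and may contain 0.\<close>

definition Cc_smooth_nonneg :: "(real \<Rightarrow> real) set" where
  "Cc_smooth_nonneg = {f.
     (\<exists>D :: nat \<Rightarrow> real \<Rightarrow> real. D 0 = f \<and>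
        (\<forall>n. \<forall>x\<ge>0. (D n has_real_derivative D (Suc n) x) (at x within {0..}))) \<and>
     (\<exists>r. \<forall>x>r. f x = 0)}"

definition transition_op ::
    "(real \<Rightarrow> real \<Rightarrow> real measure) \<Rightarrow> real \<Rightarrow> (real \<Rightarrow> real) \<Rightarrow> real \<Rightarrow> real" where
  "transition_op K t f x = (\<integral>y. f y \<partial>K t x)"

text \<open>The last condition is stated pointwise; together with the others it is equivalent to strong
  continuity of the semigroup on $C_0$.\<close>

definition feller_transition :: "(real \<Rightarrow> real \<Rightarrow> real measure) \<Rightarrow> bool" where
  "feller_transition K \<longleftrightarrow>
     (\<forall>t\<ge>0. K t \<in> borel_nonneg \<rightarrow>\<^sub>M prob_algebra borel_nonneg) \<and>
     (\<forall>x\<ge>0. K 0 x = return borel_nonneg x) \<and>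
     (\<forall>s\<ge>0. \<forall>t\<ge>0. \<forall>x\<ge>0. K (s + t) x = K s x \<bind> K t) \<and>
     (\<forall>t\<ge>0. \<forall>f\<in>C0_nonneg. transition_op K t f \<in> C0_nonneg) \<and>
     (\<forall>f\<in>C0_nonneg. \<forall>x\<ge>0. ((\<lambda>t. transition_op K t f x) \<longlongrightarrow> f x) (at_right 0))"

text \<open>The infinitesimal generator, as a graph.\<close>

definition feller_generator ::
    "(real \<Rightarrow> real \<Rightarrow> real measure) \<Rightarrow> ((real \<Rightarrow> real) \<times> (real \<Rightarrow> real)) set" where
  "feller_generator K = {(f, g). f \<in> C0_nonneg \<and> g \<in> C0_nonneg \<and>
     uniform_limit {0..} (\<lambda>t x. (transition_op K t f x - f x) / t) g (at_right 0)}"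

text \<open>The generator agrees with \<open>A\<close> on \<open>D\<close>, and \<open>D\<close> is a core: the whole generator lies in the
  closure, with respect to uniform convergence, of the restriction of \<open>A\<close> to \<open>D\<close>.\<close>

definition generator_with_core ::
    "(real \<Rightarrow> real \<Rightarrow> real measure) \<Rightarrow> (real \<Rightarrow> real) set \<Rightarrow>
     ((real \<Rightarrow> real) \<Rightarrow> real \<Rightarrow> real) \<Rightarrow> bool" where
  "generator_with_core K D A \<longleftrightarrow>
     (\<forall>f\<in>D. (f, A f) \<in> feller_generator K) \<and>
     (\<forall>(f, g) \<in> feller_generator K. \<exists>u :: nat \<Rightarrow> real \<Rightarrow> real.
        (\<forall>n. u n \<in> D) \<and>
        uniform_limit {0..} u f sequentially \<and>
        uniform_limit {0..} (\<lambda>n. A (u n)) g sequentially)"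

definition feller_process ::
    "'a measure \<Rightarrow> (real \<Rightarrow> 'a measure) \<Rightarrow> (real \<Rightarrow> real \<Rightarrow> real measure) \<Rightarrow>
     (real \<Rightarrow> 'a \<Rightarrow> real) \<Rightarrow> bool" where
  "feller_process M F K X \<longleftrightarrow>
     feller_transition K \<and> adapted F X \<and>
     (\<forall>\<omega>\<in>space M. (\<forall>t\<ge>0. 0 \<le> X t \<omega>) \<and> cadlag (\<lambda>t. X t \<omega>)) \<and>
     (\<forall>s\<ge>0. \<forall>t\<ge>0. \<forall>f \<in> borel_measurable borel_nonneg. bounded (f ` {0..}) \<longrightarrow>
        (AE \<omega> in M. real_cond_exp M (F s) (\<lambda>\<omega>'. f (X (s + t) \<omega>')) \<omega>
                      = transition_op K t f (X s \<omega>)))"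


section \<open>The affine process and its Riccati equation\<close>

definition levy_measure :: "real measure \<Rightarrow> bool" where
  "levy_measure \<mu> \<longleftrightarrow> sets \<mu> = sets borel_nonneg \<and> emeasure \<mu> {0} = 0 \<and>
     (\<integral>\<^sup>+\<xi>. ennreal (min 1 (\<xi>\<^sup>2)) \<partial>\<mu>) < \<infinity>"

definition drift :: "real measure \<Rightarrow> real" where
  "drift \<mu> = (\<integral>\<xi>. (exp \<xi> - 1 - \<xi>) \<partial>\<mu>)"

definition affine_generator ::
    "real measure \<Rightarrow> (real \<Rightarrow> real) \<Rightarrow> real \<Rightarrow> real" where
  "affine_generator \<mu> f x =
     (let f' = vector_derivative f (at x within {0..})
      in - drift \<mu> * x * f' + x * (\<integral>\<xi>. (f (x + \<xi>) - f x - f' * \<xi>) \<partial>\<mu>))"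

definition riccati :: "real measure \<Rightarrow> real \<Rightarrow> real" where
  "riccati \<mu> u = (\<integral>\<xi>. (exp (u * \<xi>) - 1 - u * \<xi>) \<partial>\<mu>) - drift \<mu> * u"

definition riccati_solution :: "real measure \<Rightarrow> (real \<Rightarrow> real) \<Rightarrow> bool" where
  "riccati_solution \<mu> g \<longleftrightarrow> g 0 = 1 \<and>
     (\<forall>t\<ge>0. g t \<le> 1 \<and> (g has_real_derivative riccati \<mu> (g t)) (at t within {0..}))"

end

theory Submission
  imports Defs
begin

text \<open>
  The process has jump intensities proportional to its state, so expectations of $e^{uX_t}$ are
  governed by the Riccati equation $g' = R(g)$: for $0 < u < 1$,
  $E_x[e^{uX_t}] = e^{x\,\psi(t,u)}$ with $\partial_t\psi = R(\psi)$, $\psi(0,u) = u$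
  (\<open>mgf_clock\<close>). Here $R$ vanishes at 0 and at 1 and is negative in between, so $\psi(t,u)$
  is described by a clock, an antiderivative $G$ of $1/R$ on $(0,1)$: it is the point $v \le u$ with
  $G(v) = G(u) + t$. This $G$ decreases, and tends to infinity at 0. Everything hinges on whether
  it stays bounded below at 1, which is the integrability of $1/R$ there.

  If $G$ is unbounded below, $\psi(t,u) \to 1$ as $u \to 1$ for every $t$, hence $E_x[e^{X_t}] = e^x$ for
  all $x$, and $e^X$ is a martingale by the Markov property (\<open>exp_conserved\<close>). Otherwise
  $\psi(t,u)$ stays below some $v < 1$, so $E_x[e^{X_t}] \le e^{vx} < e^x$ and mass is lost
  (\<open>exp_lost\<close>). The same dichotomy is Osgood's uniqueness criterion: inverting such a clock
  gives a solution that leaves 1, and along any solution that leaves 1 the clock runs at unit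
  speed, hence is bounded below (\<open>clock_bounded_iff_nonunique\<close>).

  The moment formula is reached from the generator on smooth functions with compact support as
  follows. The function $e^{ux}$ is approximated by smooth concave truncations that are
  eventually constant. As $R(1) = 0$ makes $e^x$ formally harmonic, its concave truncations are
  superharmonic, whence $E_x[e^{X_t}] \le e^x$. This bound dominates $y\,e^{uy}$ for
  $u < 1$, so Dynkin's formula passes to the limit and says that $m(t,u) = E_x[e^{uX_t}]$ solves
  $\partial_t m = R(u)\,\partial_u m$; it is then constant along characteristics.

  For the local martingale property $X$ is stopped when it first exceeds $n$. The overshoot is
  controlled by stopping on a time grid of mesh $\delta$: before that time $X \le n$, so one step
  changes $E[e^{uX}]$ by at most $n e^n (u - v)$ where $G(v) = G(u) + \delta$, and
  $(u - v)/\delta \to -R(u)$. Refining the grid and then letting $u \to 1$ makes the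
  accumulated loss vanish because $R(1) = 0$ (\<open>stopped_exp_increment\<close>).
\<close>

section \<open>Smooth concave truncations of the exponential function\<close>

text \<open>A family of smooth functions vanishing to infinite order at 0. It is closed under
  differentiation, which reduces smoothness to one computation.\<close>

definition flat :: "real poly \<Rightarrow> real \<Rightarrow> real" where
  "flat p s = (if s > 0 then poly p (1 / s) * exp (- 2 / s) else 0)"

lemma flat_scale: "(\<And>z. poly p z = c * poly q z) \<Longrightarrow> flat p s = c * flat q s"
  by (simp add: flat_def)

lemma poly_times_exp_tendsto_0:
  fixes p :: "real poly"
  shows "((\<lambda>z. poly p z * exp (- 2 * z)) \<longlongrightarrow> 0) at_top"
proof -
  have 1: "((\<lambda>z::real. z ^ i * exp (- z)) \<longlongrightarrow> 0) at_top" for i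
    using tendsto_power_div_exp_0[of i] by (simp add: exp_minus field_simps)
  have "((\<lambda>z::real. z ^ i * exp (- 2 * z)) \<longlongrightarrow> 0) at_top" for i
  proof -
    have "((\<lambda>z::real. z ^ i * exp (- z) * (z ^ 0 * exp (- z))) \<longlongrightarrow> 0) at_top"
      using tendsto_mult[OF 1[of i] 1[of 0]] by simp
    then show ?thesis by (simp add: mult.assoc flip: exp_add)
  qed
  then have "((\<lambda>z. \<Sum>i\<le>degree p. coeff p i * (z ^ i * exp (- 2 * z))) \<longlongrightarrow> (\<Sum>i\<le>degree p. coeff p i * 0)) at_top"
    by (intro tendsto_sum tendsto_mult tendsto_const) auto
  then show ?thesis by (simp add: poly_altdef sum_distrib_right mult.assoc)
qed

lemma flat_has_derivative:
  "(flat p has_real_derivative flat (monom 1 2 * (smult 2 p - pderiv p)) s) (at s)"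
proof -
  consider "s > 0" | "s < 0" | "s = 0" by linarith
  then show ?thesis
  proof cases
    case 1
    have "((\<lambda>s. poly p (1 / s) * exp (- 2 / s)) has_real_derivative
            poly (pderiv p) (1 / s) * (- 1 / s\<^sup>2) * exp (- 2 / s) + poly p (1 / s) * (exp (- 2 / s) * (2 / s\<^sup>2))) (at s)"
      using 1 by (auto intro!: derivative_eq_intros DERIV_chain2[OF poly_DERIV] simp: power2_eq_square)
    also have "poly (pderiv p) (1 / s) * (- 1 / s\<^sup>2) * exp (- 2 / s) + poly p (1 / s) * (exp (- 2 / s) * (2 / s\<^sup>2))
        = flat (monom 1 2 * (smult 2 p - pderiv p)) s"
      using 1 by (simp add: flat_def poly_monom field_simps)
    finally have "((\<lambda>s. poly p (1 / s) * exp (- 2 / s)) has_real_derivative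
        flat (monom 1 2 * (smult 2 p - pderiv p)) s) (at s)" .
    then show ?thesis
      by (rule has_field_derivative_transform_within_open[where S = "{0<..}"]) (use 1 in \<open>auto simp: flat_def\<close>)
  next
    case 2
    have "((\<lambda>_. 0) has_real_derivative flat (monom 1 2 * (smult 2 p - pderiv p)) s) (at s)"
      using 2 by (simp add: flat_def)
    then show ?thesis
      by (rule has_field_derivative_transform_within_open[where S = "{..<0}"]) (use 2 in \<open>auto simp: flat_def\<close>)
  next
    case 3
    have "((\<lambda>h. flat p h / h) \<longlongrightarrow> 0) (at_left 0)"
      by (rule tendsto_eventually) (auto simp: eventually_at_filter flat_def)
    moreover have "((\<lambda>h. flat p h / h) \<longlongrightarrow> 0) (at_right 0)"
    proof -
      have "((\<lambda>z. poly (pCons 0 p) z * exp (- 2 * z)) \<longlongrightarrow> 0) at_top"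
        by (rule poly_times_exp_tendsto_0)
      then have "((\<lambda>h. poly (pCons 0 p) (inverse h) * exp (- 2 * inverse h)) \<longlongrightarrow> 0) (at_right 0)"
        by (rule filterlim_compose[OF _ filterlim_inverse_at_top_right])
      moreover have "\<forall>\<^sub>F h in at_right 0. poly (pCons 0 p) (inverse h) * exp (- 2 * inverse h) = flat p h / h"
        by (auto simp: eventually_at_filter flat_def field_simps)
      ultimately show ?thesis by (rule Lim_transform_eventually)
    qed
    ultimately have "((\<lambda>h. flat p h / h) \<longlongrightarrow> 0) (at 0)"
      by (simp add: filterlim_split_at)
    then show ?thesis using 3 by (simp add: DERIV_def flat_def)
  qed
qed

text \<open>On $[0,1)$ this is $(1 - e^{-2v/(1-v)})/2$, and it is constant from 1 on. The factor 2 in the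
  exponent is what makes it concave on all of $[0,1)$; the normalisation gives value 0 and slope 1
  at 0.\<close>

definition soft_cap :: "real \<Rightarrow> real" where
  "soft_cap v = (1 - exp 2 * flat 1 (1 - v)) / 2"

definition soft_cap' :: "real \<Rightarrow> real" where
  "soft_cap' v = exp 2 * flat (monom 1 2) (1 - v)"

definition soft_cap'' :: "real \<Rightarrow> real" where
  "soft_cap'' v = - exp 2 * flat (monom 2 4 - monom 2 3) (1 - v)"

lemma soft_cap_deriv: "(soft_cap has_real_derivative soft_cap' v) (at v)"
proof -
  have eq: "flat (monom 1 2 * (smult 2 1 - pderiv 1)) (1 - v) = 2 * flat (monom 1 2) (1 - v)"
    by (rule flat_scale) (simp add: poly_monom del: mult_smult_right)
  have "((\<lambda>v. flat 1 (1 - v)) has_real_derivative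
      flat (monom 1 2 * (smult 2 1 - pderiv 1)) (1 - v) * (- 1)) (at v)"
    by (rule DERIV_chain2[OF flat_has_derivative]) (auto intro!: derivative_eq_intros)
  from this[unfolded eq] show ?thesis unfolding soft_cap_def[abs_def] soft_cap'_def
    by (auto intro!: derivative_eq_intros)
qed

lemma soft_cap'_deriv: "(soft_cap' has_real_derivative soft_cap'' v) (at v)"
proof -
  have eq: "flat (monom 1 2 * (smult 2 (monom 1 2) - pderiv (monom 1 2))) (1 - v) = flat (monom 2 4 - monom 2 3) (1 - v)"
    by (simp add: flat_def poly_monom pderiv_monom power2_eq_square power4_eq_xxxx power3_eq_cube field_simps)
  have "((\<lambda>v. flat (monom 1 2) (1 - v)) has_real_derivative
      flat (monom 1 2 * (smult 2 (monom 1 2) - pderiv (monom 1 2))) (1 - v) * (- 1)) (at v)"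
    by (rule DERIV_chain2[OF flat_has_derivative]) (auto intro!: derivative_eq_intros)
  from this[unfolded eq] show ?thesis unfolding soft_cap'_def[abs_def] soft_cap''_def
    by (auto intro!: derivative_eq_intros)
qed

lemma soft_cap_0 [simp]: "soft_cap 0 = 0" and soft_cap'_0 [simp]: "soft_cap' 0 = 1"
  using exp_minus_inverse[of "2::real"] by (simp_all add: soft_cap_def soft_cap'_def flat_def poly_monom)

lemma soft_cap'_nonneg: "0 \<le> soft_cap' v"
  by (simp add: soft_cap'_def flat_def poly_monom)

text \<open>In the variable $z = 1/(1-v) \ge 1$ the second derivative is $-2e^2(z^4-z^3)e^{-2z}$. The second
  bound says that $h''(v) = O(1/v)$, the scale-invariant form that survives the rescaling in
  \<open>trunc_exp\<close>.\<close>

lemma soft_cap''_bounds: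
  assumes "0 \<le> v" shows "soft_cap'' v \<le> 0" "v * \<bar>soft_cap'' v\<bar> \<le> 8 * exp 2"
proof -
  have "soft_cap'' v \<le> 0 \<and> v * \<bar>soft_cap'' v\<bar> \<le> 8 * exp 2"
  proof (cases "v < 1")
    case True
    define z where "z = 1 / (1 - v)"
    have z: "1 \<le> z" "v = 1 - 1 / z" using True assms by (auto simp: z_def field_simps)
    have eq: "soft_cap'' v = - exp 2 * ((2 * z^4 - 2 * z^3) * exp (- 2 * z))"
      using True by (simp add: soft_cap''_def flat_def poly_monom z_def)
    have le: "2 * z ^ 3 \<le> 2 * z ^ 4" using z(1) by (simp add: power_increasing)
    have 1: "soft_cap'' v \<le> 0" unfolding eq using le by (simp add: mult_nonneg_nonneg)
    have "v * \<bar>soft_cap'' v\<bar> = v * (exp 2 * ((2 * z^4 - 2 * z^3) * exp (- 2 * z)))"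
      using 1 by (simp add: eq)
    also have "\<dots> \<le> 1 * (exp 2 * ((2 * z^4 - 2 * z^3) * exp (- 2 * z)))"
      using le True assms by (intro mult_right_mono) auto
    also have "\<dots> \<le> exp 2 * (2 * z^4 * exp (- 2 * z))" using z(1) by simp
    also have "2 * z^4 * exp (- 2 * z) = 2 * (z\<^sup>2 * exp (- z))\<^sup>2"
      by (simp add: power_mult_distrib exp_minus power_inverse flip: exp_double)
    also have "z\<^sup>2 * exp (- z) \<le> 2"
      using exp_lower_Taylor_quadratic[of z] z(1) by (simp add: exp_minus field_simps)
    then have "2 * (z\<^sup>2 * exp (- z))\<^sup>2 \<le> 2 * 2\<^sup>2" by (intro mult_left_mono power_mono) auto
    finally show ?thesis using 1 by simp
  qed (simp add: soft_cap''_def flat_def)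
  then show "soft_cap'' v \<le> 0" "v * \<bar>soft_cap'' v\<bar> \<le> 8 * exp 2" by auto
qed

lemma soft_cap'_antimono:
  assumes "0 \<le> v" "v \<le> w" shows "soft_cap' w \<le> soft_cap' v"
proof (rule DERIV_nonpos_imp_nonincreasing[OF assms(2)])
  fix x assume "v \<le> x"
  then show "\<exists>y. (soft_cap' has_real_derivative y) (at x) \<and> y \<le> 0"
    using assms soft_cap''_bounds(1)[of x] by (intro exI[of _ "soft_cap'' x"]) (simp add: soft_cap'_deriv)
qed

lemma soft_cap'_le_1: "0 \<le> v \<Longrightarrow> soft_cap' v \<le> 1"
  using soft_cap'_antimono[of 0 v] by simp

lemma soft_cap_mono: "v \<le> w \<Longrightarrow> soft_cap v \<le> soft_cap w"
  by (rule DERIV_nonneg_imp_nondecreasing[of v w soft_cap]) (use soft_cap_deriv soft_cap'_nonneg in auto)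

lemma soft_cap_upper:
  assumes "0 \<le> v" "v \<le> w" shows "soft_cap w - soft_cap v \<le> soft_cap' v * (w - v)"
proof (cases "v = w")
  case False
  then have "v < w" using assms by simp
  then obtain c where c: "v < c" "c < w" "soft_cap w - soft_cap v = (w - v) * soft_cap' c"
    using MVT2[of v w soft_cap soft_cap'] soft_cap_deriv by blast
  have "(w - v) * soft_cap' c \<le> (w - v) * soft_cap' v"
    using c assms by (intro mult_left_mono soft_cap'_antimono) auto
  then show ?thesis using c by (simp add: mult.commute)
qed simp

text \<open>A second-order Taylor bound: on $[v,w]$ the second derivative is at most $8e^2/v$ in
  absolute value.\<close>

lemma soft_cap_lower:
  assumes "0 < v" "v \<le> w" shows "soft_cap w - soft_cap v \<ge> soft_cap' v * (w - v) - 8 * exp 2 * (w - v)\<^sup>2 / v"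
proof (cases "v = w")
  case False
  then have "v < w" using assms by simp
  then obtain c where c: "v < c" "c < w" "soft_cap w - soft_cap v = (w - v) * soft_cap' c"
    using MVT2[of v w soft_cap soft_cap'] soft_cap_deriv by blast
  obtain e where e: "v < e" "e < c" "soft_cap' c - soft_cap' v = (c - v) * soft_cap'' e"
    using MVT2[of v c soft_cap' soft_cap''] soft_cap'_deriv c by blast
  have "\<bar>soft_cap'' e\<bar> \<le> 8 * exp 2 / e"
    using soft_cap''_bounds(2)[of e] e assms by (simp add: field_simps)
  also have "\<dots> \<le> 8 * exp 2 / v" using e assms by (simp add: frac_le)
  finally have "(c - v) * \<bar>soft_cap'' e\<bar> \<le> (w - v) * (8 * exp 2 / v)"
    using c assms by (intro mult_mono) auto
  then have "soft_cap' c \<ge> soft_cap' v - (w - v) * (8 * exp 2 / v)"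
    using e abs_le_D2 c(1) by (smt (verit, best) mult_minus_right mult_left_mono)
  then have "(w - v) * soft_cap' c \<ge> (w - v) * (soft_cap' v - (w - v) * (8 * exp 2 / v))"
    using assms by (intro mult_left_mono) auto
  then show ?thesis using c by (simp add: algebra_simps power2_eq_square)
qed simp

lemma soft_cap_le: "0 \<le> v \<Longrightarrow> soft_cap v \<le> v"
  using soft_cap_upper[of 0 v] by simp

lemma soft_cap_nonneg: "0 \<le> v \<Longrightarrow> 0 \<le> soft_cap v"
  using soft_cap_mono[of 0 v] by simp

text \<open>These increase to $e^{ux}$ as $N \to \infty$ and equal $N/2$ for large $x$, so that
  $N/2$ minus such a function has compact support.\<close>

definition trunc_exp :: "real \<Rightarrow> real \<Rightarrow> real \<Rightarrow> real" where
  "trunc_exp u N x = N * soft_cap (exp (u * x) / N)"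

definition trunc_exp' :: "real \<Rightarrow> real \<Rightarrow> real \<Rightarrow> real" where
  "trunc_exp' u N x = u * exp (u * x) * soft_cap' (exp (u * x) / N)"

lemma trunc_exp_deriv:
  assumes "N > 0" shows "(trunc_exp u N has_real_derivative trunc_exp' u N x) (at x within S)"
proof -
  have "((\<lambda>x. exp (u * x)) has_real_derivative u * exp (u * x)) (at x within S)"
    by (rule derivative_eq_intros refl | simp)+
  then have "((\<lambda>x. exp (u * x) / N) has_real_derivative u * exp (u * x) / N) (at x within S)"
    by (rule DERIV_cdivide)
  then have "((\<lambda>x. soft_cap (exp (u * x) / N)) has_real_derivative
      soft_cap' (exp (u * x) / N) * (u * exp (u * x) / N)) (at x within S)"
    by (rule DERIV_chain2[OF soft_cap_deriv])
  then have "((\<lambda>x. N * soft_cap (exp (u * x) / N)) has_real_derivative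
      N * (soft_cap' (exp (u * x) / N) * (u * exp (u * x) / N))) (at x within S)"
    by (rule DERIV_cmult)
  moreover have "N * (a * (b / N)) = b * a" for a b using assms by simp
  ultimately show ?thesis unfolding trunc_exp_def[abs_def] trunc_exp'_def by (simp only:)
qed

lemma trunc_exp_bounds:
  assumes "N > 0" shows "0 \<le> trunc_exp u N x" "trunc_exp u N x \<le> exp (u * x)"
proof -
  have v: "0 \<le> exp (u * x) / N" using assms by simp
  show "0 \<le> trunc_exp u N x" unfolding trunc_exp_def
    using assms soft_cap_nonneg[OF v] by (intro mult_nonneg_nonneg) linarith+
  have "trunc_exp u N x \<le> N * (exp (u * x) / N)" unfolding trunc_exp_def
    using soft_cap_le[OF v] assms by (intro mult_left_mono) linarith+
  then show "trunc_exp u N x \<le> exp (u * x)" using assms by simp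
qed

lemma soft_cap_scaled_tendsto:
  "((\<lambda>N. N * soft_cap (Y / N)) \<longlongrightarrow> Y) at_top"
proof (cases "Y = 0")
  case False
  have "((\<lambda>h. (soft_cap h - soft_cap 0) / (h - 0)) \<longlongrightarrow> soft_cap' 0) (at 0)"
    using soft_cap_deriv[of 0] by (simp add: has_field_derivative_iff)
  moreover have "filterlim (\<lambda>N. Y / N) (at 0) at_top"
  proof -
    have "((\<lambda>N. Y / N) \<longlongrightarrow> 0) at_top"
      by (rule real_tendsto_divide_at_top[OF tendsto_const filterlim_ident])
    then show ?thesis
      using False by (auto simp: filterlim_at intro: eventually_mono[OF eventually_gt_at_top[of 0]])
  qed
  ultimately have "((\<lambda>N. (soft_cap (Y / N) - soft_cap 0) / (Y / N - 0)) \<longlongrightarrow> soft_cap' 0) at_top"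
    by (rule filterlim_compose)
  then have "((\<lambda>N. Y * ((soft_cap (Y / N) - soft_cap 0) / (Y / N - 0))) \<longlongrightarrow> Y * soft_cap' 0) at_top"
    by (intro tendsto_mult tendsto_const)
  then show ?thesis using False by (simp add: mult.commute)
qed (auto intro!: tendsto_eventually)

lemma trunc_exp_tendsto: "((\<lambda>N. trunc_exp u N x) \<longlongrightarrow> exp (u * x)) at_top"
  unfolding trunc_exp_def by (rule soft_cap_scaled_tendsto)

lemma trunc_exp'_tendsto: "((\<lambda>N. trunc_exp' u N x) \<longlongrightarrow> u * exp (u * x)) at_top"
proof -
  have "((\<lambda>N. exp (u * x) / N) \<longlongrightarrow> 0) at_top"
    by (rule real_tendsto_divide_at_top[OF tendsto_const filterlim_ident])
  moreover have "isCont soft_cap' 0" using soft_cap'_deriv DERIV_isCont by blast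
  ultimately have "((\<lambda>N. soft_cap' (exp (u * x) / N)) \<longlongrightarrow> soft_cap' 0) at_top"
    by (metis isCont_tendsto_compose)
  then have "((\<lambda>N. u * exp (u * x) * soft_cap' (exp (u * x) / N)) \<longlongrightarrow> u * exp (u * x) * soft_cap' 0) at_top"
    by (intro tendsto_mult tendsto_const)
  then show ?thesis by (simp add: trunc_exp'_def)
qed

lemma flat_smooth_derivs:
  "\<exists>D. D 0 = (\<lambda>x. flat 1 (1 - exp (u * x) / N)) \<and>
     (\<forall>n x. (D n has_real_derivative D (Suc n) x) (at x))" if "N > 0"
proof -
  \<comment> \<open>With \<open>z = 1/(1 - e^{ux}/N)\<close>, differentiation in \<open>x\<close> acts on \<open>p(z) e^{-2z}\<close> as \<open>u (z^2 - z)\<close>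
     times \<open>d/dz\<close>, hence maps \<open>p\<close> to \<open>(z^2 - z)(p' - 2p)\<close> up to the factor \<open>u\<close>.\<close>
  define nxt where "nxt p = [:0, -1, 1:] * (pderiv p - smult 2 p)" for p :: "real poly"
  define q where "q n = (nxt ^^ n) 1" for n
  define D where "D n x = u ^ n * flat (q n) (1 - exp (u * x) / N)" for n x
  have "(D n has_real_derivative D (Suc n) x) (at x)" for n x
  proof -
    let ?s = "1 - exp (u * x) / N"
    let ?p = "q n"
    have "((\<lambda>x. flat ?p (1 - exp (u * x) / N)) has_real_derivative
        flat (monom 1 2 * (smult 2 ?p - pderiv ?p)) ?s * (- (u * exp (u * x) / N))) (at x)"
      using that by (intro DERIV_chain2[OF flat_has_derivative]) (auto intro!: derivative_eq_intros)
    also have "flat (monom 1 2 * (smult 2 ?p - pderiv ?p)) ?s * (- (u * exp (u * x) / N)) =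
        u * flat (nxt ?p) ?s"
    proof (cases "?s > 0")
      case True
      define z where "z = 1 / ?s"
      have z: "z > 0" "exp (u * x) / N = 1 - 1 / z" using True by (auto simp: z_def)
      have e: "- (u * exp (u * x) / N) = - (u * (1 - 1 / z))" by (simp only: z(2)[symmetric] times_divide_eq_right)
      have "poly (monom 1 2 * (smult 2 ?p - pderiv ?p)) z * (- (u * (1 - 1 / z))) = u * poly (nxt ?p) z"
        using z(1) by (simp add: nxt_def poly_monom field_simps power2_eq_square)
      moreover have fl: "flat p ?s = poly p z * exp (- 2 / ?s)" for p
        using True by (simp add: flat_def z_def)
      moreover have "a * E * c = u * (b * E)" if "a * c = u * b" for a b c E :: real
        using that by (metis mult.assoc mult.commute)
      ultimately show ?thesis unfolding fl e by blast
    qed (simp add: flat_def)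
    finally have "((\<lambda>x. u ^ n * flat ?p (1 - exp (u * x) / N)) has_real_derivative
        u ^ n * (u * flat (nxt ?p) ?s)) (at x)" by (rule DERIV_cmult)
    then show ?thesis by (simp add: D_def[abs_def] q_def mult.assoc mult.left_commute)
  qed
  moreover have "D 0 = (\<lambda>x. flat 1 (1 - exp (u * x) / N))" by (simp add: D_def[abs_def] q_def)
  ultimately show ?thesis by blast
qed

lemma trunc_exp_Cc_smooth:
  assumes "N > 0" "u > 0" shows "(\<lambda>x. N / 2 - trunc_exp u N x) \<in> Cc_smooth_nonneg"
proof -
  obtain D where D: "D 0 = (\<lambda>x. flat 1 (1 - exp (u * x) / N))"
     "\<And>n x. (D n has_real_derivative D (Suc n) x) (at x)" using flat_smooth_derivs[OF assms(1)] by blast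
  let ?c = "N * exp 2 / 2"
  have eq: "N / 2 - trunc_exp u N x = ?c * flat 1 (1 - exp (u * x) / N)" for x
    by (simp add: trunc_exp_def soft_cap_def field_simps)
  have 1: "N / 2 - trunc_exp u N x = 0" if "x > ln N / u" for x
  proof -
    have "ln N < u * x" using that assms by (simp add: field_simps)
    then have "N < exp (u * x)" using assms by (metis exp_less_mono exp_ln)
    then show ?thesis unfolding eq using assms by (simp add: flat_def)
  qed
  define E where "E n x = ?c * D n x" for n x
  have 2: "E 0 = (\<lambda>x. N / 2 - trunc_exp u N x)"
    by (rule ext) (simp only: E_def eq D(1))
  have 3: "(E n has_real_derivative E (Suc n) x) (at x within {0..})" for n x
    unfolding E_def[abs_def] by (rule DERIV_cmult[OF has_field_derivative_at_within[OF D(2)]])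
  show ?thesis unfolding Cc_smooth_nonneg_def mem_Collect_eq
    by (intro conjI exI[of _ E] exI[of _ "ln N / u"] allI impI 1 2 3)
qed

lemma exp_quadratic_lower: "0 \<le> (x::real) \<Longrightarrow> x\<^sup>2 / 2 \<le> exp x - 1 - x"
  using exp_lower_Taylor_quadratic[of x] by simp

lemma exp_remainder_nonneg: "0 \<le> exp (x::real) - 1 - x"
  using exp_ge_add_one_self[of x] by linarith

lemma exp_remainder_mono:
  assumes "0 \<le> (x::real)" "x \<le> y" shows "exp x - 1 - x \<le> exp y - 1 - y"
proof (rule DERIV_nonneg_imp_nondecreasing[OF assms(2), of "\<lambda>x. exp x - 1 - x"])
  fix z assume "x \<le> z"
  moreover have "((\<lambda>x. exp x - 1 - x) has_real_derivative exp z - 1) (at z)"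
    by (auto intro!: derivative_eq_intros)
  ultimately show "\<exists>y. ((\<lambda>x. exp x - 1 - x) has_real_derivative y) (at z) \<and> 0 \<le> y"
    using assms(1) by (intro exI[of _ "exp z - 1"]) auto
qed

abbreviation trunc_rem :: "real \<Rightarrow> real \<Rightarrow> real \<Rightarrow> real \<Rightarrow> real" where
  "trunc_rem u N x \<xi> \<equiv> trunc_exp u N (x + \<xi>) - trunc_exp u N x - trunc_exp' u N x * \<xi>"

text \<open>The first bound is concavity of the cap. The second one is uniform in $N$ and dominates the integrand of the generator by a multiple of
  $e^{ux}(e^\xi - 1 - \xi)$, which is integrable in $\xi$; its lower half uses
  $e^{u\xi} \ge 1 + u\xi$, monotonicity of the cap and \<open>soft_cap_lower\<close>.\<close>

lemma trunc_exp_remainder: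
  assumes "N > 0" "0 < u" "u \<le> 1" "0 \<le> x" "0 \<le> \<xi>"
  shows "trunc_rem u N x \<xi>
           \<le> exp (u * x) * soft_cap' (exp (u * x) / N) * (exp (u * \<xi>) - 1 - u * \<xi>)" (is "?D \<le> ?U")
    and "\<bar>trunc_rem u N x \<xi>\<bar>
           \<le> 16 * exp 2 * exp (u * x) * (exp \<xi> - 1 - \<xi>)"
proof -
  define v where "v = exp (u * x) / N"
  define k where "k = u * \<xi>"
  define E where "E = exp k"
  have v: "v > 0" and Y: "exp (u * x) = N * v" using assms by (auto simp: v_def)
  have e: "exp (u * (x + \<xi>)) / N = v * E" by (simp add: v_def E_def k_def exp_add distrib_left)
  have E1: "1 \<le> E" and Ek: "1 + k \<le> E" and k0: "0 \<le> k"
    using assms exp_ge_add_one_self[of k] by (auto simp: E_def k_def)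
  have D: "?D = N * (soft_cap (v * E) - soft_cap v - soft_cap' v * v * k)"
    unfolding trunc_exp_def trunc_exp'_def e v_def[symmetric] by (simp add: Y k_def algebra_simps)
  have "soft_cap (v * E) - soft_cap v \<le> soft_cap' v * (v * E - v)"
    using v mult_left_mono[OF E1, of v] by (intro soft_cap_upper) auto
  then have "soft_cap (v * E) - soft_cap v - soft_cap' v * v * k \<le> v * soft_cap' v * (E - 1 - k)"
    by (simp add: algebra_simps)
  from mult_left_mono[OF this, of N] assms(1) show U: "?D \<le> ?U"
    unfolding D v_def[symmetric] E_def[symmetric] k_def[symmetric] Y by (simp add: mult.assoc)
  have kx: "k \<le> \<xi>" using assms mult_right_mono[of u 1 \<xi>] by (simp add: k_def)
  then have kap: "E - 1 - k \<le> exp \<xi> - 1 - \<xi>"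
    using exp_remainder_mono[OF k0 kx] by (simp add: E_def k_def)
  have kap0: "0 \<le> exp \<xi> - 1 - \<xi>" by (rule exp_remainder_nonneg)
  have "?U = (N * v) * soft_cap' v * (E - 1 - k)" using assms(1) by (simp add: Y E_def k_def)
  also have "\<dots> \<le> (N * v) * 1 * (exp \<xi> - 1 - \<xi>)"
    using kap soft_cap'_le_1[of v] v soft_cap'_nonneg[of v] Ek assms(1) by (intro mult_mono) auto
  also have "\<dots> \<le> 16 * exp 2 * (N * v) * (exp \<xi> - 1 - \<xi>)"
    using kap0 exp_ge_add_one_self[of 2] v assms(1) by (intro mult_right_mono) auto
  finally have up: "?D \<le> 16 * exp 2 * (N * v) * (exp \<xi> - 1 - \<xi>)" using U by linarith
  have "v * (1 + k) \<le> v * E" using v Ek by (intro mult_left_mono) auto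
  then have "soft_cap (v * E) \<ge> soft_cap (v + v * k)"
    by (intro soft_cap_mono) (simp add: distrib_left)
  moreover have "soft_cap (v + v * k) - soft_cap v \<ge> soft_cap' v * (v + v * k - v) - 8 * exp 2 * (v + v * k - v)\<^sup>2 / v"
    using v k0 by (intro soft_cap_lower) auto
  moreover have "8 * exp 2 * (v + v * k - v)\<^sup>2 / v = 8 * exp 2 * (v * k\<^sup>2)"
    using v by (simp add: power_mult_distrib power2_eq_square)
  ultimately have "soft_cap (v * E) - soft_cap v - soft_cap' v * v * k \<ge> - (8 * exp 2 * (v * k\<^sup>2))"
    by (simp add: mult.assoc)
  from mult_left_mono[OF this, of N] assms(1) have "?D \<ge> - (8 * exp 2 * (N * v) * k\<^sup>2)"
    unfolding D by (simp add: mult.assoc mult.left_commute[of N])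
  moreover have "k\<^sup>2 \<le> \<xi>\<^sup>2" using kx k0 by (intro power_mono) auto
  then have "k\<^sup>2 \<le> 2 * (exp \<xi> - 1 - \<xi>)" using exp_quadratic_lower[of \<xi>] assms by simp
  then have "8 * exp 2 * (N * v) * k\<^sup>2 \<le> 8 * exp 2 * (N * v) * (2 * (exp \<xi> - 1 - \<xi>))"
    using v assms(1) by (intro mult_left_mono) auto
  moreover have "8 * exp 2 * (N * v) * (2 * (exp \<xi> - 1 - \<xi>)) = 16 * exp 2 * (N * v) * (exp \<xi> - 1 - \<xi>)"
    by simp
  ultimately have "- ?D \<le> 16 * exp 2 * (N * v) * (exp \<xi> - 1 - \<xi>)" by linarith
  then show "\<bar>?D\<bar> \<le> 16 * exp 2 * exp (u * x) * (exp \<xi> - 1 - \<xi>)" unfolding Y using up by linarith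
qed

section \<open>The Riccati function and the generator on truncated exponentials\<close>

locale levy_exp =
  fixes \<mu> :: "real measure"
  assumes levy: "levy_measure \<mu>"
    and nonzero: "emeasure \<mu> (space \<mu>) \<noteq> 0"
    and exp_moment: "(\<integral>\<^sup>+\<xi>\<in>{1..}. ennreal (exp \<xi>) \<partial>\<mu>) < \<infinity>"
begin

abbreviation R :: "real \<Rightarrow> real" where
  "R \<equiv> riccati \<mu>"

lemma sets_mu: "sets \<mu> = sets borel_nonneg"
  using levy by (simp add: levy_measure_def)

lemma space_mu: "space \<mu> = {0..}"
  using sets_eq_imp_space_eq[OF sets_mu] by simp

lemma measurable_mu [measurable (raw)]: "f \<in> borel_measurable borel \<Longrightarrow> f \<in> borel_measurable \<mu>"
  unfolding measurable_cong_sets[OF sets_mu refl] by (rule measurable_restrict_space1)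

lemma exp_remainder_integrable: "integrable \<mu> (\<lambda>\<xi>. exp \<xi> - 1 - \<xi>)"
proof (rule integrableI_nonneg)
  show "(\<lambda>\<xi>. exp \<xi> - 1 - \<xi>) \<in> borel_measurable \<mu>" by measurable
  show "AE \<xi> in \<mu>. 0 \<le> exp \<xi> - 1 - \<xi>" by (rule AE_I2) (rule exp_remainder_nonneg)
  have le: "ennreal (exp \<xi> - 1 - \<xi>) \<le> ennreal (min 1 (\<xi>\<^sup>2)) + ennreal (exp \<xi>) * indicator {1..} \<xi>"
    if "\<xi> \<in> space \<mu>" for \<xi>
  proof (cases "\<xi> < 1")
    case True
    then have "exp \<xi> \<le> 1 + \<xi> + \<xi>\<^sup>2" "\<xi>\<^sup>2 \<le> 1"
      using exp_bound[of \<xi>] that by (auto simp: space_mu power_le_one)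
    then have "ennreal (exp \<xi> - 1 - \<xi>) \<le> ennreal (min 1 (\<xi>\<^sup>2))" by (intro ennreal_leI) simp
    then show ?thesis using True by simp
  next
    case False
    then have "ennreal (exp \<xi> - 1 - \<xi>) \<le> ennreal (exp \<xi>)" by (intro ennreal_leI) simp
    then show ?thesis using False by (simp add: add_increasing)
  qed
  have "(\<integral>\<^sup>+\<xi>. ennreal (exp \<xi> - 1 - \<xi>) \<partial>\<mu>)
      \<le> (\<integral>\<^sup>+\<xi>. ennreal (min 1 (\<xi>\<^sup>2)) + ennreal (exp \<xi>) * indicator {1..} \<xi> \<partial>\<mu>)"
    by (rule nn_integral_mono) (rule le)
  also have "\<dots> = (\<integral>\<^sup>+\<xi>. ennreal (min 1 (\<xi>\<^sup>2)) \<partial>\<mu>) + (\<integral>\<^sup>+\<xi>\<in>{1..}. ennreal (exp \<xi>) \<partial>\<mu>)"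
    by (rule nn_integral_add) measurable
  also have "\<dots> < \<infinity>" using levy exp_moment by (simp add: levy_measure_def)
  finally show "(\<integral>\<^sup>+\<xi>. ennreal (exp \<xi> - 1 - \<xi>) \<partial>\<mu>) < \<infinity>" .
qed

lemma AE_pos: "AE \<xi> in \<mu>. 0 < \<xi>"
proof -
  have "{0::real} \<inter> {0..} \<in> sets borel_nonneg"
    unfolding sets_restrict_space by (rule image_eqI[of _ _ "{0}"]) auto
  then have "{0} \<in> null_sets \<mu>"
    using levy unfolding levy_measure_def by (intro null_setsI) (simp_all add: sets_mu)
  then have "AE \<xi> in \<mu>. \<xi> \<notin> {0}" by (rule AE_not_in)
  then show ?thesis by (rule AE_mp) (auto intro!: AE_I2 simp: space_mu)
qed

lemma not_AE_False: "\<not> (AE \<xi> in \<mu>. False)"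
  using nonzero by (simp add: AE_iff_measurable[OF sets.top])

lemma exp_scale_bounds:
  fixes u \<xi> :: real
  assumes "0 \<le> u" "u \<le> 1" "0 \<le> \<xi>"
  shows "0 \<le> exp (u * \<xi>) - 1 - u * \<xi>" "exp (u * \<xi>) - 1 - u * \<xi> \<le> exp \<xi> - 1 - \<xi>"
  using assms mult_right_mono[of u 1 \<xi>] exp_remainder_mono[of "u * \<xi>" \<xi>] exp_remainder_nonneg[of "u * \<xi>"] by auto

lemma exp_scale_integrable:
  assumes "0 \<le> u" "u \<le> 1" shows "integrable \<mu> (\<lambda>\<xi>. exp (u * \<xi>) - 1 - u * \<xi>)"
proof (rule Bochner_Integration.integrable_bound[OF exp_remainder_integrable])
  show "AE \<xi> in \<mu>. norm (exp (u * \<xi>) - 1 - u * \<xi>) \<le> norm (exp \<xi> - 1 - \<xi>)"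
    using exp_scale_bounds[OF assms] by (intro AE_I2) (force simp: space_mu)
qed measurable

lemma drift_nonneg: "0 \<le> drift \<mu>"
  unfolding drift_def by (rule integral_nonneg_AE, rule AE_I2, rule exp_remainder_nonneg)

lemma riccati_0 [simp]: "R 0 = 0" and riccati_1 [simp]: "R 1 = 0"
  by (simp_all add: riccati_def drift_def)

text \<open>Inserting the definition of the drift, $-R(u)$ is the integral of
  $u(e^\xi-1) - (e^{u\xi}-1)$, which is positive for $\xi > 0$ by strict convexity of the
  exponential function.\<close>

lemma riccati_neg:
  assumes "0 < u" "u < 1" shows "R u < 0"
proof -
  let ?f = "\<lambda>\<xi>. u * (exp \<xi> - 1 - \<xi>) - (exp (u * \<xi>) - 1 - u * \<xi>)"
  have int: "integrable \<mu> ?f"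
    using assms by (intro Bochner_Integration.integrable_diff integrable_mult_right exp_remainder_integrable exp_scale_integrable) auto
  have eq: "- R u = integral\<^sup>L \<mu> ?f"
    unfolding riccati_def drift_def using assms
    by (subst Bochner_Integration.integral_diff) (auto intro!: exp_remainder_integrable exp_scale_integrable)
  have pos: "0 < ?f \<xi>" if xi: "0 < \<xi>" for \<xi>
  proof -
    have "exp ((1 - u) * 0 + u * \<xi>) < (1 - u) * exp 0 + u * exp \<xi>"
    proof -

      obtain a where a: "0 < a" "a < u * \<xi>" "exp (u * \<xi>) - exp 0 = (u * \<xi> - 0) * exp a"
        using MVT2[of 0 "u * \<xi>" exp exp] mult_pos_pos[OF assms(1) xi] DERIV_exp by blast
      have "u * \<xi> < \<xi>" using assms xi by simp
      then obtain c where c: "u * \<xi> < c" "c < \<xi>" "exp \<xi> - exp (u * \<xi>) = (\<xi> - u * \<xi>) * exp c"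
        using MVT2[of "u * \<xi>" \<xi> exp exp] DERIV_exp by blast
      have "exp a < exp c" using a c by simp
      then have "(1 - u) * (u * \<xi> * exp a) < (1 - u) * (u * \<xi> * exp c)"
        using assms xi by (intro mult_strict_left_mono) auto
      then have "(1 - u) * (exp (u * \<xi>) - 1) < u * (exp \<xi> - exp (u * \<xi>))"
      proof -
        have "(1 - u) * (exp (u * \<xi>) - 1) = (1 - u) * (u * \<xi> * exp a)" using a by simp
        moreover have "u * (exp \<xi> - exp (u * \<xi>)) = (1 - u) * (u * \<xi> * exp c)"
          unfolding c(3) by (simp add: algebra_simps)
        ultimately show ?thesis using \<open>(1 - u) * (u * \<xi> * exp a) < (1 - u) * (u * \<xi> * exp c)\<close> by linarith
      qed
      then show ?thesis by (simp add: algebra_simps)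
    qed
    then show ?thesis by (simp add: algebra_simps)
  qed
  have "AE \<xi> in \<mu>. 0 \<le> ?f \<xi>" using AE_pos by eventually_elim (rule less_imp_le[OF pos])
  then have "0 \<le> integral\<^sup>L \<mu> ?f" by (rule integral_nonneg_AE)
  moreover have "integral\<^sup>L \<mu> ?f \<noteq> 0"
  proof
    assume "integral\<^sup>L \<mu> ?f = 0"
    then have "AE \<xi> in \<mu>. ?f \<xi> = 0"
      using integral_nonneg_eq_0_iff_AE[OF int \<open>AE \<xi> in \<mu>. 0 \<le> ?f \<xi>\<close>] by blast
    with AE_pos have "AE \<xi> in \<mu>. False" by eventually_elim (use pos in fastforce)
    then show False using not_AE_False by blast
  qed
  ultimately show ?thesis using eq by linarith
qed

text \<open>This linear bound at 0 keeps solutions that start in $(0,1)$ from reaching 0.\<close>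

lemma riccati_lower:
  assumes "0 \<le> u" "u \<le> 1" shows "- R u \<le> drift \<mu> * u"
proof -
  have "0 \<le> (LINT \<xi>|\<mu>. (exp (u * \<xi>) - 1 - u * \<xi>))"
    by (rule integral_nonneg_AE, rule AE_I2, rule exp_remainder_nonneg)
  then show ?thesis by (simp add: riccati_def)
qed

lemma drift_pos: "0 < drift \<mu>"
  using riccati_lower[of "1/2"] riccati_neg[of "1/2"] drift_nonneg by (cases "drift \<mu> = 0") auto

lemma riccati_continuous: "continuous_on {0..1} (R)"
proof -
  have "continuous_on {0..1} (\<lambda>u. \<integral>\<xi>. (exp (u * \<xi>) - 1 - u * \<xi>) \<partial>\<mu>)"
    unfolding continuous_on_sequentially
  proof (intro allI ballI impI)
    fix s and a :: real assume s: "a \<in> {0..1}" "(\<forall>n. s n \<in> {0..1}) \<and> s \<longlonglongrightarrow> a"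
    have "(\<lambda>n. \<integral>\<xi>. (exp (s n * \<xi>) - 1 - s n * \<xi>) \<partial>\<mu>) \<longlonglongrightarrow> (LINT \<xi>|\<mu>. (exp (a * \<xi>) - 1 - a * \<xi>))"
    proof (rule integral_dominated_convergence)
      show "integrable \<mu> (\<lambda>\<xi>. exp \<xi> - 1 - \<xi>)" by (rule exp_remainder_integrable)
      show "AE \<xi> in \<mu>. (\<lambda>n. exp (s n * \<xi>) - 1 - s n * \<xi>) \<longlonglongrightarrow> exp (a * \<xi>) - 1 - a * \<xi>"
        using s by (intro AE_I2 tendsto_intros) auto
      show "AE \<xi> in \<mu>. norm (exp (s n * \<xi>) - 1 - s n * \<xi>) \<le> exp \<xi> - 1 - \<xi>" for n
        using exp_scale_bounds[of "s n"] s by (intro AE_I2) (force simp: space_mu)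
    qed measurable
    then show "((\<lambda>u. \<integral>\<xi>. (exp (u * \<xi>) - 1 - u * \<xi>) \<partial>\<mu>) \<circ> s) \<longlonglongrightarrow> (LINT \<xi>|\<mu>. (exp (a * \<xi>) - 1 - a * \<xi>))"
      by (simp add: o_def)
  qed
  then show ?thesis unfolding riccati_def[abs_def] by (intro continuous_intros)
qed

text \<open>The generator applied formally to \<open>trunc_exp\<close>, which itself is only a constant away from
  a function in the core.\<close>

definition gen_trunc :: "real \<Rightarrow> real \<Rightarrow> real \<Rightarrow> real" where
  "gen_trunc u N x = - drift \<mu> * x * trunc_exp' u N x
     + x * (LINT \<xi>|\<mu>. trunc_rem u N x \<xi>)"

lemma affine_generator_trunc_exp:
  assumes "N > 0" "x \<ge> 0"
  shows "affine_generator \<mu> (\<lambda>x. N / 2 - trunc_exp u N x) x = - gen_trunc u N x"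
proof -
  have ne: "at x within {0..} \<noteq> bot"
  proof
    assume "at x within {0..} = bot"
    moreover have "at_right x \<le> at x within {0..}" using assms(2) by (intro at_le) auto
    ultimately have "at_right x = bot" by (metis bot.extremum_uniqueI)
    then show False using trivial_limit_at_right_real[of x] by contradiction
  qed
  have "((\<lambda>x. N / 2 - trunc_exp u N x) has_real_derivative 0 - trunc_exp' u N x) (at x within {0..})"
    by (rule DERIV_diff[OF DERIV_const trunc_exp_deriv[OF assms(1)]])
  then have "vector_derivative (\<lambda>x. N / 2 - trunc_exp u N x) (at x within {0..}) = - trunc_exp' u N x"
    using ne by (intro vector_derivative_within) (auto simp: has_real_derivative_iff_has_vector_derivative)
  moreover have "(LINT \<xi>|\<mu>. (N / 2 - trunc_exp u N (x + \<xi>) - (N / 2 - trunc_exp u N x) - - trunc_exp' u N x * \<xi>))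
     = - (LINT \<xi>|\<mu>. trunc_rem u N x \<xi>)"
    unfolding Bochner_Integration.integral_minus[symmetric] by (rule Bochner_Integration.integral_cong) auto
  ultimately show ?thesis by (simp add: affine_generator_def gen_trunc_def Let_def algebra_simps)
qed

lemma trunc_exp_measurable [measurable]: "trunc_exp u N \<in> borel_measurable borel" if "N > 0"
  using trunc_exp_deriv[OF that, of u _ UNIV]
  by (intro borel_measurable_continuous_onI) (meson DERIV_continuous_on)

lemma trunc_exp_remainder_measurable:
  assumes "N > 0"
  shows "(\<lambda>\<xi>. trunc_rem u N x \<xi>) \<in> borel_measurable \<mu>"
proof -
  note [measurable] = trunc_exp_measurable[OF assms, of u]
  show ?thesis by measurable
qed

lemma trunc_exp_remainder_integrable:
  assumes "N > 0" "0 < u" "u \<le> 1" "0 \<le> x"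
  shows "integrable \<mu> (\<lambda>\<xi>. trunc_rem u N x \<xi>)"
proof (rule Bochner_Integration.integrable_bound)
  show "integrable \<mu> (\<lambda>\<xi>. 16 * exp 2 * exp (u * x) * (exp \<xi> - 1 - \<xi>))"
    by (intro integrable_mult_right exp_remainder_integrable)
  show "AE \<xi> in \<mu>. norm (trunc_rem u N x \<xi>)
      \<le> norm (16 * exp 2 * exp (u * x) * (exp \<xi> - 1 - \<xi>))"
  proof (rule AE_I2)
    fix \<xi> assume "\<xi> \<in> space \<mu>"
    then have "0 \<le> \<xi>" by (simp add: space_mu)
    from trunc_exp_remainder(2)[OF assms this]
    show "norm (trunc_rem u N x \<xi>)
      \<le> norm (16 * exp 2 * exp (u * x) * (exp \<xi> - 1 - \<xi>))"
      unfolding real_norm_def by (rule order_trans) (rule abs_ge_self)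
  qed
qed (rule trunc_exp_remainder_measurable[OF assms(1)])

text \<open>The untruncated value is $x e^x R(1) = 0$, and concavity can only decrease it.\<close>

lemma gen_trunc_nonpos:
  assumes "N > 0" "0 \<le> x" shows "gen_trunc 1 N x \<le> 0"
proof -
  let ?c = "exp x * soft_cap' (exp x / N)"
  have "(LINT \<xi>|\<mu>. (trunc_rem 1 N x \<xi>))
      \<le> (LINT \<xi>|\<mu>. ?c * (exp \<xi> - 1 - \<xi>))"
    using trunc_exp_remainder_integrable[of N 1 x] trunc_exp_remainder(1)[of N 1 x] assms
    by (intro integral_mono integrable_mult_right exp_remainder_integrable) (auto simp: space_mu)
  also have "\<dots> = ?c * drift \<mu>" by (simp add: drift_def)
  finally have le: "x * (LINT \<xi>|\<mu>. (trunc_rem 1 N x \<xi>)) \<le> x * (?c * drift \<mu>)"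
    using assms by (intro mult_left_mono)
  have "- drift \<mu> * x * trunc_exp' 1 N x = - (x * (?c * drift \<mu>))"
    by (simp add: trunc_exp'_def)
  then show ?thesis unfolding gen_trunc_def using le by linarith
qed

lemma gen_trunc_bound:
  assumes "N > 0" "0 < u" "u \<le> 1" "0 \<le> x"
  shows "\<bar>gen_trunc u N x\<bar> \<le> 17 * exp 2 * drift \<mu> * (x * exp (u * x))"
proof -
  have "\<bar>\<integral>\<xi>. (trunc_rem u N x \<xi>) \<partial>\<mu>\<bar>
      \<le> (LINT \<xi>|\<mu>. 16 * exp 2 * exp (u * x) * (exp \<xi> - 1 - \<xi>))"
    using trunc_exp_remainder_integrable[OF assms] trunc_exp_remainder(2)[OF assms]
    by (intro integral_abs_bound[THEN order_trans] integral_mono integrable_mult_right exp_remainder_integrable integrable_abs)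
      (auto simp: space_mu)
  also have "\<dots> = 16 * exp 2 * exp (u * x) * drift \<mu>" by (simp add: drift_def)
  finally have I: "\<bar>\<integral>\<xi>. (trunc_rem u N x \<xi>) \<partial>\<mu>\<bar>
      \<le> 16 * exp 2 * exp (u * x) * drift \<mu>" .
  let ?h = "soft_cap' (exp (u * x) / N)"
  have h: "0 \<le> ?h" "?h \<le> 1" using soft_cap'_nonneg soft_cap'_le_1[of "exp (u * x) / N"] assms(1) by auto
  have "u * exp (u * x) * ?h \<le> 1 * exp (u * x) * 1" using h assms by (intro mult_mono) auto
  also have "\<dots> \<le> exp 2 * exp (u * x)" by simp
  finally have f': "\<bar>trunc_exp' u N x\<bar> \<le> exp 2 * exp (u * x)"
    using h assms by (simp add: trunc_exp'_def abs_mult)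
  have "\<bar>gen_trunc u N x\<bar> \<le> drift \<mu> * x * \<bar>trunc_exp' u N x\<bar>
      + x * \<bar>\<integral>\<xi>. (trunc_rem u N x \<xi>) \<partial>\<mu>\<bar>"
    unfolding gen_trunc_def using assms drift_nonneg
    by (intro abs_triangle_ineq[THEN order_trans] add_mono) (auto simp: abs_mult)
  also have "\<dots> \<le> drift \<mu> * x * (exp 2 * exp (u * x)) + x * (16 * exp 2 * exp (u * x) * drift \<mu>)"
    using f' I assms drift_nonneg by (intro add_mono mult_left_mono) auto
  also have "\<dots> = 17 * exp 2 * drift \<mu> * (x * exp (u * x))" by (simp add: algebra_simps)
  finally show ?thesis .
qed

lemma gen_trunc_tendsto:
  assumes "0 < u" "u \<le> 1" "0 \<le> x"
  shows "(\<lambda>n. gen_trunc u (real (Suc n)) x) \<longlonglongrightarrow> x * exp (u * x) * R u"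
proof -
  have lim: "filterlim (\<lambda>n. real (Suc n)) at_top sequentially"
    by (rule filterlim_compose[OF filterlim_real_sequentially filterlim_Suc])
  note t = filterlim_compose[OF trunc_exp_tendsto lim] and t' = filterlim_compose[OF trunc_exp'_tendsto lim]
  have "(\<lambda>n. \<integral>\<xi>. (trunc_rem u (Suc n) x \<xi>) \<partial>\<mu>)
      \<longlonglongrightarrow> (LINT \<xi>|\<mu>. (exp (u * (x + \<xi>)) - exp (u * x) - u * exp (u * x) * \<xi>))"
  proof (rule integral_dominated_convergence)
    show "integrable \<mu> (\<lambda>\<xi>. 16 * exp 2 * exp (u * x) * (exp \<xi> - 1 - \<xi>))"
      by (intro integrable_mult_right exp_remainder_integrable)
    show "AE \<xi> in \<mu>. norm (trunc_rem u (Suc n) x \<xi>)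
        \<le> 16 * exp 2 * exp (u * x) * (exp \<xi> - 1 - \<xi>)" for n
      using trunc_exp_remainder(2)[of "Suc n" u x] assms by (intro AE_I2) (auto simp: space_mu)
    show "AE \<xi> in \<mu>. (\<lambda>n. trunc_rem u (Suc n) x \<xi>)
       \<longlonglongrightarrow> exp (u * (x + \<xi>)) - exp (u * x) - u * exp (u * x) * \<xi>"
      by (intro AE_I2 tendsto_intros t t')
  qed (auto intro: trunc_exp_remainder_measurable)
  also have "(LINT \<xi>|\<mu>. (exp (u * (x + \<xi>)) - exp (u * x) - u * exp (u * x) * \<xi>))
      = (LINT \<xi>|\<mu>. exp (u * x) * (exp (u * \<xi>) - 1 - u * \<xi>))"
    by (rule Bochner_Integration.integral_cong) (auto simp: exp_add distrib_left algebra_simps)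
  also have "\<dots> = exp (u * x) * (R u + drift \<mu> * u)" by (simp add: riccati_def)
  finally have "(\<lambda>n. gen_trunc u (real (Suc n)) x) \<longlonglongrightarrow>
      - drift \<mu> * x * (u * exp (u * x)) + x * (exp (u * x) * (R u + drift \<mu> * u))"
    unfolding gen_trunc_def by (intro tendsto_intros t')
  then show ?thesis by (simp add: algebra_simps)
qed

end

section \<open>Dynkin's formula for Feller kernels\<close>

lemma measurable_borel_nonneg: "f \<in> borel_measurable borel \<Longrightarrow> f \<in> borel_measurable borel_nonneg"
  by (rule measurable_restrict_space1)

lemma C0_nonneg_measurable: "f \<in> C0_nonneg \<Longrightarrow> f \<in> borel_measurable borel_nonneg"
  by (simp add: C0_nonneg_def borel_measurable_continuous_on_restrict)

lemma C0_nonneg_bounded: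
  assumes "f \<in> C0_nonneg" obtains B where "0 < B" "\<And>x. 0 \<le> x \<Longrightarrow> \<bar>f x\<bar> \<le> B"
proof -
  have c: "continuous_on {0..} f" and l: "(f \<longlongrightarrow> 0) at_top" using assms by (auto simp: C0_nonneg_def)
  from tendstoD[OF l, of 1] obtain r where r: "\<And>x. x \<ge> r \<Longrightarrow> \<bar>f x\<bar> < 1"
    by (auto simp: eventually_at_top_linorder)
  have "compact (f ` {0..r})"
    by (intro compact_continuous_image continuous_on_subset[OF c]) auto
  then obtain C where C: "\<And>x. x \<in> {0..r} \<Longrightarrow> \<bar>f x\<bar> \<le> C"
    using compact_imp_bounded[of "f ` {0..r}"] unfolding bounded_iff by (metis imageI real_norm_def)
  have "\<bar>f x\<bar> \<le> max 1 C" if "0 \<le> x" for x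
    using r[of x] C[of x] that by (cases "x \<le> r") force+
  then show ?thesis by (intro that[of "max 1 C"]) auto
qed

locale feller_kernel =
  fixes K :: "real \<Rightarrow> real \<Rightarrow> real measure"
  assumes feller: "feller_transition K"
begin

lemma kernel_measurable: "0 \<le> t \<Longrightarrow> K t \<in> borel_nonneg \<rightarrow>\<^sub>M prob_algebra borel_nonneg"
  using feller by (simp add: feller_transition_def)

lemma
  assumes "0 \<le> t" "0 \<le> x"
  shows kernel_prob: "prob_space (K t x)"
  and sets_kernel: "sets (K t x) = sets borel_nonneg" and space_kernel: "space (K t x) = {0..}"
proof -
  have "K t x \<in> space (prob_algebra borel_nonneg)"
    using measurable_space[OF kernel_measurable[OF assms(1)], of x] assms(2) by simp
  then show "prob_space (K t x)" and s: "sets (K t x) = sets borel_nonneg"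
    by (auto simp: space_prob_algebra)
  show "space (K t x) = {0..}" using sets_eq_imp_space_eq[OF s] by simp
qed

lemma kernel_borel_measurable:
  assumes "0 \<le> t" "0 \<le> x" "f \<in> borel_measurable borel_nonneg"
  shows "f \<in> borel_measurable (K t x)"
  using assms(3) by (simp add: measurable_cong_sets[OF sets_kernel[OF assms(1,2)] refl])

lemma kernel_integrable:
  fixes f :: "real \<Rightarrow> real"
  assumes "0 \<le> t" "0 \<le> x" "f \<in> borel_measurable borel_nonneg" "\<And>y. 0 \<le> y \<Longrightarrow> \<bar>f y\<bar> \<le> B"
  shows "integrable (K t x) f"
proof -
  interpret prob_space "K t x" by (rule kernel_prob[OF assms(1,2)])
  show ?thesis
    by (rule integrable_const_bound[of _ B])
      (use assms space_kernel[OF assms(1,2)] kernel_borel_measurable[OF assms(1-3)] in auto)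
qed

lemma kernel_integral_bound:
  fixes f :: "real \<Rightarrow> real"
  assumes "0 \<le> t" "0 \<le> x" "f \<in> borel_measurable borel_nonneg" "\<And>y. 0 \<le> y \<Longrightarrow> \<bar>f y\<bar> \<le> B"
  shows "\<bar>\<integral>y. f y \<partial>K t x\<bar> \<le> B"
proof -
  interpret prob_space "K t x" by (rule kernel_prob[OF assms(1,2)])
  have "\<bar>\<integral>y. f y \<partial>K t x\<bar> \<le> (LINT y|K t x. \<bar>f y\<bar>)" by (rule integral_abs_bound)
  also have "\<dots> \<le> (LINT y|K t x. B)"
    using kernel_integrable[OF assms] assms(4) space_kernel[OF assms(1,2)]
    by (intro integral_mono) auto
  finally show ?thesis by (simp add: prob_space)
qed

lemma transition_op_measurable:
  assumes "0 \<le> t" "f \<in> borel_measurable borel_nonneg"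
  shows "transition_op K t f \<in> borel_measurable borel_nonneg"
  unfolding transition_op_def[abs_def]
  by (rule measurable_compose[OF measurable_prob_algebraD[OF kernel_measurable[OF assms(1)]]
        integral_measurable_subprob_algebra[OF assms(2)]])

lemma transition_op_semigroup:
  fixes f :: "real \<Rightarrow> real"
  assumes "0 \<le> s" "0 \<le> t" "0 \<le> x" "f \<in> borel_measurable borel_nonneg" "\<And>y. 0 \<le> y \<Longrightarrow> \<bar>f y\<bar> \<le> B"
  shows "transition_op K (s + t) f x = (LINT y|K s x. transition_op K t f y)"
proof -
  interpret prob_space "K s x" by (rule kernel_prob[OF assms(1,3)])
  have "K (s + t) x = K s x \<bind> K t" using feller assms by (auto simp: feller_transition_def)
  moreover have "integral\<^sup>L (K s x \<bind> K t) f = (LINT y|K s x. integral\<^sup>L (K t y) f)"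
  proof (rule integral_bind[where K = borel_nonneg and B = B and B' = 1])
    show "K t \<in> K s x \<rightarrow>\<^sub>M subprob_algebra borel_nonneg"
      using measurable_prob_algebraD[OF kernel_measurable[OF assms(2)]]
      by (simp add: measurable_cong_sets[OF sets_kernel[OF assms(1,3)] refl])
    show "AE y in K s x. emeasure (K t y) (space (K t y)) \<le> ennreal 1"
      using prob_space.emeasure_space_1[OF kernel_prob[OF assms(2)]]
      by (intro AE_I2) (simp add: space_kernel[OF assms(1,3)])
    show "finite_measure (K s x)" by unfold_locales
  qed (use assms in auto)
  ultimately show ?thesis by (simp add: transition_op_def)
qed

lemma transition_op_0: "0 \<le> x \<Longrightarrow> f \<in> borel_measurable borel_nonneg \<Longrightarrow> transition_op K 0 f x = f x"
  using feller by (simp add: feller_transition_def transition_op_def integral_return)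

text \<open>Since $P_s$ is a contraction, the uniform convergence $(P_hf - f)/h \to g$ makes the difference
  quotients of $s \mapsto P_sf(x)$ converge to $P_sg(x)$ uniformly in $s$. So $P_sf(x)$ is Lipschitz
  in $s$, its right derivative $P_sg(x)$ is a uniform limit of continuous functions, and a
  continuous uniform right derivative is a derivative.\<close>

lemma generator_dynkin:
  assumes gen: "(f, g) \<in> feller_generator K" and x: "0 \<le> x" and t: "0 \<le> t"
  shows "((\<lambda>s. transition_op K s g x) has_integral (transition_op K t f x - f x)) {0..t}"
proof -
  define F where "F t = transition_op K t f x" for t
  define r where "r t = transition_op K t g x" for t
  have f: "f \<in> C0_nonneg" and g: "g \<in> C0_nonneg"
    and ul: "uniform_limit {0..} (\<lambda>t x. (transition_op K t f x - f x) / t) g (at_right 0)"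
    using gen by (auto simp: feller_generator_def)
  note fm = C0_nonneg_measurable[OF f] and gm = C0_nonneg_measurable[OF g]
  obtain Bf where Bf: "\<And>y. 0 \<le> y \<Longrightarrow> \<bar>f y\<bar> \<le> Bf" using C0_nonneg_bounded[OF f] by metis
  obtain Bg where Bg: "0 < Bg" "\<And>y. 0 \<le> y \<Longrightarrow> \<bar>g y\<bar> \<le> Bg" using C0_nonneg_bounded[OF g] by metis
  have key: "\<exists>\<delta>>0. \<forall>h s. 0 < h \<longrightarrow> h < \<delta> \<longrightarrow> 0 \<le> s \<longrightarrow> \<bar>(F (s + h) - F s) / h - r s\<bar> \<le> \<epsilon>" if "\<epsilon> > 0" for \<epsilon>
  proof -
    from uniform_limitD[OF ul that] obtain \<delta> where \<delta>: "\<delta> > 0"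
      "\<And>h y. 0 < h \<Longrightarrow> h < \<delta> \<Longrightarrow> 0 \<le> y \<Longrightarrow> \<bar>(transition_op K h f y - f y) / h - g y\<bar> < \<epsilon>"
      unfolding eventually_at_right_field by (auto simp: dist_real_def)
    have "\<bar>(F (s + h) - F s) / h - r s\<bar> \<le> \<epsilon>" if h: "0 < h" "h < \<delta>" and s: "0 \<le> s" for h s
    proof -
      have Pm: "transition_op K h f \<in> borel_measurable borel_nonneg"
        using h by (intro transition_op_measurable fm) auto
      have Pb: "\<bar>transition_op K h f y\<bar> \<le> Bf" if "0 \<le> y" for y
        unfolding transition_op_def using that h fm Bf by (intro kernel_integral_bound) auto
      have i1: "integrable (K s x) (transition_op K h f)" using s x Pm Pb by (rule kernel_integrable)
      have i2: "integrable (K s x) f" using s x fm Bf by (rule kernel_integrable)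
      have i3: "integrable (K s x) g" using s x gm Bg(2) by (rule kernel_integrable)
      have "F (s + h) = (LINT y|K s x. transition_op K h f y)"
        unfolding F_def using s h x fm Bf by (intro transition_op_semigroup) auto
      then have "(F (s + h) - F s) / h - r s = (LINT y|K s x. (transition_op K h f y - f y) / h - g y)"
        using i1 i2 i3 by (simp add: F_def r_def transition_op_def[of K s])
      also have "\<bar>\<dots>\<bar> \<le> \<epsilon>"
      proof (rule kernel_integral_bound[OF s x])
        show "(\<lambda>y. (transition_op K h f y - f y) / h - g y) \<in> borel_measurable borel_nonneg"
          using Pm fm gm by simp
        show "\<bar>(transition_op K h f y - f y) / h - g y\<bar> \<le> \<epsilon>" if "0 \<le> y" for y
          using \<delta>(2)[OF h that] by simp
      qed
      finally show ?thesis .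
    qed
    then show ?thesis using \<delta>(1) by blast
  qed
  have rB: "\<bar>r s\<bar> \<le> Bg" if "0 \<le> s" for s
    unfolding r_def transition_op_def using that x gm Bg(2) by (rule kernel_integral_bound)
  have Fc: "continuous_on {0..} F"
  proof -
    obtain \<delta> where \<delta>: "\<delta> > 0"
      "\<And>h s. 0 < h \<Longrightarrow> h < \<delta> \<Longrightarrow> 0 \<le> s \<Longrightarrow> \<bar>(F (s + h) - F s) / h - r s\<bar> \<le> 1" using key[of 1] by auto
    have 1: "\<bar>F (s + h) - F s\<bar> \<le> (Bg + 1) * h" if "0 < h" "h < \<delta>" "0 \<le> s" for h s
    proof -
      have "\<bar>(F (s + h) - F s) / h\<bar> \<le> Bg + 1" using \<delta>(2)[OF that] rB[of s] that by linarith
      then show ?thesis using that by (simp add: abs_div field_simps)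
    qed
    have 2: "\<bar>F s' - F s\<bar> \<le> (Bg + 1) * \<bar>s' - s\<bar>" if "\<bar>s' - s\<bar> < \<delta>" "0 \<le> s" "0 \<le> s'" for s s'
      using 1[of "s' - s" s] 1[of "s - s'" s'] that by (cases s s' rule: linorder_cases) (auto simp: abs_minus_commute)
    show ?thesis unfolding continuous_on_iff
    proof (intro ballI allI impI)
      fix s e :: real assume s: "s \<in> {0..}" "0 < e"
      let ?d = "min \<delta> (e / (Bg + 1))"
      have "dist (F s') (F s) < e" if "s' \<in> {0..}" "dist s' s < ?d" for s'
      proof -
        have "(Bg + 1) * \<bar>s' - s\<bar> < e" using that Bg(1) by (simp add: dist_real_def field_simps)
        then show ?thesis using 2[of s' s] that s by (simp add: dist_real_def)
      qed
      then show "\<exists>d>0. \<forall>s'\<in>{0..}. dist s' s < d \<longrightarrow> dist (F s') (F s) < e"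
        using \<delta>(1) Bg(1) s by (intro exI[of _ ?d]) auto
    qed
  qed
  have ulr: "uniform_limit {0..} (\<lambda>h s. (F (s + h) - F s) / h) r (at_right 0)"
  proof (rule uniform_limitI)
    fix e :: real assume "e > 0"
    with key[of "e / 2"] obtain \<delta> where \<delta>: "\<delta> > 0"
      "\<And>h s. 0 < h \<Longrightarrow> h < \<delta> \<Longrightarrow> 0 \<le> s \<Longrightarrow> \<bar>(F (s + h) - F s) / h - r s\<bar> \<le> e / 2" by auto
    show "\<forall>\<^sub>F h in at_right 0. \<forall>s\<in>{0..}. dist ((F (s + h) - F s) / h) (r s) < e"
      unfolding eventually_at_right_field
    proof (intro exI[of _ \<delta>] conjI allI impI ballI)
      fix h s :: real assume "0 < h" "h < \<delta>" "s \<in> {0..}"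
      then show "dist ((F (s + h) - F s) / h) (r s) < e"
        using \<delta>(2)[of h s] \<open>e > 0\<close> by (simp add: dist_real_def)
    qed (rule \<delta>(1))
  qed
  have rc: "continuous_on {0..} r"
  proof (rule uniform_limit_theorem[OF _ ulr])
    show "\<forall>\<^sub>F h in at_right 0. continuous_on {0..} (\<lambda>s. (F (s + h) - F s) / h)"
      unfolding eventually_at_right_field
    proof (intro exI[of _ 1] conjI allI impI)
      fix h :: real assume h: "0 < h" "h < 1"
      have "continuous_on {0..} (\<lambda>s. F (s + h))"
        by (rule continuous_on_compose2[OF Fc]) (use h in \<open>auto intro!: continuous_intros\<close>)
      then show "continuous_on {0..} (\<lambda>s. (F (s + h) - F s) / h)"
        using Fc h by (intro continuous_intros) auto
    qed simp
  qed simp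

  have der: "(F has_real_derivative r s) (at s within {0..})" if s: "0 \<le> s" for s
    unfolding has_field_derivative_iff
  proof (rule tendstoI)
    fix e :: real assume e: "e > 0"
    obtain \<delta> where \<delta>: "\<delta> > 0"
      "\<And>h s. 0 < h \<Longrightarrow> h < \<delta> \<Longrightarrow> 0 \<le> s \<Longrightarrow> \<bar>(F (s + h) - F s) / h - r s\<bar> \<le> e / 2" using key[of "e / 2"] e by auto
    obtain d where d: "d > 0" "\<And>y. 0 \<le> y \<Longrightarrow> \<bar>y - s\<bar> < d \<Longrightarrow> \<bar>r y - r s\<bar> < e / 2"
      using rc s e unfolding continuous_on_iff dist_real_def
      by (metis atLeast_iff half_gt_zero)
    have "dist ((F y - F s) / (y - s)) (r s) < e" if y: "0 \<le> y" "y \<noteq> s" "dist y s < min \<delta> d" for y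
    proof (cases "y > s")
      case True
      then show ?thesis using \<delta>(2)[of "y - s" s] s y e by (simp add: dist_real_def)
    next
      case False
      then have "y < s" using y by simp
      have "(F s - F y) / (s - y) = (F y - F s) / (y - s)"
        by (metis minus_diff_eq minus_divide_divide)
      then have "\<bar>(F y - F s) / (y - s) - r y\<bar> \<le> e / 2"
        using \<delta>(2)[of "s - y" y] \<open>y < s\<close> y by (simp add: dist_real_def)
      moreover have "\<bar>r y - r s\<bar> < e / 2" using d(2)[of y] y by (simp add: dist_real_def)
      ultimately show ?thesis unfolding dist_real_def by linarith
    qed
    then show "\<forall>\<^sub>F y in at s within {0..}. dist ((F y - F s) / (y - s)) (r s) < e"
      unfolding eventually_at using \<delta>(1) d(1) by (intro exI[of _ "min \<delta> d"]) auto
  qed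
  have "(r has_integral F t - F 0) {0..t}"
  proof (rule fundamental_theorem_of_calculus[OF t])
    fix s assume "s \<in> {0..t}"
    then have "(F has_real_derivative r s) (at s within {0..t})"
      by (intro DERIV_subset[OF der]) auto
    then show "(F has_vector_derivative r s) (at s within {0..t})"
      by (simp add: has_real_derivative_iff_has_vector_derivative)
  qed
  then show "((\<lambda>s. transition_op K s g x) has_integral (transition_op K t f x - f x)) {0..t}"
    using transition_op_0[OF x fm] by (simp add: F_def r_def[abs_def])
qed

end

section \<open>Exponential moments are constant along characteristics\<close>

lemma exp_expansion_bound:
  fixes a b v y :: real
  assumes "0 \<le> y" "a \<le> v" "b \<le> v"
  shows "\<bar>exp (b * y) - exp (a * y) - (b - a) * (y * exp (a * y))\<bar> \<le> (b - a)\<^sup>2 * (y\<^sup>2 * exp (v * y))"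
proof -
  define z where "z = (b - a) * y"
  define A where "A = exp (a * y)"
  define B where "B = exp (b * y)"
  have AB: "B = A * exp z" "A = B * exp (- z)" unfolding A_def B_def z_def
    by (simp_all add: algebra_simps flip: exp_add)
  have pos: "0 < A" "0 < B" by (simp_all add: A_def B_def)
  have le: "A \<le> exp (v * y)" "B \<le> exp (v * y)"
    unfolding A_def B_def using assms by (simp_all add: mult_right_mono)
  have 1: "A * (1 + z) \<le> B" unfolding AB(1) using pos by (intro mult_left_mono exp_ge_add_one_self) auto
  have 2: "B * (1 - z) \<le> A"
    using mult_left_mono[OF exp_ge_add_one_self[of "- z"], of B] pos AB(2) by simp
  have "B - A - z * A \<le> z * (B - A)" using 2 by (simp add: algebra_simps)
  also have "\<dots> \<le> z\<^sup>2 * exp (v * y)"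
  proof (cases "0 \<le> z")
    case True
    have "B - A \<le> z * B" using 2 by (simp add: algebra_simps)
    also have "\<dots> \<le> z * exp (v * y)" using le True by (intro mult_left_mono)
    finally have "z * (B - A) \<le> z * (z * exp (v * y))" using True by (intro mult_left_mono)
    then show ?thesis by (simp add: power2_eq_square mult.assoc)
  next
    case False
    have "z * exp (v * y) \<le> z * A" using le False by (intro mult_left_mono_neg) auto
    also have "\<dots> \<le> B - A" using 1 by (simp add: algebra_simps)
    finally have "z * (B - A) \<le> z * (z * exp (v * y))" using False by (intro mult_left_mono_neg) auto
    then show ?thesis by (simp add: power2_eq_square mult.assoc)
  qed
  finally have "B - A - z * A \<le> z\<^sup>2 * exp (v * y)" .
  moreover have "0 \<le> B - A - z * A" using 1 by (simp add: algebra_simps)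
  ultimately have "\<bar>B - A - z * A\<bar> \<le> z\<^sup>2 * exp (v * y)" by simp
  then show ?thesis by (simp add: A_def B_def z_def power_mult_distrib mult.assoc)
qed

lemma mult_exp_le:
  fixes u y :: real
  assumes "u < 1" "0 \<le> y"
  shows "y * exp (u * y) \<le> exp y / (1 - u)" "y\<^sup>2 * exp (u * y) \<le> 2 * exp y / (1 - u)\<^sup>2"
proof -
  define z where "z = (1 - u) * y"
  have e: "exp y = exp z * exp (u * y)" unfolding z_def by (simp add: algebra_simps flip: exp_add)
  have z: "0 \<le> z" using assms by (simp add: z_def)
  have "z \<le> exp z" using exp_ge_add_one_self[of z] by linarith
  then have "z * exp (u * y) \<le> exp y" unfolding e by (intro mult_right_mono) auto
  then show "y * exp (u * y) \<le> exp y / (1 - u)"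
    using assms by (simp add: z_def field_simps)
  have "z\<^sup>2 \<le> 2 * exp z" using exp_quadratic_lower[OF z] z by simp
  then have "z\<^sup>2 * exp (u * y) \<le> 2 * exp y" unfolding e by simp
  then show "y\<^sup>2 * exp (u * y) \<le> 2 * exp y / (1 - u)\<^sup>2"
    using assms by (simp add: z_def power_mult_distrib pos_le_divide_eq mult.commute mult.left_commute)
qed

locale affine_feller = levy_exp \<mu> + feller_kernel K for \<mu> K +
  assumes generator: "generator_with_core K Cc_smooth_nonneg (affine_generator \<mu>)"
begin

lemma trunc_exp_generator:
  assumes "0 < N" "0 < u"
  shows "((\<lambda>x. N / 2 - trunc_exp u N x), affine_generator \<mu> (\<lambda>x. N / 2 - trunc_exp u N x)) \<in> feller_generator K"
  using generator trunc_exp_Cc_smooth[OF assms] by (simp add: generator_with_core_def)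

lemma gen_trunc_measurable:
  assumes "0 < N" "0 < u" shows "gen_trunc u N \<in> borel_measurable borel_nonneg"
proof -
  have "affine_generator \<mu> (\<lambda>x. N / 2 - trunc_exp u N x) \<in> borel_measurable borel_nonneg"
    using trunc_exp_generator[OF assms] by (intro C0_nonneg_measurable) (simp add: feller_generator_def)
  then have "(\<lambda>x. - affine_generator \<mu> (\<lambda>x. N / 2 - trunc_exp u N x) x) \<in> borel_measurable borel_nonneg"
    by (rule borel_measurable_uminus)
  then show ?thesis
    by (rule measurable_cong[THEN iffD1, rotated]) (use assms affine_generator_trunc_exp in simp)
qed

lemma trunc_exp_integrable:
  assumes "0 < N" "0 < u" "0 \<le> t" "0 \<le> x" shows "integrable (K t x) (trunc_exp u N)"
proof -
  interpret prob_space "K t x" by (rule kernel_prob[OF assms(3,4)])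
  let ?f = "\<lambda>x. N / 2 - trunc_exp u N x"
  have C0: "?f \<in> C0_nonneg" using trunc_exp_generator[OF assms(1,2)] by (simp add: feller_generator_def)
  obtain B where "\<And>y. 0 \<le> y \<Longrightarrow> \<bar>?f y\<bar> \<le> B" using C0_nonneg_bounded[OF C0] by metis
  then have "integrable (K t x) ?f" using assms C0_nonneg_measurable[OF C0] by (intro kernel_integrable)
  then have "integrable (K t x) (\<lambda>y. N / 2 - ?f y)"
    by (rule Bochner_Integration.integrable_diff[OF integrable_const])
  then show ?thesis by simp
qed

lemma trunc_exp_dynkin:
  assumes "0 < N" "0 < u" "0 \<le> t" "0 \<le> x"
  shows "((\<lambda>s. \<integral>y. gen_trunc u N y \<partial>K s x) has_integral
           ((LINT y|K t x. trunc_exp u N y) - trunc_exp u N x)) {0..t}"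
proof -
  interpret prob_space "K t x" by (rule kernel_prob[OF assms(3,4)])
  let ?f = "\<lambda>x. N / 2 - trunc_exp u N x"
  have "((\<lambda>s. transition_op K s (affine_generator \<mu> ?f) x) has_integral (transition_op K t ?f x - ?f x)) {0..t}"
    by (rule generator_dynkin[OF trunc_exp_generator[OF assms(1,2)] assms(4,3)])
  then have "((\<lambda>s. - transition_op K s (affine_generator \<mu> ?f) x) has_integral - (transition_op K t ?f x - ?f x)) {0..t}"
    by (rule has_integral_neg)
  moreover have eq: "- transition_op K s (affine_generator \<mu> ?f) x = (LINT y|K s x. gen_trunc u N y)" if "s \<in> {0..t}" for s
    unfolding transition_op_def Bochner_Integration.integral_minus[symmetric]
    using that assms affine_generator_trunc_exp
    by (intro Bochner_Integration.integral_cong refl) (simp add: space_kernel)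
  moreover have "transition_op K t ?f x = N / 2 - (LINT y|K t x. trunc_exp u N y)"
    unfolding transition_op_def using trunc_exp_integrable[OF assms]
    by (subst Bochner_Integration.integral_diff) (auto simp: prob_space)
  ultimately have "((\<lambda>s. - transition_op K s (affine_generator \<mu> ?f) x) has_integral
      (LINT y|K t x. trunc_exp u N y) - trunc_exp u N x) {0..t}" by simp
  then show ?thesis by (rule has_integral_eq[rotated]) (rule eq)
qed

text \<open>By Dynkin's formula and \<open>gen_trunc_nonpos\<close> the expectation of each truncation of $e^y$ is at
  most its initial value; Fatou's lemma removes the truncation.\<close>

lemma
  assumes "0 \<le> t" "0 \<le> x"
  shows exp_integrable: "integrable (K t x) exp"
    and exp_integral_le: "(LINT y|K t x. exp y) \<le> exp x"
proof -
  interpret prob_space "K t x" by (rule kernel_prob[OF assms])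
  have le: "(LINT y|K t x. trunc_exp 1 N y) \<le> exp x" if N: "0 < N" for N
  proof -
    have "(LINT y|K s x. gen_trunc 1 N y) \<le> 0" if "s \<in> {0..t}" for s
    proof -
      have "0 \<le> (LINT y|K s x. - gen_trunc 1 N y)"
        using that assms N gen_trunc_nonpos by (intro integral_nonneg_AE AE_I2) (simp add: space_kernel)
      then show ?thesis by simp
    qed
    then have "(LINT y|K t x. trunc_exp 1 N y) - trunc_exp 1 N x \<le> 0"
      by (intro has_integral_le[OF trunc_exp_dynkin[OF N _ assms] has_integral_0]) auto
    then show ?thesis using trunc_exp_bounds(2)[OF N, of 1 x] by simp
  qed
  have lim: "filterlim (\<lambda>n. real (Suc n)) at_top sequentially"
    by (rule filterlim_compose[OF filterlim_real_sequentially filterlim_Suc])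
  have "(\<integral>\<^sup>+y. ennreal (exp y) \<partial>K t x) = (\<integral>\<^sup>+y. liminf (\<lambda>n. ennreal (trunc_exp 1 (Suc n) y)) \<partial>K t x)"
  proof (rule nn_integral_cong)
    fix y
    have "(\<lambda>n. ennreal (trunc_exp 1 (Suc n) y)) \<longlonglongrightarrow> ennreal (exp (1 * y))"
      by (intro tendsto_ennrealI filterlim_compose[OF trunc_exp_tendsto lim])
    then show "ennreal (exp y) = liminf (\<lambda>n. ennreal (trunc_exp 1 (Suc n) y))"
      by (simp add: lim_imp_Liminf)
  qed
  also have "\<dots> \<le> liminf (\<lambda>n. \<integral>\<^sup>+y. ennreal (trunc_exp 1 (Suc n) y) \<partial>K t x)"
    using trunc_exp_measurable
    by (intro nn_integral_liminf measurable_compose[OF _ measurable_ennreal]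
        kernel_borel_measurable[OF assms] measurable_borel_nonneg) simp
  also have "\<dots> \<le> liminf (\<lambda>n. ennreal (exp x))"
  proof (intro Liminf_mono always_eventually allI)
    fix n
    have "(\<integral>\<^sup>+y. ennreal (trunc_exp 1 (Suc n) y) \<partial>K t x) = ennreal (LINT y|K t x. trunc_exp 1 (Suc n) y)"
      using trunc_exp_bounds(1)[of "Suc n"] assms
      by (intro nn_integral_eq_integral trunc_exp_integrable) auto
    then show "(\<integral>\<^sup>+y. ennreal (trunc_exp 1 (Suc n) y) \<partial>K t x) \<le> ennreal (exp x)"
      using le[of "Suc n"] by (simp add: ennreal_leI)
  qed
  finally have fin: "(\<integral>\<^sup>+y. ennreal (exp y) \<partial>K t x) \<le> ennreal (exp x)" by (simp add: Liminf_const)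
  show int: "integrable (K t x) exp"
    using le_less_trans[OF fin ennreal_less_top]
    by (intro integrableI_nonneg kernel_borel_measurable[OF assms] measurable_borel_nonneg) auto
  have "ennreal (LINT y|K t x. exp y) \<le> ennreal (exp x)"
    using fin nn_integral_eq_integral[OF int] by simp
  then show "(LINT y|K t x. exp y) \<le> exp x" by simp
qed

lemma dominated_integrable:
  fixes f :: "real \<Rightarrow> real"
  assumes "0 \<le> t" "0 \<le> x" "f \<in> borel_measurable borel_nonneg" "\<And>y. 0 \<le> y \<Longrightarrow> \<bar>f y\<bar> \<le> C * exp y"
  shows "integrable (K t x) f" "\<bar>\<integral>y. f y \<partial>K t x\<bar> \<le> C * exp x"
proof -
  have C: "0 \<le> C" using assms(4)[of 0] by simp
  have i: "integrable (K t x) (\<lambda>y. C * exp y)"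
    using exp_integrable[OF assms(1,2)] by (rule integrable_mult_right)
  show int: "integrable (K t x) f"
  proof (rule Bochner_Integration.integrable_bound[OF i])
    show "f \<in> borel_measurable (K t x)" by (rule kernel_borel_measurable[OF assms(1-3)])
    show "AE y in K t x. norm (f y) \<le> norm (C * exp y)"
      using assms(4) C by (intro AE_I2) (simp add: space_kernel[OF assms(1,2)] abs_mult)
  qed
  have "\<bar>\<integral>y. f y \<partial>K t x\<bar> \<le> (LINT y|K t x. \<bar>f y\<bar>)" by (rule integral_abs_bound)
  also have "\<dots> \<le> (LINT y|K t x. C * exp y)"
    using int i assms(4) by (intro integral_mono) (auto simp: space_kernel[OF assms(1,2)])
  also have "\<dots> = C * (LINT y|K t x. exp y)" by simp
  also have "\<dots> \<le> C * exp x" using C exp_integral_le[OF assms(1,2)] by (intro mult_left_mono)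
  finally show "\<bar>\<integral>y. f y \<partial>K t x\<bar> \<le> C * exp x" .
qed

definition mgf :: "real \<Rightarrow> real \<Rightarrow> real \<Rightarrow> real" where
  "mgf x t u = (LINT y|K t x. exp (u * y))"

definition mgf' :: "real \<Rightarrow> real \<Rightarrow> real \<Rightarrow> real" where
  "mgf' x t u = (LINT y|K t x. y * exp (u * y))"

lemma exp_scaled_integrable:
  assumes "0 \<le> t" "0 \<le> x" "u \<le> 1" shows "integrable (K t x) (\<lambda>y. exp (u * y))"
proof (rule dominated_integrable(1)[OF assms(1,2)])
  show "(\<lambda>y. exp (u * y)) \<in> borel_measurable borel_nonneg" by (intro measurable_borel_nonneg) measurable
  show "\<bar>exp (u * y)\<bar> \<le> 1 * exp y" if "0 \<le> y" for y
    using that assms(3) mult_right_mono[of u 1 y] by simp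
qed

lemma mgf'_integrable:
  assumes "0 \<le> t" "0 \<le> x" "u < 1"
  shows "integrable (K t x) (\<lambda>y. y * exp (u * y))"
proof -
  have m: "(\<lambda>y. y * exp (u * y)) \<in> borel_measurable borel_nonneg" by (intro measurable_borel_nonneg) measurable
  have b: "\<bar>y * exp (u * y)\<bar> \<le> 1 / (1 - u) * exp y" if "0 \<le> y" for y
    using mult_exp_le(1)[OF assms(3) that] that by (simp add: abs_mult)
  show ?thesis by (rule dominated_integrable(1)[OF assms(1,2) m b])
qed

text \<open>\<open>mgf'\<close> is the derivative of \<open>mgf\<close> in $u$, with an error that is uniform in time. The
  uniformity lets continuity in $t$ pass from \<open>mgf\<close> to \<open>mgf'\<close>.\<close>

lemma mgf_expansion:
  assumes "0 \<le> t" "0 \<le> x" "a \<le> v" "b \<le> v" "v < 1"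
  shows "\<bar>mgf x t b - mgf x t a - (b - a) * mgf' x t a\<bar> \<le> (b - a)\<^sup>2 * (2 * exp x / (1 - v)\<^sup>2)"
proof -
  let ?f = "\<lambda>y. exp (b * y) - exp (a * y) - (b - a) * (y * exp (a * y))"
  have "mgf x t b - mgf x t a - (b - a) * mgf' x t a = (LINT y|K t x. ?f y)"
    unfolding mgf_def mgf'_def using assms
    by (simp add: exp_scaled_integrable mgf'_integrable)
  also have "\<bar>\<dots>\<bar> \<le> ((b - a)\<^sup>2 * (2 / (1 - v)\<^sup>2)) * exp x"
  proof (rule dominated_integrable(2)[OF assms(1,2)])
    show "?f \<in> borel_measurable borel_nonneg" by (intro measurable_borel_nonneg) measurable
    fix y :: real assume y: "0 \<le> y"
    have "\<bar>?f y\<bar> \<le> (b - a)\<^sup>2 * (y\<^sup>2 * exp (v * y))" by (rule exp_expansion_bound[OF y assms(3,4)])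
    also have "\<dots> \<le> (b - a)\<^sup>2 * (2 * exp y / (1 - v)\<^sup>2)"
      using mult_exp_le(2)[OF assms(5) y] by (intro mult_left_mono) auto
    finally show "\<bar>?f y\<bar> \<le> ((b - a)\<^sup>2 * (2 / (1 - v)\<^sup>2)) * exp y" by simp
  qed
  finally show ?thesis by simp
qed

text \<open>The integrated form of $\partial_t m = R(u)\,\partial_u m$, the limit of \<open>trunc_exp_dynkin\<close>.\<close>

lemma mgf_dynkin:
  assumes "0 < u" "u < 1" "0 \<le> t" "0 \<le> x"
  shows "((\<lambda>s. R u * mgf' x s u) has_integral (mgf x t u - exp (u * x))) {0..t}"
proof -
  have lim: "filterlim (\<lambda>n. real (Suc n)) at_top sequentially"
    by (rule filterlim_compose[OF filterlim_real_sequentially filterlim_Suc])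
  let ?f = "\<lambda>n s. \<integral>y. gen_trunc u (Suc n) y \<partial>K s x"
  define C where "C = 17 * exp 2 * drift \<mu> / (1 - u)"
  have gb: "\<bar>gen_trunc u (Suc n) y\<bar> \<le> C * exp y" if "0 \<le> y" for n y
  proof -
    have "\<bar>gen_trunc u (Suc n) y\<bar> \<le> 17 * exp 2 * drift \<mu> * (y * exp (u * y))"
      using that assms by (intro gen_trunc_bound) auto
    also have "\<dots> \<le> 17 * exp 2 * drift \<mu> * (exp y / (1 - u))"
      using mult_exp_le(1)[OF assms(2) that] drift_nonneg by (intro mult_left_mono) auto
    finally show ?thesis by (simp add: C_def)
  qed
  have gm: "gen_trunc u (Suc n) \<in> borel_measurable borel_nonneg" for n
    using assms by (intro gen_trunc_measurable) auto
  have dyn: "(?f n has_integral ((LINT y|K t x. trunc_exp u (Suc n) y) - trunc_exp u (Suc n) x)) {0..t}" for n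
    by (rule trunc_exp_dynkin[OF _ assms(1,3,4)]) simp
  have pt: "(\<lambda>n. ?f n s) \<longlonglongrightarrow> R u * mgf' x s u" if s: "s \<in> {0..t}" for s
  proof -
    have s0: "0 \<le> s" using s by simp
    have "(\<lambda>n. ?f n s) \<longlonglongrightarrow> (LINT y|K s x. y * exp (u * y) * R u)"
    proof (rule integral_dominated_convergence)
      show "integrable (K s x) (\<lambda>y. C * exp y)"
        by (intro integrable_mult_right exp_integrable[OF s0 assms(4)])
      show "AE y in K s x. norm (gen_trunc u (Suc n) y) \<le> C * exp y" for n
        using gb by (intro AE_I2) (simp add: space_kernel[OF s0 assms(4)])
      show "AE y in K s x. (\<lambda>n. gen_trunc u (Suc n) y) \<longlonglongrightarrow> y * exp (u * y) * R u"
        using gen_trunc_tendsto assms by (intro AE_I2) (simp add: space_kernel[OF s0 assms(4)])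
      show "gen_trunc u (Suc n) \<in> borel_measurable (K s x)" for n
        by (rule kernel_borel_measurable[OF s0 assms(4) gm])
      show "(\<lambda>y. y * exp (u * y) * R u) \<in> borel_measurable (K s x)"
        by (intro kernel_borel_measurable[OF s0 assms(4)] measurable_borel_nonneg) measurable
    qed
    also have "(LINT y|K s x. y * exp (u * y) * R u) = R u * mgf' x s u"
      unfolding mgf'_def by (simp add: mult.commute)
    finally show ?thesis .
  qed
  have bd: "norm (?f n s) \<le> C * exp x" if "s \<in> {0..t}" for n s
    using dominated_integrable(2)[OF _ assms(4) gm gb, of s] that by simp
  have dc: "?f n integrable_on {0..t}" "(\<lambda>_. C * exp x) integrable_on {0..t}" for n
    using dyn[of n] by (auto intro: has_integral_integrable integrable_const_ivl simp del: of_nat_Suc)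
  have int: "(\<lambda>s. R u * mgf' x s u) integrable_on {0..t}"
    by (rule dominated_convergence(1)[where f = ?f and h = "\<lambda>_. C * exp x"]) (use dc bd pt in blast)+
  have conv: "(\<lambda>n. integral {0..t} (?f n)) \<longlonglongrightarrow> integral {0..t} (\<lambda>s. R u * mgf' x s u)"
    by (rule dominated_convergence(2)[where f = ?f and h = "\<lambda>_. C * exp x"]) (use dc bd pt in blast)+
  have "(\<lambda>n. (LINT y|K t x. trunc_exp u (Suc n) y) - trunc_exp u (Suc n) x) \<longlonglongrightarrow> mgf x t u - exp (u * x)"
    unfolding mgf_def
  proof (rule tendsto_diff[OF integral_dominated_convergence filterlim_compose[OF trunc_exp_tendsto lim]])
    show "integrable (K t x) (\<lambda>y. exp (u * y))" using assms by (intro exp_scaled_integrable) auto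
    show "AE y in K t x. norm (trunc_exp u (Suc n) y) \<le> exp (u * y)" for n
      using trunc_exp_bounds[of "Suc n" u] by (intro AE_I2) simp
    show "AE y in K t x. (\<lambda>n. trunc_exp u (Suc n) y) \<longlonglongrightarrow> exp (u * y)"
      by (intro AE_I2 filterlim_compose[OF trunc_exp_tendsto lim])
    show "trunc_exp u (Suc n) \<in> borel_measurable (K t x)" for n
      using trunc_exp_integrable[of "Suc n"] assms by auto
    show "(\<lambda>y. exp (u * y)) \<in> borel_measurable (K t x)"
      by (intro kernel_borel_measurable[OF assms(3,4)] measurable_borel_nonneg) measurable
  qed
  moreover have "integral {0..t} (?f n) = (LINT y|K t x. trunc_exp u (Suc n) y) - trunc_exp u (Suc n) x" for n
    by (rule integral_unique[OF dyn])
  ultimately have "(\<lambda>n. integral {0..t} (?f n)) \<longlonglongrightarrow> mgf x t u - exp (u * x)" by presburger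
  then have "integral {0..t} (\<lambda>s. R u * mgf' x s u) = mgf x t u - exp (u * x)"
    by (rule LIMSEQ_unique[OF conv])
  then show ?thesis using integrable_integral[OF int] by simp
qed

lemma mgf_0: "0 \<le> x \<Longrightarrow> mgf x 0 u = exp (u * x)"
  unfolding mgf_def transition_op_def[symmetric]
  by (rule transition_op_0) (auto intro!: measurable_borel_nonneg)

lemma mgf'_continuous:
  assumes "0 < u" "u < 1" "0 \<le> x"
  shows "continuous_on {0..T} (\<lambda>t. mgf' x t u)"
proof -
  have mc: "continuous_on {0..T} (\<lambda>t. mgf x t w)" if "0 < w" "w < 1" for w
  proof (cases "0 \<le> T")
    case True
    have "continuous_on {0..T} (\<lambda>t. integral {0..t} (\<lambda>s. R w * mgf' x s w))"
      by (rule indefinite_integral_continuous_1[OF has_integral_integrable[OF mgf_dynkin[OF that True assms(3)]]])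
    then have "continuous_on {0..T} (\<lambda>t. exp (w * x) + integral {0..t} (\<lambda>s. R w * mgf' x s w))"
      by (intro continuous_intros)
    then show ?thesis
      by (rule continuous_on_eq) (use integral_unique[OF mgf_dynkin[OF that _ assms(3)]] in simp)
  qed simp
  define v where "v = (1 + u) / 2"
  have v: "u < v" "v < 1" using assms by (auto simp: v_def)
  define D where "D = 2 * exp x / (1 - v)\<^sup>2"
  have D: "0 < D" using v by (simp add: D_def)
  have "uniform_limit {0..T} (\<lambda>h t. (mgf x t (u + h) - mgf x t u) / h) (\<lambda>t. mgf' x t u) (at_right 0)"
  proof (rule uniform_limitI)
    fix e :: real assume e: "0 < e"
    show "\<forall>\<^sub>F h in at_right 0. \<forall>t\<in>{0..T}. dist ((mgf x t (u + h) - mgf x t u) / h) (mgf' x t u) < e"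
      unfolding eventually_at_right_field
    proof (intro exI[of _ "min (v - u) (e / D)"] conjI allI impI ballI)
      fix h t assume h: "0 < h" "h < min (v - u) (e / D)" and t: "t \<in> {0..T}"
      have "\<bar>mgf x t (u + h) - mgf x t u - (u + h - u) * mgf' x t u\<bar> \<le> (u + h - u)\<^sup>2 * D"
        unfolding D_def using h t v assms by (intro mgf_expansion) auto
      then have "\<bar>mgf x t (u + h) - mgf x t u - h * mgf' x t u\<bar> \<le> h\<^sup>2 * D" by simp
      then have "\<bar>mgf x t (u + h) - mgf x t u - h * mgf' x t u\<bar> / h \<le> h\<^sup>2 * D / h"
        using h by (intro divide_right_mono) auto
      also have "\<dots> < e" using h D by (simp add: power2_eq_square field_simps)
      also have "\<bar>mgf x t (u + h) - mgf x t u - h * mgf' x t u\<bar> / h = \<bar>(mgf x t (u + h) - mgf x t u) / h - mgf' x t u\<bar>"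
      proof -
        have "(mgf x t (u + h) - mgf x t u) / h - mgf' x t u = (mgf x t (u + h) - mgf x t u - h * mgf' x t u) / h"
          using h by (simp add: field_simps)
        then show ?thesis using h by (simp add: abs_divide)
      qed
      finally show "dist ((mgf x t (u + h) - mgf x t u) / h) (mgf' x t u) < e" by (simp add: dist_real_def)
    qed (use v e D in auto)
  qed
  then show ?thesis
  proof (rule uniform_limit_theorem[rotated])
    show "\<forall>\<^sub>F h in at_right 0. continuous_on {0..T} (\<lambda>t. (mgf x t (u + h) - mgf x t u) / h)"
      unfolding eventually_at_right_field
    proof (intro exI[of _ "v - u"] conjI allI impI)
      fix h assume h: "0 < h" "h < v - u"
      have "continuous_on {0..T} (\<lambda>t. mgf x t (u + h))" "continuous_on {0..T} (\<lambda>t. mgf x t u)"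
        using h v assms by (intro mc; linarith)+
      then show "continuous_on {0..T} (\<lambda>t. (mgf x t (u + h) - mgf x t u) / h)"
        using h by (intro continuous_on_divide continuous_on_diff continuous_on_const) auto
    qed (use v in simp)
  qed simp
qed

lemma mgf_time_derivative:
  assumes "0 < u" "u < 1" "0 \<le> x" "t \<in> {0..T}"
  shows "((\<lambda>t. mgf x t u) has_real_derivative R u * mgf' x t u) (at t within {0..T})"
proof -
  have "((\<lambda>t. integral {0..t} (\<lambda>s. R u * mgf' x s u)) has_real_derivative R u * mgf' x t u) (at t within {0..T})"
    by (rule integral_has_real_derivative[OF _ assms(4)]) (intro continuous_intros mgf'_continuous assms)
  then have "((\<lambda>t. exp (u * x) + integral {0..t} (\<lambda>s. R u * mgf' x s u)) has_real_derivative
      0 + R u * mgf' x t u) (at t within {0..T})"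
    by (intro DERIV_add DERIV_const)
  then have "((\<lambda>t. exp (u * x) + integral {0..t} (\<lambda>s. R u * mgf' x s u)) has_real_derivative
      R u * mgf' x t u) (at t within {0..T})" by simp
  then show ?thesis
    by (rule has_field_derivative_transform_within[OF _ zero_less_one assms(4)])
      (use integral_unique[OF mgf_dynkin[OF assms(1,2) _ assms(3)]] in simp)
qed

text \<open>Along the curve $\eta \mapsto (G(v) - G(\eta), \eta)$ the time changes at rate $-1/R(\eta)$, which
  cancels the two partial derivatives of $m$. The curve joins $(t,u)$ to $(0,v)$, where $m$ is
  explicit. Differentiability of $m$ along the curve is obtained by splitting the increment into a
  second-order remainder, a term linear in $\eta$, and a pure time increment.\<close>

lemma mgf_characteristic:
  assumes G: "\<And>\<eta>. 0 < \<eta> \<Longrightarrow> \<eta> < 1 \<Longrightarrow> (G has_real_derivative 1 / R \<eta>) (at \<eta>)"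
    and v: "0 < v" "v \<le> u" and u: "u < 1" and x: "0 \<le> x" and t: "G v = G u + t"
  shows "mgf x t u = exp (v * x)"
proof -
  define T where "T = t"
  define \<tau> where "\<tau> \<eta> = G v - G \<eta>" for \<eta>
  have anti: "G b \<le> G a" if "0 < a" "a \<le> b" "b < 1" for a b
  proof (rule DERIV_nonpos_imp_nonincreasing[OF that(2)])
    fix c assume "a \<le> c" "c \<le> b"
    then show "\<exists>y. (G has_real_derivative y) (at c) \<and> y \<le> 0"
      using G[of c] riccati_neg[of c] that by (intro exI[of _ "1 / R c"]) (auto simp: divide_nonneg_neg)
  qed
  have \<tau>: "\<tau> \<eta> \<in> {0..T}" if "\<eta> \<in> {v..u}" for \<eta>
    using anti[of v \<eta>] anti[of \<eta> u] that v u t by (auto simp: \<tau>_def T_def)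
  define q where "q \<eta> = mgf x (\<tau> \<eta>) \<eta>" for \<eta>
  have "(q has_real_derivative 0) (at \<eta> within {v..u})" if \<eta>: "\<eta> \<in> {v..u}" for \<eta>
  proof -
    have \<eta>01: "0 < \<eta>" "\<eta> < 1" using \<eta> v u by auto
    define D where "D = 2 * exp x / (1 - u)\<^sup>2"
    have d\<tau>: "(\<tau> has_real_derivative - (1 / R \<eta>)) (at \<eta> within {v..u})"
      unfolding \<tau>_def[abs_def] using has_field_derivative_at_within[OF G[OF \<eta>01]]
      by (auto intro!: derivative_eq_intros)
    have "((\<lambda>t. mgf x t \<eta>) \<circ> \<tau> has_real_derivative R \<eta> * mgf' x (\<tau> \<eta>) \<eta> * - (1 / R \<eta>)) (at \<eta> within {v..u})"
      by (rule DERIV_image_chain[OF DERIV_subset[OF mgf_time_derivative[OF \<eta>01 x \<tau>[OF \<eta>]]] d\<tau>]) (use \<tau> in auto)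
    then have 1: "((\<lambda>\<eta>'. mgf x (\<tau> \<eta>') \<eta>) has_real_derivative - mgf' x (\<tau> \<eta>) \<eta>) (at \<eta> within {v..u})"
      using riccati_neg[OF \<eta>01] by (simp add: o_def)
    have "continuous_on {v..u} \<tau>"
      unfolding \<tau>_def[abs_def] using G v u
      by (intro continuous_intros DERIV_continuous_on[of _ _ "\<lambda>\<eta>. 1 / R \<eta>"])
        (auto intro: has_field_derivative_at_within)
    then have "continuous_on {v..u} (\<lambda>\<eta>'. mgf' x (\<tau> \<eta>') \<eta>)"
      by (rule continuous_on_compose2[OF mgf'_continuous[OF \<eta>01 x, of T]]) (use \<tau> in auto)
    then have 2: "((\<lambda>\<eta>'. mgf' x (\<tau> \<eta>') \<eta>) \<longlongrightarrow> mgf' x (\<tau> \<eta>) \<eta>) (at \<eta> within {v..u})"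
      using \<eta> by (auto simp: continuous_on_def)
    define rem where "rem \<eta>' = (mgf x (\<tau> \<eta>') \<eta>' - mgf x (\<tau> \<eta>') \<eta> - (\<eta>' - \<eta>) * mgf' x (\<tau> \<eta>') \<eta>) / (\<eta>' - \<eta>)" for \<eta>'
    have 3: "(rem \<longlongrightarrow> 0) (at \<eta> within {v..u})"
    proof (rule Lim_null_comparison)
      show "\<forall>\<^sub>F \<eta>' in at \<eta> within {v..u}. norm (rem \<eta>') \<le> \<bar>\<eta>' - \<eta>\<bar> * D"
        unfolding eventually_at_filter
      proof (intro always_eventually allI impI)
        fix \<eta>' assume n: "\<eta>' \<noteq> \<eta>" "\<eta>' \<in> {v..u}"
        have "\<bar>mgf x (\<tau> \<eta>') \<eta>' - mgf x (\<tau> \<eta>') \<eta> - (\<eta>' - \<eta>) * mgf' x (\<tau> \<eta>') \<eta>\<bar> \<le> (\<eta>' - \<eta>)\<^sup>2 * D"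
          unfolding D_def using n \<eta> u x \<tau>[OF n(2)] by (intro mgf_expansion) auto
        then have "norm (rem \<eta>') \<le> (\<eta>' - \<eta>)\<^sup>2 * D / \<bar>\<eta>' - \<eta>\<bar>"
          unfolding rem_def real_norm_def abs_divide by (intro divide_right_mono) auto
        also have "(\<eta>' - \<eta>)\<^sup>2 * D / \<bar>\<eta>' - \<eta>\<bar> = \<bar>\<eta>' - \<eta>\<bar> * D"
          using n by (simp add: power2_eq_square abs_if field_simps)
        finally show "norm (rem \<eta>') \<le> \<bar>\<eta>' - \<eta>\<bar> * D" .
      qed
      show "((\<lambda>\<eta>'. \<bar>\<eta>' - \<eta>\<bar> * D) \<longlongrightarrow> 0) (at \<eta> within {v..u})"
        by (auto intro!: tendsto_eq_intros)
    qed
    have "((\<lambda>\<eta>'. rem \<eta>' + mgf' x (\<tau> \<eta>') \<eta> + (mgf x (\<tau> \<eta>') \<eta> - mgf x (\<tau> \<eta>) \<eta>) / (\<eta>' - \<eta>)) \<longlongrightarrow>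
        0 + mgf' x (\<tau> \<eta>) \<eta> + - mgf' x (\<tau> \<eta>) \<eta>) (at \<eta> within {v..u})"
      by (intro tendsto_add 2 3 1[unfolded has_field_derivative_iff])
    moreover have "\<forall>\<^sub>F \<eta>' in at \<eta> within {v..u}.
        rem \<eta>' + mgf' x (\<tau> \<eta>') \<eta> + (mgf x (\<tau> \<eta>') \<eta> - mgf x (\<tau> \<eta>) \<eta>) / (\<eta>' - \<eta>) = (q \<eta>' - q \<eta>) / (\<eta>' - \<eta>)"
      unfolding eventually_at_filter
      by (intro always_eventually allI impI) (simp add: rem_def q_def diff_divide_distrib)
    ultimately show ?thesis unfolding has_field_derivative_iff
      by (auto elim: Lim_transform_eventually)
  qed
  then obtain c where "\<And>\<eta>. \<eta> \<in> {v..u} \<Longrightarrow> q \<eta> = c"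
    using has_field_derivative_zero_constant[of "{v..u}" q] by auto
  then have "q v = q u" using v by simp
  then show ?thesis using t mgf_0[OF x] by (simp add: q_def \<tau>_def)
qed

end

section \<open>Osgood's criterion for the Riccati equation\<close>

context levy_exp
begin

definition clock :: "real \<Rightarrow> real" where
  "clock = (SOME G. \<forall>\<eta>. 0 < \<eta> \<longrightarrow> \<eta> < 1 \<longrightarrow> (G has_real_derivative 1 / R \<eta>) (at \<eta>))"

lemma riccati_isCont:
  assumes "0 < u" "u < 1" shows "isCont (R) u"
  using continuous_on_interior[OF riccati_continuous, of u] assms by simp

lemma clock_deriv:
  assumes "0 < \<eta>" "\<eta> < 1" shows "(clock has_real_derivative 1 / R \<eta>) (at \<eta>)"
proof -
  have "\<exists>F. \<forall>x. ereal 0 < ereal x \<longrightarrow> ereal x < ereal 1 \<longrightarrow> (F has_vector_derivative 1 / R x) (at x)"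
  proof -
    have "isCont (\<lambda>\<eta>. 1 / R \<eta>) x" if "ereal 0 < ereal x" "ereal x < ereal 1" for x
      using riccati_isCont[of x] riccati_neg[of x] that by (intro continuous_intros) auto
    then show ?thesis by (intro einterval_antiderivative) simp_all
  qed
  then have "\<exists>G. \<forall>\<eta>. 0 < \<eta> \<longrightarrow> \<eta> < 1 \<longrightarrow> (G has_real_derivative 1 / R \<eta>) (at \<eta>)"
    by (simp add: has_real_derivative_iff_has_vector_derivative)
  from someI_ex[OF this] show ?thesis using assms unfolding clock_def by blast
qed

lemma clock_isCont: "0 < u \<Longrightarrow> u < 1 \<Longrightarrow> isCont clock u"
  using clock_deriv DERIV_isCont by blast

lemma clock_strict_antimono:
  assumes "0 < a" "a < b" "b < 1" shows "clock b < clock a"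
proof (rule DERIV_neg_imp_decreasing[OF assms(2)])
  fix x assume "a \<le> x" "x \<le> b"
  then show "\<exists>y. (clock has_real_derivative y) (at x) \<and> y < 0"
    using assms clock_deriv[of x] riccati_neg[of x] by (intro exI[of _ "1 / R x"]) auto
qed

lemma clock_antimono: "0 < a \<Longrightarrow> a \<le> b \<Longrightarrow> b < 1 \<Longrightarrow> clock b \<le> clock a"
  using clock_strict_antimono[of a b] by (cases "a = b") auto

lemma clock_less_cancel:
  assumes "0 < a" "a < 1" "0 < b" "b < 1" "clock a < clock b" shows "b < a"
  using clock_antimono[of a b] assms by (cases "b < a") auto

text \<open>Compare with $-\ln(u)/b$: by \<open>riccati_lower\<close> the sum of the clock and $\ln(u)/b$ decreases. In
  particular the clock is infinite at 0, so it can be advanced by any amount.\<close>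

lemma clock_growth:
  assumes "0 < v" "v \<le> u" "u < 1"
  shows "clock u + (ln u - ln v) / drift \<mu> \<le> clock v"
proof -
  have "clock u + ln u / drift \<mu> \<le> clock v + ln v / drift \<mu>"
  proof (rule DERIV_nonpos_imp_nonincreasing[OF assms(2)])
    fix x assume "v \<le> x" "x \<le> u"
    then have x: "0 < x" "x < 1" using assms by auto
    have "((\<lambda>x. clock x + ln x / drift \<mu>) has_real_derivative 1 / R x + 1 / x / drift \<mu>) (at x)"
      using x by (intro DERIV_add clock_deriv DERIV_cdivide DERIV_ln_divide)
    moreover have "1 / (drift \<mu> * x) \<le> 1 / (- R x)"
      using riccati_lower[of x] riccati_neg[of x] x drift_pos
      by (intro frac_le) auto
    then have "1 / R x + 1 / x / drift \<mu> \<le> 0" by (simp add: mult.commute)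
    ultimately show "\<exists>y. ((\<lambda>x. clock x + ln x / drift \<mu>) has_real_derivative y) (at x) \<and> y \<le> 0" by blast
  qed
  then show ?thesis by (simp add: diff_divide_distrib)
qed

lemma clock_advance:
  assumes "0 < u" "u < 1" "0 \<le> t"
  obtains v where "0 < v" "v \<le> u" "clock v = clock u + t"
proof -
  define w where "w = u * exp (- (drift \<mu> * t))"
  have w: "0 < w" "w \<le> u" using assms drift_pos by (auto simp: w_def)
  have "ln w = ln u - drift \<mu> * t" using assms by (simp add: w_def ln_mult)
  then have "clock u + t \<le> clock w" using clock_growth[OF w assms(2)] drift_pos by simp
  moreover have "continuous_on {w..u} clock"
    using w assms by (intro continuous_at_imp_continuous_on ballI clock_isCont) auto
  ultimately obtain v where "w \<le> v" "v \<le> u" "clock v = clock u + t"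
    using IVT2'[of clock u "clock u + t" w] w assms by auto
  then show ?thesis using w by (intro that[of v]) linarith+
qed

text \<open>As the clock decreases, this only concerns the behaviour at 1: it says that the time a Riccati
  solution needs to fall from 1 to a given lower value is finite.\<close>

definition clock_bounded :: bool where
  "clock_bounded \<longleftrightarrow> (\<exists>L. \<forall>u. 0 < u \<longrightarrow> u < 1 \<longrightarrow> L \<le> clock u)"

lemma clock_limit:
  assumes clock_bounded
  obtains L where "(clock \<longlongrightarrow> L) (at_left 1)" "\<And>u. 0 < u \<Longrightarrow> u < 1 \<Longrightarrow> L < clock u"
    "\<And>t. 0 < t \<Longrightarrow> \<exists>u. 0 < u \<and> u < 1 \<and> clock u < L + t"
proof -
  define L where "L = Inf (clock ` {0<..<1})"
  have bdd: "bdd_below (clock ` {0<..<1})" using assms unfolding clock_bounded_def bdd_below_def by force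
  have le: "L \<le> clock u" if "0 < u" "u < 1" for u
    unfolding L_def using that bdd by (intro cInf_lower) auto
  have less: "L < clock u" if "0 < u" "u < 1" for u
    using le[of "(1 + u) / 2"] clock_strict_antimono[of u "(1 + u) / 2"] that by simp
  have near: "\<exists>u. 0 < u \<and> u < 1 \<and> clock u < a" if "L < a" for a
    using that cInf_less_iff[of "clock ` {0<..<1}" a] bdd unfolding L_def by auto
  have "(clock \<longlongrightarrow> L) (at_left 1)"
  proof (rule order_tendstoI)
    fix a assume "a < L"
    then show "\<forall>\<^sub>F u in at_left 1. a < clock u"
      unfolding eventually_at_left_field using less by (intro exI[of _ 0]) force
  next
    fix a assume "L < a"
    then obtain w where w: "0 < w" "w < 1" "clock w < a" using near by blast
    then show "\<forall>\<^sub>F u in at_left 1. clock u < a"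
      unfolding eventually_at_left_field using le_less_trans[OF clock_antimono[of w]]
      by (intro exI[of _ w]) auto
  qed
  then show ?thesis using that[of L] less near by simp
qed

lemma clock_bounded_iff_integrable:
  "clock_bounded \<longleftrightarrow> (\<exists>\<epsilon>>0. set_integrable lborel {1 - \<epsilon><..<1} (\<lambda>\<eta>. 1 / R \<eta>))"
proof
  assume clock_bounded
  then obtain L where L: "(clock \<longlongrightarrow> L) (at_left 1)" using clock_limit by metis
  have eq: "einterval (ereal (1/2)) (ereal 1) = {1/2<..<1::real}" by (simp add: einterval_eq)
  have "set_integrable lborel (einterval (ereal (1/2)) (ereal 1)) (\<lambda>\<eta>. - (1 / R \<eta>))"
  proof (rule interval_integral_FTC_nonneg(1))
    show "ereal (1/2) < ereal 1" by simp
    show "DERIV (\<lambda>x. - clock x) x :> - (1 / R x)" if "ereal (1/2) < ereal x" "ereal x < ereal 1" for x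
      using that clock_deriv[of x] by (intro DERIV_minus) auto
    show "isCont (\<lambda>\<eta>. - (1 / R \<eta>)) x" if "ereal (1/2) < ereal x" "ereal x < ereal 1" for x
      using that riccati_isCont[of x] riccati_neg[of x] by (intro continuous_intros) auto
    show "AE x in lborel. ereal (1/2) < ereal x \<longrightarrow> ereal x < ereal 1 \<longrightarrow> 0 \<le> - (1 / R x)"
      using riccati_neg by (intro AE_I2) (auto simp: divide_nonneg_neg less_imp_le)
    have "((\<lambda>x. - clock x) \<longlongrightarrow> - clock (1/2)) (at (1/2))"
      using clock_isCont[of "1/2"] by (intro tendsto_minus) (simp add: isCont_def)
    then have "((\<lambda>x. - clock x) \<longlongrightarrow> - clock (1/2)) (at_right (1/2))"
      by (rule filterlim_mono[OF _ order_refl]) (simp add: at_le)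
    then show "(((\<lambda>x. - clock x) \<circ> real_of_ereal) \<longlongrightarrow> - clock (1/2)) (at_right (ereal (1/2)))"
      by (simp add: ereal_tendsto_simps)
    have "((\<lambda>x. - clock x) \<longlongrightarrow> - L) (at_left 1)" using L by (rule tendsto_minus)
    then show "(((\<lambda>x. - clock x) \<circ> real_of_ereal) \<longlongrightarrow> - L) (at_left (ereal 1))"
      by (simp only: ereal_tendsto_simps)
  qed
  then have "set_integrable lborel {1/2<..<1} (\<lambda>\<eta>. - (- (1 / R \<eta>)))"
    unfolding eq set_integrable_def by simp
  then show "\<exists>\<epsilon>>0. set_integrable lborel {1 - \<epsilon><..<1} (\<lambda>\<eta>. 1 / R \<eta>)"
    by (intro exI[of _ "1/2"]) simp
next
  assume "\<exists>\<epsilon>>0. set_integrable lborel {1 - \<epsilon><..<1} (\<lambda>\<eta>. 1 / R \<eta>)"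
  then obtain \<epsilon> where \<epsilon>: "\<epsilon> > 0" "set_integrable lborel {1 - \<epsilon><..<1} (\<lambda>\<eta>. 1 / R \<eta>)" by blast
  define a where "a = max (1 - \<epsilon>) (1/2)"
  have a: "0 < a" "a < 1" using \<epsilon>(1) by (auto simp: a_def)
  have "set_integrable lborel {a<..<1} (\<lambda>\<eta>. 1 / R \<eta>)"
    by (rule set_integrable_subset[OF \<epsilon>(2)]) (auto simp: a_def)
  then have "(\<lambda>\<eta>. 1 / R \<eta>) integrable_on {a<..<1}"
    by (rule set_borel_integral_eq_integral(1))
  then have int: "(\<lambda>\<eta>. - (1 / R \<eta>)) integrable_on {a<..<1}" by (rule integrable_neg)
  define I where "I = integral {a<..<1} (\<lambda>\<eta>. - (1 / R \<eta>))"
  define c where "c = (a + 1) / 2"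
  have c: "a < c" "c < 1" using a by (auto simp: c_def)
  have nn: "0 \<le> - (1 / R x)" if "x \<in> {a<..<1}" for x
    using riccati_neg[of x] that a by (simp add: divide_nonneg_neg)
  have I: "0 \<le> I" unfolding I_def using int nn by (intro integral_nonneg) auto
  have "clock c - I \<le> clock u" if u: "0 < u" "u < 1" for u
  proof (cases "u \<le> c")
    case True
    then show ?thesis using clock_antimono[of u c] u c I by simp
  next
    case False
    have hi: "((\<lambda>\<eta>. - (1 / R \<eta>)) has_integral - clock u - - clock c) {c..u}"
    proof (rule fundamental_theorem_of_calculus)
      fix x assume "x \<in> {c..u}"
      then have "((\<lambda>x. - clock x) has_real_derivative - (1 / R x)) (at x within {c..u})"
        using a c u by (intro DERIV_minus has_field_derivative_at_within[OF clock_deriv]) auto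
      then show "((\<lambda>x. - clock x) has_vector_derivative - (1 / R x)) (at x within {c..u})"
        by (simp add: has_real_derivative_iff_has_vector_derivative)
    qed (use False in simp)
    have "integral {c..u} (\<lambda>\<eta>. - (1 / R \<eta>)) \<le> I"
      unfolding I_def using int nn c u has_integral_integrable[OF hi] by (intro integral_subset_le) auto
    then show ?thesis unfolding integral_unique[OF hi] by simp
  qed
  then show clock_bounded unfolding clock_bounded_def by blast
qed

lemma riccati_solution_const: "riccati_solution \<mu> (\<lambda>_. 1)"
  by (simp add: riccati_solution_def)

text \<open>After its last visit to 1 the solution moves inside $(0,1)$ for a while, and there
  $G(g(t)) - t$ is constant. Since $g$ tends to 1 at that last visit, $G$ is bounded below near 1.\<close>

lemma clock_bounded_if_leaves_1:
  assumes g: "riccati_solution \<mu> g" and t1: "0 \<le> t1" "g t1 < 1"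
  shows clock_bounded
proof -
  have g0: "g 0 = 1" and g1: "\<And>t. 0 \<le> t \<Longrightarrow> g t \<le> 1"
    and gd: "\<And>t. 0 \<le> t \<Longrightarrow> (g has_real_derivative R (g t)) (at t within {0..})"
    using g by (auto simp: riccati_solution_def)
  have gc: "continuous_on {0..} g" by (rule DERIV_continuous_on[of _ _ "\<lambda>t. R (g t)"]) (use gd in simp)
  define Z where "Z = {t \<in> {0..t1}. g t = 1}"
  have "closed Z" unfolding Z_def
    by (rule continuous_closed_preimage_constant[OF continuous_on_subset[OF gc]]) auto
  moreover have "Z \<noteq> {}" "bdd_above Z" using g0 t1 by (auto simp: Z_def bdd_above_def)
  ultimately have "Sup Z \<in> Z" by (intro closed_contains_Sup)
  define t0 where "t0 = Sup Z"
  have t0: "0 \<le> t0" "t0 < t1" "g t0 = 1"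
    using \<open>Sup Z \<in> Z\<close> t1 unfolding t0_def Z_def by (auto simp: order.order_iff_strict)
  have lt1: "g t < 1" if "t0 < t" "t \<le> t1" for t
  proof (rule ccontr)
    assume "\<not> g t < 1"
    then have "t \<in> Z" using g1[of t] that t0 by (auto simp: Z_def)
    then have "t \<le> t0" unfolding t0_def using \<open>bdd_above Z\<close> by (rule cSup_upper)
    then show False using that by simp
  qed
  have near: "\<exists>d>0. \<forall>t. 0 \<le> t \<longrightarrow> \<bar>t - t0\<bar> < d \<longrightarrow> u < g t" if "u < 1" for u
  proof -
    from gc t0(1) have "\<exists>d>0. \<forall>t\<in>{0..}. dist t t0 < d \<longrightarrow> dist (g t) (g t0) < 1 - u"
      using that unfolding continuous_on_iff by (metis atLeast_iff diff_gt_0_iff_gt)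
    then show ?thesis using t0(3) by (force simp: dist_real_def)
  qed
  obtain d where d: "d > 0" "\<And>t. 0 \<le> t \<Longrightarrow> \<bar>t - t0\<bar> < d \<Longrightarrow> 0 < g t" using near[of 0] by auto
  define t2 where "t2 = min t1 (t0 + d)"
  have t2: "t0 < t2" using t0 d by (simp add: t2_def)
  have in01: "0 < g t" "g t < 1" if "t \<in> {t0<..<t2}" for t
    using d(2)[of t] lt1[of t] that t0 by (auto simp: t2_def)
  have "((\<lambda>t. clock (g t) - t) has_real_derivative 0) (at t within {t0<..<t2})" if t: "t \<in> {t0<..<t2}" for t
  proof -
    have "(g has_real_derivative R (g t)) (at t within {t0<..<t2})"
      by (rule DERIV_subset[OF gd]) (use t t0 in auto)
    from DERIV_chain2[OF clock_deriv[OF in01[OF t]] this]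
    have "((\<lambda>t. clock (g t)) has_real_derivative 1) (at t within {t0<..<t2})"
      using riccati_neg[OF in01[OF t]] by simp
    from DERIV_diff[OF this DERIV_ident] show ?thesis by simp
  qed
  then obtain C where C: "\<And>t. t \<in> {t0<..<t2} \<Longrightarrow> clock (g t) - t = C"
    using has_field_derivative_zero_constant[of "{t0<..<t2}" "\<lambda>t. clock (g t) - t"] by auto
  have "C + t0 \<le> clock u" if u: "0 < u" "u < 1" for u
  proof -
    obtain e where e: "e > 0" "\<And>t. 0 \<le> t \<Longrightarrow> \<bar>t - t0\<bar> < e \<Longrightarrow> u < g t" using near[OF u(2)] by auto
    define t where "t = t0 + min e (t2 - t0) / 2"
    have t: "t \<in> {t0<..<t2}" "\<bar>t - t0\<bar> < e" using e(1) t2 by (auto simp: t_def min_def field_simps)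
    have "u < g t" using e(2)[OF _ t(2)] t t0 by auto
    then have "clock (g t) \<le> clock u" using u in01[OF t(1)] by (intro clock_antimono) auto
    then show ?thesis using C[OF t(1)] t(1) by auto
  qed
  then show ?thesis unfolding clock_bounded_def by blast
qed

text \<open>If $L$ is the limit of the clock at 1, the equation $G(g(t)) = L + t$ defines a solution for
  $t > 0$ that starts from 1. Its derivative at 0 vanishes by the mean value theorem, because
  $R$ is continuous at 1 with value 0.\<close>

lemma riccati_solution_leaving_1:
  assumes clock_bounded obtains g where "riccati_solution \<mu> g" "g 1 < 1"
proof -
  obtain L where L: "\<And>u. 0 < u \<Longrightarrow> u < 1 \<Longrightarrow> L < clock u"
    "\<And>t. 0 < t \<Longrightarrow> \<exists>u. 0 < u \<and> u < 1 \<and> clock u < L + t" using clock_limit[OF assms] by metis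
  define g where "g t = (if t \<le> 0 then 1 else SOME v. 0 < v \<and> v < 1 \<and> clock v = L + t)" for t
  have g: "0 < g t" "g t < 1" "clock (g t) - L = t" if t: "0 < t" for t
  proof -
    obtain u where u: "0 < u" "u < 1" "clock u < L + t" using L(2)[OF t] by blast
    obtain v where "0 < v" "v \<le> u" "clock v = clock u + (L + t - clock u)"
      using clock_advance[of u "L + t - clock u"] u by auto
    then have "\<exists>v. 0 < v \<and> v < 1 \<and> clock v = L + t" using u by (intro exI[of _ v]) auto
    from someI_ex[OF this] show "0 < g t" "g t < 1" "clock (g t) - L = t" using t by (auto simp: g_def)
  qed
  have inv: "g (clock v - L) = v" if "0 < v" "v < 1" for v
    using g[of "clock v - L"] L(1)[OF that] that clock_strict_antimono[of v "g (clock v - L)"]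
      clock_strict_antimono[of "g (clock v - L)" v] by (cases v "g (clock v - L)" rule: linorder_cases) auto
  have gcont: "isCont g t" if "0 < t" for t
  proof -
    define d where "d = min (g t) (1 - g t) / 2"
    have d: "0 < d" "\<And>z. \<bar>z - g t\<bar> \<le> d \<Longrightarrow> 0 < z \<and> z < 1"
      using g[OF that] by (auto simp: d_def min_def field_simps abs_if split: if_splits)
    have "isCont g (clock (g t) - L)"
      by (rule isCont_inverse_function[OF d(1), of "g t" g "\<lambda>v. clock v - L"])
        (use d(2) inv clock_isCont in \<open>auto intro!: continuous_intros\<close>)
    then show ?thesis using g(3)[OF that] by simp
  qed
  have gder: "(g has_real_derivative R (g t)) (at t)" if t: "0 < t" for t
  proof -
    have "((\<lambda>v. clock v - L) has_real_derivative 1 / R (g t)) (at (g t))"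
      using DERIV_diff[OF clock_deriv[OF g(1,2)[OF t]] DERIV_const[of L]] by simp
    from DERIV_inverse_function[of _ _ g t 0 "t + 1", OF this] have
      "(g has_real_derivative inverse (1 / R (g t))) (at t)"
      using riccati_neg[OF g(1,2)[OF t]] t g(3) gcont[OF t] by auto
    then show ?thesis by simp
  qed
  have near0: "\<exists>d>0. \<forall>t. 0 < t \<longrightarrow> t < d \<longrightarrow> u < g t" if "u < 1" for u
  proof -
    define w where "w = max u (1/2)"
    have w: "0 < w" "w < 1" "u \<le> w" using that by (auto simp: w_def)
    have "u < g t" if "0 < t" "t < clock w - L" for t
      using clock_less_cancel[of "g t" w] g[OF that(1)] that w by auto
    then show ?thesis using L(1)[OF w(1,2)] by (intro exI[of _ "clock w - L"]) auto
  qed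
  have g_0: "g 0 = 1" by (simp add: g_def)
  have contg: "continuous_on {0..t} g" for t
    unfolding continuous_on_eq_continuous_within
  proof
    fix s assume s: "s \<in> {0..t}"
    show "continuous (at s within {0..t}) g"
    proof (cases "s = 0")
      case True
      have "\<exists>d>0. \<forall>x'\<in>{0..t}. dist x' 0 < d \<longrightarrow> dist (g x') (g 0) < e" if e: "e > 0" for e
      proof -
        obtain d where d: "d > 0" "\<And>t. 0 < t \<Longrightarrow> t < d \<Longrightarrow> 1 - e < g t" using near0[of "1 - e"] e by auto
        have "dist (g x') (g 0) < e" if x: "x' \<in> {0..t}" "dist x' 0 < d" for x'
          using d(2)[of x'] g(2)[of x'] x g_0 \<open>e > 0\<close> by (cases "x' = 0") (auto simp: dist_real_def)
        then show ?thesis using d(1) by blast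
      qed
      then show ?thesis unfolding True continuous_within_eps_delta by (simp add: dist_real_def)
    next
      case False
      then show ?thesis
        by (intro continuous_at_imp_continuous_at_within[OF gcont]) (use s in simp)
    qed
  qed
  have gder0: "(g has_real_derivative R (g 0)) (at 0 within {0..})"
    unfolding has_field_derivative_iff
  proof (rule tendstoI)
    fix e :: real assume e: "0 < e"
    obtain \<delta> where \<delta>: "\<delta> > 0" "\<And>w. w \<in> {0..1} \<Longrightarrow> \<bar>w - 1\<bar> < \<delta> \<Longrightarrow> \<bar>R w\<bar> < e"
      using riccati_continuous[unfolded continuous_on_iff, rule_format, of 1 e] e
      by (auto simp: dist_real_def)
    obtain d where d: "d > 0" "\<And>t. 0 < t \<Longrightarrow> t < d \<Longrightarrow> 1 - \<delta> < g t" using near0[of "1 - \<delta>"] \<delta>(1) by auto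
    have "dist ((g t - g 0) / (t - 0)) (R (g 0)) < e" if t: "0 < t" "t < d" for t
    proof -
      obtain z where z: "0 < z" "z < t" "g t - g 0 = R (g z) * (t - 0)"
        using mvt[OF t(1) contg, of "\<lambda>x. (*) (R (g x))"] gder[unfolded has_field_derivative_def] by blast
      have "\<bar>R (g z)\<bar> < e" using \<delta>(2)[of "g z"] d(2)[of z] g[OF z(1)] z t by auto
      then show ?thesis using z t g_0 by (simp add: dist_real_def)
    qed
    then show "\<forall>\<^sub>F t in at 0 within {0..}. dist ((g t - g 0) / (t - 0)) (R (g 0)) < e"
      unfolding eventually_at using d(1) by (intro exI[of _ d]) (auto simp: dist_real_def)
  qed
  have "riccati_solution \<mu> g" unfolding riccati_solution_def
  proof (intro conjI allI impI)
    fix t :: real assume t: "0 \<le> t"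
    show "g t \<le> 1" using g(2)[of t] g_0 t by (cases "t = 0") auto
    show "(g has_real_derivative R (g t)) (at t within {0..})"
      using gder0 gder[of t] t by (cases "t = 0") (auto intro: has_field_derivative_at_within)
  qed (rule g_0)
  then show ?thesis using that g(2)[of 1] by simp
qed

lemma clock_bounded_iff_nonunique:
  "clock_bounded \<longleftrightarrow> (\<exists>g h. riccati_solution \<mu> g \<and> riccati_solution \<mu> h \<and> (\<exists>t\<ge>0. g t \<noteq> h t))"
proof
  assume clock_bounded
  then obtain g where "riccati_solution \<mu> g" "g 1 < 1" by (rule riccati_solution_leaving_1)
  then show "\<exists>g h. riccati_solution \<mu> g \<and> riccati_solution \<mu> h \<and> (\<exists>t\<ge>0. g t \<noteq> h t)"
    using riccati_solution_const by (intro exI[of _ g] exI[of _ "\<lambda>_. 1"]) (auto intro!: exI[of _ 1])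
next
  assume "\<exists>g h. riccati_solution \<mu> g \<and> riccati_solution \<mu> h \<and> (\<exists>t\<ge>0. g t \<noteq> h t)"
  then obtain g h t where gh: "riccati_solution \<mu> g" "riccati_solution \<mu> h" "0 \<le> t" "g t \<noteq> h t" by blast
  then have "g t \<le> 1" "h t \<le> 1" by (auto simp: riccati_solution_def)
  then have "g t < 1 \<or> h t < 1" using gh(4) by linarith
  then show clock_bounded using clock_bounded_if_leaves_1 gh by blast
qed

end

section \<open>Exponential moments at the critical exponent\<close>

context levy_exp
begin

text \<open>The infinitesimal form of the clock: $v_n$ is where the solution started at $u$ is after the
  short time $\delta_n$.\<close>

lemma clock_rate:
  assumes u: "0 < u" "u < 1"
    and v: "\<And>n. 0 < v n" "\<And>n. v n \<le> u" "\<And>n. clock (v n) = clock u + \<delta> n"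
    and \<delta>: "\<And>n. 0 < \<delta> n" "\<delta> \<longlonglongrightarrow> 0"
  shows "(\<lambda>n. (u - v n) / \<delta> n) \<longlonglongrightarrow> - R u"
proof -
  have ne: "v n \<noteq> u" for n using v(3)[of n] \<delta>(1)[of n] by auto
  have "v \<longlonglongrightarrow> u"
  proof (rule order_tendstoI)
    fix a assume a: "a < u"
    define w where "w = max a (u / 2)"
    have w: "0 < w" "w < u" "a \<le> w" using a u by (auto simp: w_def)
    have "0 < clock w - clock u" using clock_strict_antimono[of w u] w u by simp
    then have "\<forall>\<^sub>F n in sequentially. \<delta> n < clock w - clock u" using \<delta>(2) by (rule order_tendstoD(2)[rotated])
    then show "\<forall>\<^sub>F n in sequentially. a < v n"
    proof eventually_elim
      case (elim n)
      then have "clock (v n) < clock w" using v(3)[of n] by simp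
      then have "w < v n" using clock_less_cancel[of "v n" w] v(1,2)[of n] w u by simp
      then show ?case using w(3) by simp
    qed
  next
    fix a assume "u < a"
    then show "\<forall>\<^sub>F n in sequentially. v n < a" using v(2) by (intro always_eventually allI) (meson le_less_trans)
  qed
  then have "filterlim v (at u) sequentially" using ne by (simp add: filterlim_at)
  from filterlim_compose[OF clock_deriv[OF u, unfolded has_field_derivative_iff] this]
  have "(\<lambda>n. inverse ((clock (v n) - clock u) / (v n - u))) \<longlonglongrightarrow> inverse (1 / R u)"
    using riccati_neg[OF u] by (intro tendsto_inverse) auto
  then have "(\<lambda>n. - inverse ((clock (v n) - clock u) / (v n - u))) \<longlonglongrightarrow> - R u"
    by (intro tendsto_minus) simp
  moreover have "- inverse ((clock (v n) - clock u) / (v n - u)) = (u - v n) / \<delta> n" for n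
    using v(3)[of n] by (simp add: minus_divide_left)
  ultimately show ?thesis by simp
qed

end

lemma left_unit_seq:
  defines "s \<equiv> \<lambda>n. 1 - 1 / real (n + 2)"
  shows "0 < s n" "s n < 1" "s \<longlonglongrightarrow> 1"
proof -
  show "0 < s n" "s n < 1" by (auto simp: s_def)
  have "(\<lambda>n. 1 - inverse (real (Suc (Suc n)))) \<longlonglongrightarrow> 1 - 0"
    by (intro tendsto_diff tendsto_const LIMSEQ_Suc[OF LIMSEQ_inverse_real_of_nat])
  then show "s \<longlonglongrightarrow> 1" by (simp add: s_def inverse_eq_divide add.commute)
qed

context affine_feller
begin

lemma mgf_clock:
  assumes "0 < v" "v \<le> u" "u < 1" "clock v = clock u + t" "0 \<le> x"
  shows "mgf x t u = exp (v * x)"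
  by (rule mgf_characteristic[OF clock_deriv assms(1-3,5,4)])

lemma mgf_le_exp_integral:
  assumes "0 \<le> t" "0 \<le> x" "u \<le> 1" shows "mgf x t u \<le> (LINT y|K t x. exp y)"
  unfolding mgf_def using assms mult_right_mono[of u 1]
  by (intro integral_mono exp_scaled_integrable exp_integrable) (auto simp: space_kernel)

text \<open>Given $w < 1$, an unbounded clock allows a start $u < 1$ so close to 1 that the solution is
  still above $w$ at time $t$.\<close>

lemma exp_conserved:
  assumes "\<not> clock_bounded" "0 \<le> t" "0 \<le> x"
  shows "(LINT y|K t x. exp y) = exp x"
proof (rule antisym[OF exp_integral_le[OF assms(2,3)]])
  have le: "exp (w * x) \<le> (LINT y|K t x. exp y)" if w: "0 < w" "w < 1" for w
  proof -
    obtain u where u: "0 < u" "u < 1" "clock u < clock w - t"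
      using assms(1) unfolding clock_bounded_def by (meson not_le)
    obtain v where v: "0 < v" "v \<le> u" "clock v = clock u + t" using clock_advance[OF u(1,2) assms(2)] .
    have "w < v" using clock_less_cancel[of v w] u v w by simp
    then have "exp (w * x) \<le> mgf x t u" using mgf_clock[OF v(1,2) u(2) v(3) assms(3)] assms(3)
      by (simp add: mult_right_mono)
    also have "\<dots> \<le> (LINT y|K t x. exp y)" using assms u by (intro mgf_le_exp_integral) auto
    finally show ?thesis .
  qed
  have "(\<lambda>n. exp ((1 - 1 / real (n + 2)) * x)) \<longlonglongrightarrow> exp (1 * x)"
    by (intro tendsto_intros left_unit_seq)
  then have "exp (1 * x) \<le> (LINT y|K t x. exp y)"
    by (rule LIMSEQ_le_const2) (use le left_unit_seq in blast)
  then show "exp x \<le> (LINT y|K t x. exp y)" by simp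
qed

text \<open>If the clock is bounded, solutions started from any $u < 1$ are below a common $w < 1$ at time
  $t$, and the limit $u \to 1$ keeps the resulting bound on the moments.\<close>

lemma exp_lost:
  assumes clock_bounded "0 < t" "0 < x"
  shows "(LINT y|K t x. exp y) < exp x"
proof -
  obtain L where L: "\<And>u. 0 < u \<Longrightarrow> u < 1 \<Longrightarrow> L < clock u"
    "\<And>t. 0 < t \<Longrightarrow> \<exists>u. 0 < u \<and> u < 1 \<and> clock u < L + t" using clock_limit[OF assms(1)] by metis
  obtain w where w: "0 < w" "w < 1" "clock w < L + t" using L(2)[OF assms(2)] by blast
  have t: "0 \<le> t" "0 \<le> x" using assms by auto
  have le: "mgf x t u \<le> exp (w * x)" if u: "0 < u" "u < 1" for u
  proof -
    obtain v where v: "0 < v" "v \<le> u" "clock v = clock u + t" using clock_advance[OF u t(1)] .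
    have "v < w" using clock_less_cancel[of w v] L(1)[OF u] u v w by simp
    then show ?thesis using mgf_clock[OF v(1,2) u(2) v(3) t(2)] t(2) by (simp add: mult_right_mono)
  qed
  have "(\<lambda>n. mgf x t (1 - 1 / real (n + 2))) \<longlonglongrightarrow> (LINT y|K t x. exp (1 * y))"
    unfolding mgf_def
  proof (rule integral_dominated_convergence)
    show "integrable (K t x) exp" by (rule exp_integrable[OF t])
    show "AE y in K t x. (\<lambda>n. exp ((1 - 1 / real (n + 2)) * y)) \<longlonglongrightarrow> exp (1 * y)"
      by (intro AE_I2 tendsto_intros left_unit_seq)
    show "AE y in K t x. norm (exp ((1 - 1 / real (n + 2)) * y)) \<le> exp y" for n
      using mult_right_mono[OF less_imp_le[OF left_unit_seq(2)[of n]]]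
      by (intro AE_I2) (fastforce simp: space_kernel[OF t])
  qed (auto intro!: kernel_borel_measurable[OF t] measurable_borel_nonneg)
  then have "(LINT y|K t x. exp (1 * y)) \<le> exp (w * x)"
    by (rule LIMSEQ_le_const2) (use le left_unit_seq in blast)
  also have "\<dots> < exp x" using w assms(3) by simp
  finally show ?thesis by simp
qed

end

section \<open>The Markov property for exponentials\<close>

context usual_filtered_prob_space
begin

abbreviation expect_on :: "'a set \<Rightarrow> ('a \<Rightarrow> real) \<Rightarrow> real" where
  "expect_on A f \<equiv> \<integral>\<omega>. indicator A \<omega> * f \<omega> \<partial>M"

lemma F_space: "0 \<le> t \<Longrightarrow> space (F t) = space M"
  and F_sets: "0 \<le> t \<Longrightarrow> A \<in> sets (F t) \<Longrightarrow> A \<in> sets M"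
  using subalgebra_F[of t] by (auto simp: subalgebra_def)

lemma F_measurable_M: "0 \<le> t \<Longrightarrow> f \<in> borel_measurable (F t) \<Longrightarrow> f \<in> borel_measurable M"
  by (rule measurable_from_subalg[OF subalgebra_F])

lemma F_measurable_mono:
  assumes "0 \<le> s" "s \<le> t" "f \<in> borel_measurable (F s)" shows "f \<in> borel_measurable (F t)"
proof (rule measurable_from_subalg[OF _ assms(3)])
  show "subalgebra (F t) (F s)"
    using F_mono[OF assms(1,2)] F_space[of s] F_space[of t] assms(1,2) by (simp add: subalgebra_def)
qed

lemma martingaleI:
  assumes "adapted F Y" "\<And>t. 0 \<le> t \<Longrightarrow> integrable M (Y t)"
    and "\<And>s t A. 0 \<le> s \<Longrightarrow> s \<le> t \<Longrightarrow> A \<in> sets (F s) \<Longrightarrow>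
      (expect_on A (\<lambda>\<omega>. Y t \<omega>)) = expect_on A (\<lambda>\<omega>. Y s \<omega>)"
  shows "martingale M F Y"
  unfolding martingale_def
proof (intro conjI allI impI)
  fix s t :: real assume st: "0 \<le> s \<and> s \<le> t"
  interpret S: finite_measure_subalgebra M "F s"
    using st by unfold_locales (auto intro: subalgebra_F)
  show "AE \<omega> in M. real_cond_exp M (F s) (Y t) \<omega> = Y s \<omega>"
    using st assms
    by (intro S.real_cond_exp_charact) (auto simp: adapted_def set_lebesgue_integral_def)
qed (use assms in auto)

end

locale affine_process = affine_feller \<mu> K + usual_filtered_prob_space M F
  for \<mu> K and M :: "'a measure" and F +
  fixes X :: "real \<Rightarrow> 'a \<Rightarrow> real" and x0 :: real
  assumes process: "feller_process M F K X"
    and x0_pos: "0 < x0" and X_0: "\<And>\<omega>. \<omega> \<in> space M \<Longrightarrow> X 0 \<omega> = x0"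
begin

lemma X_adapted: "0 \<le> t \<Longrightarrow> X t \<in> borel_measurable (F t)"
  using process by (simp add: feller_process_def adapted_def)

lemma X_measurable: "0 \<le> t \<Longrightarrow> X t \<in> borel_measurable M"
  using X_adapted F_measurable_M by blast

lemma X_nonneg: "0 \<le> t \<Longrightarrow> \<omega> \<in> space M \<Longrightarrow> 0 \<le> X t \<omega>"
  and X_cadlag: "\<omega> \<in> space M \<Longrightarrow> cadlag (\<lambda>t. X t \<omega>)"
proof -
  have "\<forall>\<omega>\<in>space M. (\<forall>t\<ge>0. 0 \<le> X t \<omega>) \<and> cadlag (\<lambda>t. X t \<omega>)"
    using process unfolding feller_process_def by blast
  then show "0 \<le> t \<Longrightarrow> \<omega> \<in> space M \<Longrightarrow> 0 \<le> X t \<omega>" "\<omega> \<in> space M \<Longrightarrow> cadlag (\<lambda>t. X t \<omega>)" by auto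
qed

lemma X_measurable_nonneg: "0 \<le> t \<Longrightarrow> X t \<in> M \<rightarrow>\<^sub>M borel_nonneg"
  using X_measurable X_nonneg by (intro measurable_restrict_space2) auto

lemma markov_bounded:
  assumes "0 \<le> s" "0 \<le> t" "A \<in> sets (F s)" "f \<in> borel_measurable borel_nonneg" "\<And>y. 0 \<le> y \<Longrightarrow> \<bar>f y\<bar> \<le> B"
  shows "expect_on A (\<lambda>\<omega>. f (X (s + t) \<omega>)) = expect_on A (\<lambda>\<omega>. transition_op K t f (X s \<omega>))"
proof -
  interpret S: finite_measure_subalgebra M "F s"
    using assms(1) by unfold_locales (auto intro: subalgebra_F)
  have "bounded (f ` {0..})" using assms(5) by (auto simp: bounded_iff)
  then have ce: "AE \<omega> in M. real_cond_exp M (F s) (\<lambda>\<omega>'. f (X (s + t) \<omega>')) \<omega> = transition_op K t f (X s \<omega>)"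
    using process assms(1,2,4) unfolding feller_process_def by blast
  have m: "(\<lambda>\<omega>. f (X (s + t) \<omega>)) \<in> borel_measurable M"
    using assms by (intro measurable_compose[OF X_measurable_nonneg]) auto
  have int: "integrable M (\<lambda>\<omega>. f (X (s + t) \<omega>))"
    by (rule integrable_const_bound[OF _ m, of B]) (use assms X_nonneg in auto)
  have "expect_on A (\<lambda>\<omega>. f (X (s + t) \<omega>))
      = expect_on A (\<lambda>\<omega>. real_cond_exp M (F s) (\<lambda>\<omega>'. f (X (s + t) \<omega>')) \<omega>)"
    using S.real_cond_exp_intA[OF int assms(3)] by (simp add: set_lebesgue_integral_def)
  also have "\<dots> = expect_on A (\<lambda>\<omega>. transition_op K t f (X s \<omega>))"
  proof (rule integral_cong_AE)
    show "(\<lambda>\<omega>. indicator A \<omega> * real_cond_exp M (F s) (\<lambda>\<omega>'. f (X (s + t) \<omega>')) \<omega>) \<in> borel_measurable M"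
      using F_sets[OF assms(1,3)] by (intro borel_measurable_times borel_measurable_indicator) auto
    show "(\<lambda>\<omega>. indicator A \<omega> * transition_op K t f (X s \<omega>)) \<in> borel_measurable M"
      using F_sets[OF assms(1,3)] assms
      by (intro borel_measurable_times borel_measurable_indicator
          measurable_compose[OF X_measurable_nonneg transition_op_measurable]) auto
    show "AE \<omega> in M. indicator A \<omega> * real_cond_exp M (F s) (\<lambda>\<omega>'. f (X (s + t) \<omega>')) \<omega>
        = indicator A \<omega> * transition_op K t f (X s \<omega>)"
      using ce by eventually_elim simp
  qed
  finally show ?thesis .
qed

lemma distr_X:
  assumes t: "0 \<le> t" shows "distr M borel_nonneg (X t) = K t x0"
proof (rule measure_eqI)
  have x0: "0 \<le> x0" using x0_pos by simp
  show "sets (distr M borel_nonneg (X t)) = sets (K t x0)" by (simp add: sets_kernel[OF t x0])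
  interpret KP: prob_space "K t x0" by (rule kernel_prob[OF t x0])
  fix B assume "B \<in> sets (distr M borel_nonneg (X t))"
  then have B: "B \<in> sets borel_nonneg" by simp
  then have BK: "B \<in> sets (K t x0)" by (simp add: sets_kernel[OF t x0])
  have sp: "X t -` B \<inter> space M \<in> sets M" by (rule measurable_sets[OF X_measurable_nonneg[OF t] B])
  have "expect_on (space M) (\<lambda>\<omega>. indicator B (X (0 + t) \<omega>))
      = expect_on (space M) (\<lambda>\<omega>. transition_op K t (indicator B) (X 0 \<omega>))"
    using B t F_space[of 0] sets.top[of "F 0"]
    by (intro markov_bounded[of 0 t _ _ 1]) (auto simp: indicator_def)
  also have "\<dots> = (LINT \<omega>|M. transition_op K t (indicator B) x0)"
    by (rule Bochner_Integration.integral_cong) (auto simp: X_0)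
  also have "\<dots> = measure (K t x0) B"
    using BK by (simp add: transition_op_def prob_space)
  also have "expect_on (space M) (\<lambda>\<omega>. indicator B (X (0 + t) \<omega>)) = (LINT \<omega>|M. indicator (X t -` B \<inter> space M) \<omega> :: real)"
    by (rule Bochner_Integration.integral_cong) (auto simp: indicator_def)
  also have "\<dots> = measure M (X t -` B \<inter> space M)" using sp by simp
  finally show "emeasure (distr M borel_nonneg (X t)) B = emeasure (K t x0) B"
    using B by (simp add: emeasure_distr X_measurable_nonneg[OF t] emeasure_eq_measure KP.emeasure_eq_measure)
qed

lemma
  assumes t: "0 \<le> t"
  shows exp_X_integrable: "integrable M (\<lambda>\<omega>. exp (X t \<omega>))"
    and exp_X_integral: "(LINT \<omega>|M. exp (X t \<omega>)) = (LINT y|K t x0. exp y)"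
proof -
  have x0: "0 \<le> x0" using x0_pos by simp
  have e: "(exp :: real \<Rightarrow> real) \<in> borel_measurable borel_nonneg" by (intro measurable_borel_nonneg) simp
  show "integrable M (\<lambda>\<omega>. exp (X t \<omega>))"
    using exp_integrable[OF t x0] integrable_distr_eq[OF X_measurable_nonneg[OF t] e] distr_X[OF t] by simp
  show "(LINT \<omega>|M. exp (X t \<omega>)) = (LINT y|K t x0. exp y)"
    using integral_distr[OF X_measurable_nonneg[OF t] e] distr_X[OF t] by simp
qed


lemma exp_scaled_X_integrable:
  assumes "0 \<le> t" "u \<le> 1" shows "integrable M (\<lambda>\<omega>. exp (u * X t \<omega>))"
proof (rule Bochner_Integration.integrable_bound[OF exp_X_integrable[OF assms(1)]])
  note [measurable] = X_measurable[OF assms(1)]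
  show "(\<lambda>\<omega>. exp (u * X t \<omega>)) \<in> borel_measurable M" by measurable
  show "AE \<omega> in M. norm (exp (u * X t \<omega>)) \<le> norm (exp (X t \<omega>))"
    using mult_right_mono[OF assms(2)] X_nonneg[OF assms(1)] by (intro AE_I2) fastforce
qed

lemma mgf_measurable:
  assumes "0 \<le> t" shows "(\<lambda>x. mgf x t u) \<in> borel_measurable borel_nonneg"
proof -
  have "(\<lambda>y::real. exp (u * y)) \<in> borel_measurable borel_nonneg" by (intro measurable_borel_nonneg) measurable
  from transition_op_measurable[OF assms this] show ?thesis
    unfolding transition_op_def[abs_def] mgf_def .
qed

lemma mgf_le:
  assumes "0 \<le> t" "0 \<le> x" "u \<le> 1" shows "0 \<le> mgf x t u" "mgf x t u \<le> exp x"
  using mgf_le_exp_integral[OF assms] exp_integral_le[OF assms(1,2)] by (auto simp: mgf_def)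

text \<open>The Markov property holds for the bounded functions $\min(e^{uy}, n)$, and both sides are
  dominated by $e^{X_{s+t}}$ and $e^{X_s}$, respectively.\<close>

lemma markov_exp:
  assumes s: "0 \<le> s" and t: "0 \<le> t" and A: "A \<in> sets (F s)" and u: "u \<le> 1"
  shows "expect_on A (\<lambda>\<omega>. exp (u * X (s + t) \<omega>)) = expect_on A (\<lambda>\<omega>. mgf (X s \<omega>) t u)"
proof -
  note AM [measurable] = F_sets[OF s A]
  have st: "0 \<le> s + t" using s t by simp
  note [measurable] = X_measurable[OF s] X_measurable[OF st]
  define f where "f n y = min (exp (u * y)) (real n)" for n y
  have fm: "f n \<in> borel_measurable borel_nonneg" for n
    unfolding f_def by (intro measurable_borel_nonneg) measurable
  have f0: "0 \<le> f n y" "f n y \<le> exp (u * y)" for n y by (auto simp: f_def)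
  have flim: "(\<lambda>n. f n y) \<longlonglongrightarrow> exp (u * y)" for y
  proof (rule tendsto_eventually)
    obtain N :: nat where "exp (u * y) \<le> N" using real_arch_simple by blast
    then show "\<forall>\<^sub>F n in sequentially. f n y = exp (u * y)"
      unfolding eventually_sequentially f_def by (intro exI[of _ N]) (auto simp: min_def intro: antisym)
  qed
  have ule: "exp (u * y) \<le> exp y" if "0 \<le> y" for y using mult_right_mono[OF u that] by simp
  have eq: "expect_on A (\<lambda>\<omega>. f n (X (s + t) \<omega>)) = expect_on A (\<lambda>\<omega>. transition_op K t (f n) (X s \<omega>))" for n
    by (rule markov_bounded[OF s t A fm, of _ n]) (auto simp: f_def)
  have "(\<lambda>n. \<integral>\<omega>. indicator A \<omega> * f n (X (s + t) \<omega>) \<partial>M) \<longlonglongrightarrow> expect_on A (\<lambda>\<omega>. exp (u * X (s + t) \<omega>))"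
  proof (rule integral_dominated_convergence[OF _ _ exp_X_integrable[OF st]])
    show "AE \<omega> in M. (\<lambda>n. indicator A \<omega> * f n (X (s + t) \<omega>)) \<longlonglongrightarrow> indicator A \<omega> * exp (u * X (s + t) \<omega>)"
      by (intro AE_I2 tendsto_mult tendsto_const flim)
    show "AE \<omega> in M. norm (indicator A \<omega> * f n (X (s + t) \<omega>)) \<le> exp (X (s + t) \<omega>)" for n
      using f0 order_trans[OF f0(2) ule[OF X_nonneg[OF st]]]
      by (intro AE_I2) (auto simp: indicator_def)
    show "(\<lambda>\<omega>. indicator A \<omega> * f n (X (s + t) \<omega>)) \<in> borel_measurable M" for n
      unfolding f_def by measurable
  qed measurable
  moreover have "(\<lambda>n. \<integral>\<omega>. indicator A \<omega> * transition_op K t (f n) (X s \<omega>) \<partial>M) \<longlonglongrightarrow> expect_on A (\<lambda>\<omega>. mgf (X s \<omega>) t u)"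
  proof (rule integral_dominated_convergence[OF _ _ exp_X_integrable[OF s]])
    show "(\<lambda>\<omega>. indicator A \<omega> * transition_op K t (f n) (X s \<omega>)) \<in> borel_measurable M" for n
      by (intro borel_measurable_times borel_measurable_indicator AM
          measurable_compose[OF X_measurable_nonneg[OF s] transition_op_measurable[OF t fm]])
    show "(\<lambda>\<omega>. indicator A \<omega> * mgf (X s \<omega>) t u) \<in> borel_measurable M"
      by (intro borel_measurable_times borel_measurable_indicator AM
          measurable_compose[OF X_measurable_nonneg[OF s] mgf_measurable[OF t]])
    show "AE \<omega> in M. norm (indicator A \<omega> * transition_op K t (f n) (X s \<omega>)) \<le> exp (X s \<omega>)" for n
    proof (rule AE_I2)
      fix \<omega> assume "\<omega> \<in> space M"
      then have x: "0 \<le> X s \<omega>" by (rule X_nonneg[OF s])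
      have "\<bar>f n y\<bar> \<le> 1 * exp y" if "0 \<le> y" for y
        using f0(1)[of n y] order_trans[OF f0(2) ule[OF that], of n] by simp
      from dominated_integrable(2)[OF t x fm this]
      show "norm (indicator A \<omega> * transition_op K t (f n) (X s \<omega>)) \<le> exp (X s \<omega>)"
        by (auto simp: indicator_def transition_op_def)
    qed
    show "AE \<omega> in M. (\<lambda>n. indicator A \<omega> * transition_op K t (f n) (X s \<omega>)) \<longlonglongrightarrow> indicator A \<omega> * mgf (X s \<omega>) t u"
    proof (rule AE_I2)
      fix \<omega> assume "\<omega> \<in> space M"
      then have x: "0 \<le> X s \<omega>" by (rule X_nonneg[OF s])
      have "(\<lambda>n. transition_op K t (f n) (X s \<omega>)) \<longlonglongrightarrow> mgf (X s \<omega>) t u"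
        unfolding transition_op_def mgf_def
      proof (rule integral_dominated_convergence[OF _ _ exp_integrable[OF t x]])
        show "AE y in K t (X s \<omega>). norm (f n y) \<le> exp y" for n
          using f0 order_trans[OF f0(2) ule] by (intro AE_I2) (simp add: space_kernel[OF t x])
      qed (auto intro!: flim kernel_borel_measurable[OF t x] fm measurable_borel_nonneg)
      then show "(\<lambda>n. indicator A \<omega> * transition_op K t (f n) (X s \<omega>)) \<longlonglongrightarrow> indicator A \<omega> * mgf (X s \<omega>) t u"
        by (intro tendsto_mult tendsto_const)
    qed
  qed
  ultimately show ?thesis unfolding eq by (rule LIMSEQ_unique)
qed

lemma indicator_exp_integrable:
  assumes "A \<in> sets M" "0 \<le> t" "u \<le> 1" shows "integrable M (\<lambda>\<omega>. indicator A \<omega> * exp (u * X t \<omega>))"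
  using integrable_mult_indicator[OF assms(1) exp_scaled_X_integrable[OF assms(2,3)]] by simp

lemma markov_exp_clock:
  assumes "0 \<le> s" "0 \<le> t" "A \<in> sets (F s)" "0 < v" "v \<le> u" "u < 1" "clock v = clock u + t"
  shows "expect_on A (\<lambda>\<omega>. exp (u * X (s + t) \<omega>)) = expect_on A (\<lambda>\<omega>. exp (v * X s \<omega>))"
proof -
  have "expect_on A (\<lambda>\<omega>. mgf (X s \<omega>) t u) = expect_on A (\<lambda>\<omega>. exp (v * X s \<omega>))"
    using mgf_clock[OF assms(4-7)] X_nonneg[OF assms(1)] by (intro Bochner_Integration.integral_cong) auto
  then show ?thesis using markov_exp[OF assms(1-3), of u] assms(6) by simp
qed

lemma exp_supermartingale:
  assumes "0 \<le> s" "0 \<le> t" "A \<in> sets (F s)"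
  shows "expect_on A (\<lambda>\<omega>. exp (X (s + t) \<omega>)) \<le> expect_on A (\<lambda>\<omega>. exp (X s \<omega>))"
proof -
  note AM = F_sets[OF assms(1,3)]
  have "expect_on A (\<lambda>\<omega>. exp (1 * X (s + t) \<omega>)) = expect_on A (\<lambda>\<omega>. mgf (X s \<omega>) t 1)"
    by (rule markov_exp[OF assms]) simp
  also have "\<dots> \<le> expect_on A (\<lambda>\<omega>. exp (X s \<omega>))"
  proof (rule integral_mono)
    have b: "0 \<le> mgf (X s \<omega>) t 1" "mgf (X s \<omega>) t 1 \<le> exp (X s \<omega>)" if "\<omega> \<in> space M" for \<omega>
      using mgf_le[OF assms(2) X_nonneg[OF assms(1) that], of 1] by auto
    show i: "integrable M (\<lambda>\<omega>. indicator A \<omega> * exp (X s \<omega>))"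
      using indicator_exp_integrable[OF AM assms(1), of 1] by simp
    show "integrable M (\<lambda>\<omega>. indicator A \<omega> * mgf (X s \<omega>) t 1)"
    proof (rule Bochner_Integration.integrable_bound[OF i])
      show "(\<lambda>\<omega>. indicator A \<omega> * mgf (X s \<omega>) t 1) \<in> borel_measurable M"
        by (intro borel_measurable_times borel_measurable_indicator AM
            measurable_compose[OF X_measurable_nonneg[OF assms(1)] mgf_measurable[OF assms(2)]])
      show "AE \<omega> in M. norm (indicator A \<omega> * mgf (X s \<omega>) t 1) \<le> norm (indicator A \<omega> * exp (X s \<omega>))"
        using b by (intro AE_I2) (auto simp: indicator_def)
    qed
    show "indicator A \<omega> * mgf (X s \<omega>) t 1 \<le> indicator A \<omega> * exp (X s \<omega>)" if "\<omega> \<in> space M" for \<omega>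
      using b[OF that] by (auto simp: indicator_def)
  qed
  finally show ?thesis by simp
qed

lemma exp_martingale_increment:
  assumes "\<not> clock_bounded" "0 \<le> s" "0 \<le> t" "A \<in> sets (F s)"
  shows "expect_on A (\<lambda>\<omega>. exp (X (s + t) \<omega>)) = expect_on A (\<lambda>\<omega>. exp (X s \<omega>))"
proof -
  have "expect_on A (\<lambda>\<omega>. mgf (X s \<omega>) t 1) = expect_on A (\<lambda>\<omega>. exp (X s \<omega>))"
    using exp_conserved[OF assms(1,3)] X_nonneg[OF assms(2)]
    by (intro Bochner_Integration.integral_cong) (auto simp: mgf_def)
  then show ?thesis using markov_exp[OF assms(2-4), of 1] by simp
qed

lemma expectation_minus_1:
  assumes "A \<in> sets M" "integrable M f"
  shows "expect_on A (\<lambda>\<omega>. (f \<omega> - 1)) = expect_on A (\<lambda>\<omega>. f \<omega>) - measure M A"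
proof -
  have "expect_on A (\<lambda>\<omega>. (f \<omega> - 1)) = (LINT \<omega>|M. indicator A \<omega> * f \<omega> - indicator A \<omega>)"
    by (simp add: right_diff_distrib)
  also have "\<dots> = expect_on A (\<lambda>\<omega>. f \<omega>) - (LINT \<omega>|M. indicator A \<omega>)"
    using integrable_mult_indicator[OF assms] assms(1)
    by (intro Bochner_Integration.integral_diff) (auto simp: less_top[symmetric])
  finally show ?thesis using assms(1) by simp
qed

text \<open>If the clock is bounded below, the expectation has already dropped at time 1. Otherwise
  \<open>exp_conserved\<close> and the Markov property give the martingale property.\<close>

lemma martingale_iff: "martingale M F (\<lambda>t \<omega>. exp (X t \<omega>) - 1) \<longleftrightarrow> \<not> clock_bounded"
proof
  assume m: "martingale M F (\<lambda>t \<omega>. exp (X t \<omega>) - 1)"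
  show "\<not> clock_bounded"
  proof
    assume clock_bounded
    interpret S: finite_measure_subalgebra M "F 0" by unfold_locales (auto intro: subalgebra_F)
    have int: "integrable M (\<lambda>\<omega>. exp (X 1 \<omega>) - 1)" using m by (simp add: martingale_def)
    have "AE \<omega> in M. real_cond_exp M (F 0) (\<lambda>\<omega>. exp (X 1 \<omega>) - 1) \<omega> = exp (X 0 \<omega>) - 1"
      using m by (auto simp: martingale_def)
    then have "(LINT \<omega>|M. real_cond_exp M (F 0) (\<lambda>\<omega>. exp (X 1 \<omega>) - 1) \<omega>) = (LINT \<omega>|M. exp (X 0 \<omega>) - 1)"
      using X_measurable[of 0] by (intro integral_cong_AE) auto
    also have "\<dots> = (LINT \<omega>|M. exp x0 - 1)" by (rule Bochner_Integration.integral_cong) (auto simp: X_0)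
    finally have "(LINT \<omega>|M. exp (X 1 \<omega>) - 1) = exp x0 - 1"
      using S.real_cond_exp_int(2)[OF int] by (simp add: prob_space)
    moreover have "(LINT \<omega>|M. exp (X 1 \<omega>) - 1) = (LINT y|K 1 x0. exp y) - 1"
      using exp_X_integrable[of 1] exp_X_integral[of 1] by (simp add: prob_space)
    ultimately show False using exp_lost[OF \<open>clock_bounded\<close>, of 1 x0] x0_pos by simp
  qed
next
  assume nb: "\<not> clock_bounded"
  show "martingale M F (\<lambda>t \<omega>. exp (X t \<omega>) - 1)"
  proof (rule martingaleI)
    show "adapted F (\<lambda>t \<omega>. exp (X t \<omega>) - 1)"
      unfolding adapted_def using X_adapted by (intro allI impI borel_measurable_diff) auto
    show "integrable M (\<lambda>\<omega>. exp (X t \<omega>) - 1)" if "0 \<le> t" for t using exp_X_integrable[OF that] by simp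
    fix s t A assume st: "0 \<le> s" "s \<le> t" and A: "A \<in> sets (F s)"
    show "expect_on A (\<lambda>\<omega>. exp (X t \<omega>) - 1) = expect_on A (\<lambda>\<omega>. exp (X s \<omega>) - 1)"
      using exp_martingale_increment[OF nb st(1) _ A, of "t - s"] st F_sets[OF st(1) A] exp_X_integrable
      by (simp add: expectation_minus_1)
  qed
qed

end

section \<open>Stopping on a time grid\<close>

lemma cadlag_bounded:
  assumes x: "cadlag x" and T: "0 \<le> T"
  obtains B where "\<And>t. 0 \<le> t \<Longrightarrow> t \<le> T \<Longrightarrow> x t \<le> B"
proof -
  define P where "P a b = (\<exists>B. \<forall>t. 0 \<le> t \<longrightarrow> a \<le> t \<longrightarrow> t \<le> b \<longrightarrow> x t \<le> B)" for a b
  have "P 0 T"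
  proof (rule Bolzano[OF T])
    fix a b c assume "P a b" "P b c"
    then obtain B C where "\<And>t. 0 \<le> t \<Longrightarrow> a \<le> t \<Longrightarrow> t \<le> b \<Longrightarrow> x t \<le> B"
      "\<And>t. 0 \<le> t \<Longrightarrow> b \<le> t \<Longrightarrow> t \<le> c \<Longrightarrow> x t \<le> C" unfolding P_def by blast
    then have "x t \<le> max B C" if "0 \<le> t" "a \<le> t" "t \<le> c" for t
      using that by (cases "t \<le> b") (simp_all add: le_max_iff_disj)
    then show "P a c" unfolding P_def by blast
  next
    fix t assume t: "0 \<le> t" "t \<le> T"
    have "(x \<longlongrightarrow> x t) (at_right t)" using x t by (simp add: cadlag_def)
    then have "\<forall>\<^sub>F y in at_right t. x y < x t + 1" by (rule order_tendstoD) simp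
    then obtain r where r: "t < r" "\<And>y. t < y \<Longrightarrow> y < r \<Longrightarrow> x y < x t + 1"
      unfolding eventually_at_right_field by blast
    have "\<exists>l B. l < t \<and> (\<forall>y. 0 \<le> y \<longrightarrow> l < y \<longrightarrow> y < t \<longrightarrow> x y \<le> B)"
    proof (cases "t = 0")
      case True
      then show ?thesis by (intro exI[of _ "-1"]) auto
    next
      case False
      then obtain m where "(x \<longlongrightarrow> m) (at_left t)" using x t unfolding cadlag_def by (metis order_le_less)
      then have "\<forall>\<^sub>F y in at_left t. x y < m + 1" by (rule order_tendstoD) simp
      then obtain l where "l < t" "\<And>y. l < y \<Longrightarrow> y < t \<Longrightarrow> x y < m + 1"
        unfolding eventually_at_left_field by blast
      then show ?thesis by (intro exI[of _ l] exI[of _ "m + 1"]) (auto intro: less_imp_le)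
    qed
    then obtain l B where l: "l < t" "\<And>y. 0 \<le> y \<Longrightarrow> l < y \<Longrightarrow> y < t \<Longrightarrow> x y \<le> B" by blast
    show "\<exists>d>0. \<forall>a b. a \<le> t \<and> t \<le> b \<and> b - a < d \<longrightarrow> P a b"
    proof (intro exI[of _ "min (r - t) (t - l)"] conjI allI impI)
      fix a b assume ab: "a \<le> t \<and> t \<le> b \<and> b - a < min (r - t) (t - l)"
      have "x y \<le> max (x t + 1) B" if "0 \<le> y" "a \<le> y" "y \<le> b" for y
      proof (cases y t rule: linorder_cases)
        case less
        then show ?thesis using l(2)[of y] that ab by (simp add: le_max_iff_disj)
      next
        case greater
        then show ?thesis using r(2)[of y] that ab by (simp add: le_max_iff_disj less_imp_le)
      qed (simp add: le_max_iff_disj)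
      then show "P a b" unfolding P_def by blast
    qed (use r l in auto)
  qed
  then show ?thesis unfolding P_def using that by blast
qed

lemma cadlag_right_sequential:
  assumes x: "cadlag x" and T: "0 \<le> T" and \<sigma>: "\<And>n. T \<le> \<sigma> n" "\<sigma> \<longlonglongrightarrow> T"
  shows "(\<lambda>n. x (\<sigma> n)) \<longlonglongrightarrow> x T"
proof (rule tendstoI)
  fix e :: real assume e: "0 < e"
  have "(x \<longlongrightarrow> x T) (at_right T)" using x T by (simp add: cadlag_def)
  from tendstoD[OF this e] obtain r where r: "T < r" "\<And>y. T < y \<Longrightarrow> y < r \<Longrightarrow> dist (x y) (x T) < e"
    unfolding eventually_at_right_field by blast
  from order_tendstoD(2)[OF \<sigma>(2) r(1)] show "\<forall>\<^sub>F n in sequentially. dist (x (\<sigma> n)) (x T) < e"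
  proof eventually_elim
    case (elim n)
    then show ?case using r(2)[of "\<sigma> n"] \<sigma>(1)[of n] e by (cases "\<sigma> n = T") auto
  qed
qed

definition stop_time :: "('a \<Rightarrow> ennreal) \<Rightarrow> real \<Rightarrow> 'a \<Rightarrow> real" where
  "stop_time \<tau> t \<omega> = enn2real (min (ennreal t) (\<tau> \<omega>))"

lemma stop_time_nonneg: "0 \<le> stop_time \<tau> t \<omega>"
  by (simp add: stop_time_def)

lemma stop_time_before: "0 \<le> t \<Longrightarrow> ennreal t \<le> \<tau> \<omega> \<Longrightarrow> stop_time \<tau> t \<omega> = t"
  by (simp add: stop_time_def min_def)

lemma stop_time_after: "\<tau> \<omega> \<le> ennreal t \<Longrightarrow> stop_time \<tau> t \<omega> = enn2real (\<tau> \<omega>)"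
  by (simp add: stop_time_def min_def)

text \<open>The first point of the grid $s, s + \delta, \dots, s + k\delta$ that is not before $\tau$, or the
  last point if there is none. The recursion changes the stopped process only on
  $\{s + k\delta < \tau\}$, an event known at the time $s + k\delta$.\<close>

primrec grid_time :: "real \<Rightarrow> real \<Rightarrow> ('a \<Rightarrow> ennreal) \<Rightarrow> nat \<Rightarrow> 'a \<Rightarrow> real" where
  "grid_time s \<delta> \<tau> 0 \<omega> = s"
| "grid_time s \<delta> \<tau> (Suc k) \<omega> =
     (if ennreal (s + real k * \<delta>) < \<tau> \<omega> then s + real (Suc k) * \<delta> else grid_time s \<delta> \<tau> k \<omega>)"

text \<open>The disjunct $s = 0$ covers the value $\tau = 0$, for which the starting point of the grid
  is exact.\<close>

lemma grid_time_invariant: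
  assumes "0 \<le> s" "0 \<le> \<delta>" "ennreal s < \<tau> \<omega> \<or> s = 0"
  shows "(ennreal (s + real k * \<delta>) < \<tau> \<omega> \<and> grid_time s \<delta> \<tau> k \<omega> = s + real k * \<delta>) \<or>
    (\<tau> \<omega> \<le> ennreal (s + real k * \<delta>) \<and> enn2real (\<tau> \<omega>) \<le> grid_time s \<delta> \<tau> k \<omega> \<and>
     grid_time s \<delta> \<tau> k \<omega> \<le> enn2real (\<tau> \<omega>) + \<delta> \<and> grid_time s \<delta> \<tau> k \<omega> \<le> s + real k * \<delta>)"
proof (cases "\<tau> \<omega>" rule: ennreal_cases)
  case top
  then show ?thesis by (induct k) (auto simp: ennreal_less_top)
next
  case (real r)
  have nn: "0 \<le> s + real k * \<delta>" for k using assms by simp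
  show ?thesis
  proof (induct k)
    case 0
    then show ?case using assms real by (auto simp: ennreal_less_iff)
  next
    case (Suc k)
    show ?case using Suc nn[of k] nn[of "Suc k"] real assms(2)
      by (auto simp: ennreal_less_iff distrib_right not_le not_less)
  qed
qed

lemma grid_time_at:
  assumes "0 \<le> s" "0 \<le> \<delta>" "ennreal s < \<tau> \<omega> \<or> s = 0" "ennreal (s + real k * \<delta>) < \<tau> \<omega>"
  shows "grid_time s \<delta> \<tau> k \<omega> = s + real k * \<delta>"
  using grid_time_invariant[where \<tau> = \<tau> and \<omega> = \<omega> and k = k, OF assms(1-3)] assms(4) by (auto simp: not_le[symmetric])

lemma grid_time_approx:
  assumes "0 \<le> s" "0 \<le> \<delta>" "ennreal s < \<tau> \<omega> \<or> s = 0" and t: "t = s + real k * \<delta>"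
  shows "stop_time \<tau> t \<omega> \<le> grid_time s \<delta> \<tau> k \<omega>" "grid_time s \<delta> \<tau> k \<omega> \<le> stop_time \<tau> t \<omega> + \<delta>"
proof -
  have t0: "0 \<le> t" using assms by simp
  show "stop_time \<tau> t \<omega> \<le> grid_time s \<delta> \<tau> k \<omega>" "grid_time s \<delta> \<tau> k \<omega> \<le> stop_time \<tau> t \<omega> + \<delta>"
    using grid_time_invariant[where \<tau> = \<tau> and \<omega> = \<omega> and k = k, OF assms(1-3)] assms(2)
      stop_time_before[OF t0, of \<tau> \<omega>] stop_time_after[of \<tau> \<omega> t]
    unfolding t[symmetric] by auto
qed

text \<open>The price of truncating $e^{uy}$ at level $c$ is small compared with $e^y$. This is the uniform
  integrability of $e^{uX}$, $u < 1$, over a family along which $E[e^X]$ is bounded.\<close>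

lemma exp_truncation:
  fixes u c y :: real
  assumes "0 \<le> u" "u \<le> 1"
  shows "exp (u * y) \<le> min (exp (u * y)) (exp (u * c)) + exp (- ((1 - u) * c)) * exp y"
proof (cases "c \<le> y")
  case True
  have "(1 - u) * c \<le> (1 - u) * y" using assms True by (intro mult_left_mono) auto
  then have "u * y \<le> - ((1 - u) * c) + y" by (simp add: algebra_simps)
  then have "exp (u * y) \<le> exp (- ((1 - u) * c)) * exp y" by (simp flip: exp_add)
  moreover have "0 \<le> min (exp (u * y)) (exp (u * c))" by simp
  ultimately show ?thesis by linarith
next
  case False
  then have "exp (u * y) \<le> exp (u * c)" using assms by (simp add: mult_left_mono)
  then have "min (exp (u * y)) (exp (u * c)) = exp (u * y)" by (rule min_absorb1)
  then show ?thesis by simp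
qed

context usual_filtered_prob_space
begin

lemma stopping_time_sets:
  assumes "is_stopping_time M F \<tau>" "0 \<le> t"
  shows "{\<omega> \<in> space M. \<tau> \<omega> \<le> ennreal t} \<in> sets (F t)" "{\<omega> \<in> space M. ennreal t < \<tau> \<omega>} \<in> sets (F t)"
proof -
  show le: "{\<omega> \<in> space M. \<tau> \<omega> \<le> ennreal t} \<in> sets (F t)"
    using assms by (simp add: is_stopping_time_def)
  have "{\<omega> \<in> space M. ennreal t < \<tau> \<omega>} = space (F t) - {\<omega> \<in> space M. \<tau> \<omega> \<le> ennreal t}"
    using F_space[OF assms(2)] by auto
  then show "{\<omega> \<in> space M. ennreal t < \<tau> \<omega>} \<in> sets (F t)" using le by simp
qed

end

context affine_process
begin

lemma grid_measurable:
  assumes \<tau>: "is_stopping_time M F \<tau>" and s: "0 \<le> s" "0 \<le> \<delta>"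
  shows "(\<lambda>\<omega>. X (grid_time s \<delta> \<tau> k \<omega>) \<omega>) \<in> borel_measurable (F (s + real k * \<delta>))"
proof (induct k)
  case 0
  then show ?case using X_adapted[OF s(1)] by simp
next
  case (Suc k)
  let ?t = "s + real k * \<delta>" and ?t' = "s + real (Suc k) * \<delta>"
  have t: "0 \<le> ?t" "?t \<le> ?t'" using s by (auto simp: distrib_right)
  then have t': "0 \<le> ?t'" by linarith
  have "(\<lambda>\<omega>. if ennreal ?t < \<tau> \<omega> then X ?t' \<omega> else X (grid_time s \<delta> \<tau> k \<omega>) \<omega>) \<in> borel_measurable (F ?t')"
  proof (rule measurable_If)
    show "X ?t' \<in> borel_measurable (F ?t')" by (rule X_adapted[OF t'])
    show "(\<lambda>\<omega>. X (grid_time s \<delta> \<tau> k \<omega>) \<omega>) \<in> borel_measurable (F ?t')"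
      by (rule F_measurable_mono[OF t Suc])
    show "{\<omega> \<in> space (F ?t'). ennreal ?t < \<tau> \<omega>} \<in> sets (F ?t')"
      unfolding F_space[OF t'] using stopping_time_sets(2)[OF \<tau> t(1)] F_mono[OF t] by blast
  qed
  then show ?case by (rule measurable_cong[THEN iffD1, rotated]) simp
qed

lemma grid_limit:
  assumes \<omega>: "\<omega> \<in> space M" and s: "0 \<le> s" "s \<le> t" "ennreal s < \<tau> \<omega> \<or> s = 0"
  shows "(\<lambda>n. X (grid_time s ((t - s) / real (Suc n)) \<tau> (Suc n) \<omega>) \<omega>) \<longlonglongrightarrow> X (stop_time \<tau> t \<omega>) \<omega>"
proof (rule cadlag_right_sequential[OF X_cadlag[OF \<omega>] stop_time_nonneg])
  let ?\<delta> = "\<lambda>n. (t - s) / real (Suc n)"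
  have \<delta>: "0 \<le> ?\<delta> n" "t = s + real (Suc n) * ?\<delta> n" for n using s(2) by auto
  note approx = grid_time_approx[where \<tau> = \<tau> and \<omega> = \<omega> and k = "Suc n" for n, OF s(1) \<delta>(1) s(3) \<delta>(2)]
  show "stop_time \<tau> t \<omega> \<le> grid_time s (?\<delta> n) \<tau> (Suc n) \<omega>" for n by (rule approx(1))
  have "(\<lambda>n. ?\<delta> n) \<longlonglongrightarrow> 0"
    using tendsto_mult[OF tendsto_const LIMSEQ_inverse_real_of_nat, of "t - s"] by (simp add: divide_inverse)
  then have "(\<lambda>n. stop_time \<tau> t \<omega> + ?\<delta> n) \<longlonglongrightarrow> stop_time \<tau> t \<omega> + 0" by (intro tendsto_add tendsto_const)
  then have lim: "(\<lambda>n. stop_time \<tau> t \<omega> + ?\<delta> n) \<longlonglongrightarrow> stop_time \<tau> t \<omega>" by simp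
  show "(\<lambda>n. grid_time s (?\<delta> n) \<tau> (Suc n) \<omega>) \<longlonglongrightarrow> stop_time \<tau> t \<omega>"
    by (rule tendsto_sandwich[OF always_eventually[OF allI[OF approx(1)]]
          always_eventually[OF allI[OF approx(2)]] tendsto_const lim])
qed

lemma stopped_X_measurable:
  assumes \<tau>: "is_stopping_time M F \<tau>" and t: "0 \<le> t"
  shows "(\<lambda>\<omega>. X (stop_time \<tau> t \<omega>) \<omega>) \<in> borel_measurable (F t)"
proof (rule borel_measurable_LIMSEQ_real)
  show "(\<lambda>n. X (grid_time 0 ((t - 0) / real (Suc n)) \<tau> (Suc n) \<omega>) \<omega>) \<longlonglongrightarrow> X (stop_time \<tau> t \<omega>) \<omega>"
    if "\<omega> \<in> space (F t)" for \<omega>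
    using that F_space[OF t] t by (intro grid_limit) auto
  show "(\<lambda>\<omega>. X (grid_time 0 ((t - 0) / real (Suc n)) \<tau> (Suc n) \<omega>) \<omega>) \<in> borel_measurable (F t)" for n
    using grid_measurable[OF \<tau>, of 0 "(t - 0) / real (Suc n)" "Suc n"] t by (simp del: grid_time.simps of_nat_Suc)
qed

lemma grid_step:
  assumes \<tau>: "is_stopping_time M F \<tau>" and s: "0 \<le> s" "0 \<le> \<delta>"
    and A: "A \<in> sets (F s)" "\<And>\<omega>. \<omega> \<in> A \<Longrightarrow> ennreal s < \<tau> \<omega>"
  defines "B k \<equiv> A \<inter> {\<omega> \<in> space M. ennreal (s + real k * \<delta>) < \<tau> \<omega>}"
  shows "B k \<in> sets (F (s + real k * \<delta>))"
    and "\<omega> \<in> space M \<Longrightarrow> indicator A \<omega> * f (X (grid_time s \<delta> \<tau> (Suc k) \<omega>) \<omega>) =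
      indicator A \<omega> * f (X (grid_time s \<delta> \<tau> k \<omega>) \<omega>) +
      (indicator (B k) \<omega> * f (X (s + real k * \<delta> + \<delta>) \<omega>) - indicator (B k) \<omega> * f (X (s + real k * \<delta>) \<omega>) :: real)"
proof -
  have t: "0 \<le> s + real k * \<delta>" "s \<le> s + real k * \<delta>" using s by auto
  show "B k \<in> sets (F (s + real k * \<delta>))"
    unfolding B_def using F_mono[OF s(1) t(2)] A(1) stopping_time_sets(2)[OF \<tau> t(1)] by blast
  assume \<omega>: "\<omega> \<in> space M"
  have e: "s + real (Suc k) * \<delta> = s + real k * \<delta> + \<delta>" by (simp add: distrib_right)
  show "indicator A \<omega> * f (X (grid_time s \<delta> \<tau> (Suc k) \<omega>) \<omega>) =
      indicator A \<omega> * f (X (grid_time s \<delta> \<tau> k \<omega>) \<omega>) +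
      (indicator (B k) \<omega> * f (X (s + real k * \<delta> + \<delta>) \<omega>) - indicator (B k) \<omega> * f (X (s + real k * \<delta>) \<omega>))"
  proof (cases "\<omega> \<in> A \<and> ennreal (s + real k * \<delta>) < \<tau> \<omega>")
    case True
    then have "grid_time s \<delta> \<tau> k \<omega> = s + real k * \<delta>" using A(2) by (intro grid_time_at[OF s]) auto
    then show ?thesis using True \<omega> unfolding grid_time.simps e B_def by simp
  next
    case False
    then show ?thesis using \<omega> unfolding grid_time.simps e B_def by (auto simp: indicator_def)
  qed
qed

text \<open>Conditioning on the past, one grid step replaces the exponent $u$ by the $v$ with
  $G(v) = G(u) + \delta$. As $X \le n$ strictly before $\tau$, this lowers the expectation by at most
  $n e^n (u - v)$ each time.\<close>

lemma
  assumes \<tau>: "is_stopping_time M F \<tau>" and s: "0 \<le> s" "0 \<le> \<delta>"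
    and A: "A \<in> sets (F s)" "\<And>\<omega>. \<omega> \<in> A \<Longrightarrow> ennreal s < \<tau> \<omega>"
  shows grid_integrable: "u \<le> 1 \<Longrightarrow> integrable M (\<lambda>\<omega>. indicator A \<omega> * exp (u * X (grid_time s \<delta> \<tau> k \<omega>) \<omega>))"
    and grid_supermartingale:
      "expect_on A (\<lambda>\<omega>. exp (X (grid_time s \<delta> \<tau> k \<omega>) \<omega>)) \<le> expect_on A (\<lambda>\<omega>. exp (X s \<omega>))"
    and grid_lower: "\<lbrakk>0 < v; v \<le> u; u < 1; clock v = clock u + \<delta>; 0 \<le> n;
        \<And>\<omega> r. \<omega> \<in> space M \<Longrightarrow> 0 \<le> r \<Longrightarrow> ennreal r < \<tau> \<omega> \<Longrightarrow> X r \<omega> \<le> n\<rbrakk> \<Longrightarrow>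
      (expect_on A (\<lambda>\<omega>. exp (u * X s \<omega>))) - real k * (n * exp n * (u - v))
        \<le> expect_on A (\<lambda>\<omega>. exp (u * X (grid_time s \<delta> \<tau> k \<omega>) \<omega>))"
proof -
  define B where "B k = A \<inter> {\<omega> \<in> space M. ennreal (s + real k * \<delta>) < \<tau> \<omega>}" for k
  note step = grid_step[OF \<tau> s A, folded B_def]
  have t: "0 \<le> s + real k * \<delta>" "0 \<le> s + real k * \<delta> + \<delta>" for k using s by auto
  have BM: "B k \<in> sets M" for k using step(1) F_sets[OF t(1)] by blast
  have intB: "integrable M (\<lambda>\<omega>. indicator (B k) \<omega> * exp (u * X (s + real k * \<delta> + \<delta>) \<omega>))"
     "integrable M (\<lambda>\<omega>. indicator (B k) \<omega> * exp (u * X (s + real k * \<delta>) \<omega>))" if "u \<le> 1" for u k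
    by (rule indicator_exp_integrable[OF BM t(2) that] indicator_exp_integrable[OF BM t(1) that])+
  have int: "integrable M (\<lambda>\<omega>. indicator A \<omega> * exp (u * X (grid_time s \<delta> \<tau> k \<omega>) \<omega>))" if u: "u \<le> 1" for u k
  proof (induct k)
    case 0
    then show ?case using indicator_exp_integrable[OF F_sets[OF s(1) A(1)] s(1) u] by simp
  next
    case (Suc k)
    from Bochner_Integration.integrable_add[OF Suc Bochner_Integration.integrable_diff[OF intB[OF u]]]
    show ?case by (rule Bochner_Integration.integrable_cong[THEN iffD1, rotated 2])
        (simp_all only: step(2)[of _ "\<lambda>y. exp (u * y)"])
  qed
  then show "u \<le> 1 \<Longrightarrow> integrable M (\<lambda>\<omega>. indicator A \<omega> * exp (u * X (grid_time s \<delta> \<tau> k \<omega>) \<omega>))" .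
  have inc: "expect_on A (\<lambda>\<omega>. exp (u * X (grid_time s \<delta> \<tau> (Suc k) \<omega>) \<omega>)) =
      expect_on A (\<lambda>\<omega>. exp (u * X (grid_time s \<delta> \<tau> k \<omega>) \<omega>)) +
      ((expect_on (B k) (\<lambda>\<omega>. exp (u * X (s + real k * \<delta> + \<delta>) \<omega>))) -
       (expect_on (B k) (\<lambda>\<omega>. exp (u * X (s + real k * \<delta>) \<omega>))))" if u: "u \<le> 1" for u k
  proof -
    have "expect_on A (\<lambda>\<omega>. exp (u * X (grid_time s \<delta> \<tau> (Suc k) \<omega>) \<omega>)) =
      (LINT \<omega>|M. indicator A \<omega> * exp (u * X (grid_time s \<delta> \<tau> k \<omega>) \<omega>) +
        (indicator (B k) \<omega> * exp (u * X (s + real k * \<delta> + \<delta>) \<omega>) - indicator (B k) \<omega> * exp (u * X (s + real k * \<delta>) \<omega>)))"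
      by (rule Bochner_Integration.integral_cong[OF refl step(2)])
    also have "\<dots> = expect_on A (\<lambda>\<omega>. exp (u * X (grid_time s \<delta> \<tau> k \<omega>) \<omega>)) +
      ((expect_on (B k) (\<lambda>\<omega>. exp (u * X (s + real k * \<delta> + \<delta>) \<omega>))) -
       (expect_on (B k) (\<lambda>\<omega>. exp (u * X (s + real k * \<delta>) \<omega>))))"
      using int[OF u, of k] intB[OF u, of k]
      by (simp only: Bochner_Integration.integral_add Bochner_Integration.integral_diff Bochner_Integration.integrable_diff)
    finally show ?thesis .
  qed
  show "expect_on A (\<lambda>\<omega>. exp (X (grid_time s \<delta> \<tau> k \<omega>) \<omega>)) \<le> expect_on A (\<lambda>\<omega>. exp (X s \<omega>))"
  proof (induct k)
    case (Suc k)
    then show ?case using inc[of 1 k] exp_supermartingale[OF t(1) s(2) step(1), of k] by simp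
  qed simp
  assume v: "0 < v" "v \<le> u" "u < 1" "clock v = clock u + \<delta>" and n: "0 \<le> n"
    and Xn: "\<And>\<omega> r. \<omega> \<in> space M \<Longrightarrow> 0 \<le> r \<Longrightarrow> ennreal r < \<tau> \<omega> \<Longrightarrow> X r \<omega> \<le> n"
  show "expect_on A (\<lambda>\<omega>. exp (u * X s \<omega>)) - real k * (n * exp n * (u - v))
        \<le> expect_on A (\<lambda>\<omega>. exp (u * X (grid_time s \<delta> \<tau> k \<omega>) \<omega>))"
  proof (induct k)
    case (Suc k)
    let ?t = "s + real k * \<delta>"
    have "expect_on (B k) (\<lambda>\<omega>. exp (u * X ?t \<omega>)) - expect_on (B k) (\<lambda>\<omega>. exp (v * X ?t \<omega>))
        = (LINT \<omega>|M. indicator (B k) \<omega> * exp (u * X ?t \<omega>) - indicator (B k) \<omega> * exp (v * X ?t \<omega>))"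
      using intB(2)[of u k] intB(2)[of v k] v by simp
    also have "\<dots> \<le> (LINT \<omega>|M. n * exp n * (u - v))"
    proof (rule integral_mono)
      show "integrable M (\<lambda>\<omega>. indicator (B k) \<omega> * exp (u * X ?t \<omega>) - indicator (B k) \<omega> * exp (v * X ?t \<omega>))"
        using intB(2)[of u k] intB(2)[of v k] v by simp
      fix \<omega> assume \<omega>: "\<omega> \<in> space M"
      show "indicator (B k) \<omega> * exp (u * X ?t \<omega>) - indicator (B k) \<omega> * exp (v * X ?t \<omega>) \<le> n * exp n * (u - v)"
      proof (cases "\<omega> \<in> B k")
        case True
        define x where "x = X ?t \<omega>"
        have x: "0 \<le> x" "x \<le> n" using True X_nonneg[OF t(1) \<omega>] Xn[OF \<omega> t(1)] by (auto simp: x_def B_def)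
        have "u * x \<le> 1 * x" using x v by (intro mult_right_mono) auto
        then have le: "exp (u * x) \<le> exp n" using x by simp
        have "exp (u * x) * (1 + (v - u) * x) \<le> exp (u * x) * exp ((v - u) * x)"
          by (intro mult_left_mono exp_ge_add_one_self) auto
        also have "\<dots> = exp (v * x)" by (simp add: algebra_simps flip: exp_add)
        finally have "exp (u * x) - exp (v * x) \<le> exp (u * x) * ((u - v) * x)" by (simp add: algebra_simps)
        also have "\<dots> \<le> exp n * ((u - v) * n)" using le x v by (intro mult_mono) auto
        finally show ?thesis using True by (simp add: x_def mult_ac)
      qed (use n v in simp)
    qed simp
    also have "\<dots> = n * exp n * (u - v)" by (simp add: prob_space)
    finally have "expect_on (B k) (\<lambda>\<omega>. exp (u * X ?t \<omega>)) - n * exp n * (u - v)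
        \<le> expect_on (B k) (\<lambda>\<omega>. exp (u * X (?t + \<delta>) \<omega>))"
      using markov_exp_clock[OF t(1) s(2) step(1) v] by simp
    moreover have "real (Suc k) * (n * exp n * (u - v)) = real k * (n * exp n * (u - v)) + n * exp n * (u - v)"
      by (simp add: distrib_right)
    ultimately show ?case using Suc inc[of u k] v(3) by linarith
  qed simp
qed

text \<open>The upper bound is Fatou's lemma applied to the grid approximations. For the lower bound, with
  $u < 1$ and mesh $\delta_k$, the $k+1$ steps cost in total
  $(t-s)\,n e^n\,(u-v_k)/\delta_k \to -(t-s)\,n e^n R(u)$. The limits are taken in the order $k$, then
  the truncation level $c$, then $u \to 1$.\<close>

lemma stopped_exp_increment:
  assumes \<tau>: "is_stopping_time M F \<tau>" and st: "0 \<le> s" "s \<le> t"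
    and A: "A \<in> sets (F s)" "\<And>\<omega>. \<omega> \<in> A \<Longrightarrow> ennreal s < \<tau> \<omega>"
    and n: "0 \<le> n" and Xn: "\<And>\<omega> r. \<omega> \<in> space M \<Longrightarrow> 0 \<le> r \<Longrightarrow> ennreal r < \<tau> \<omega> \<Longrightarrow> X r \<omega> \<le> n"
  shows "integrable M (\<lambda>\<omega>. indicator A \<omega> * exp (X (stop_time \<tau> t \<omega>) \<omega>))" (is "integrable M ?Z")
    and "expect_on A (\<lambda>\<omega>. exp (X (stop_time \<tau> t \<omega>) \<omega>)) = expect_on A (\<lambda>\<omega>. exp (X s \<omega>))"
proof -
  have AM: "A \<in> sets M" by (rule F_sets[OF st(1) A(1)])
  have t: "0 \<le> t" using st by simp
  have "integrable M ?Z \<and> integral\<^sup>L M ?Z = expect_on A (\<lambda>\<omega>. exp (X s \<omega>))"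
  proof (cases "s = t")
    case True
    have Zeq: "?Z = (\<lambda>\<omega>. indicator A \<omega> * exp (X s \<omega>))"
      using A(2) stop_time_before[OF st(1), of \<tau>] True
      by (intro ext) (auto simp: indicator_def less_imp_le)
    show ?thesis unfolding Zeq using indicator_exp_integrable[OF AM st(1), of 1] by simp
  next
    case False
    define \<delta> where "\<delta> k = (t - s) / real (Suc k)" for k
    have \<delta>: "0 < \<delta> k" "0 \<le> \<delta> k" for k using False st by (auto simp: \<delta>_def)
    have \<delta>0: "\<delta> \<longlonglongrightarrow> 0" unfolding \<delta>_def[abs_def]
      using tendsto_mult[OF tendsto_const LIMSEQ_inverse_real_of_nat, of "t - s"] by (simp add: divide_inverse)
    define Y where "Y k \<omega> = X (grid_time s (\<delta> k) \<tau> (Suc k) \<omega>) \<omega>" for k \<omega>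
    define Z where "Z \<omega> = X (stop_time \<tau> t \<omega>) \<omega>" for \<omega>
    have Ylim: "(\<lambda>k. Y k \<omega>) \<longlonglongrightarrow> Z \<omega>" if "\<omega> \<in> A" for \<omega>
      unfolding Y_def Z_def \<delta>_def using that sets.sets_into_space[OF AM] A(2)[OF that] st
      by (intro grid_limit) auto

    have Zm [measurable]: "Z \<in> borel_measurable M"
      unfolding Z_def[abs_def] by (rule F_measurable_M[OF t stopped_X_measurable[OF \<tau> t]])
    have Ym [measurable]: "Y k \<in> borel_measurable M" for k
      unfolding Y_def[abs_def] using \<delta>(2)[of k] st
      by (intro F_measurable_M[OF _ grid_measurable[OF \<tau> st(1) \<delta>(2)]]) simp
    note [measurable] = AM X_measurable[OF st(1)]
    let ?I = "\<integral>\<omega>. indicator A \<omega> * exp (X s \<omega>) \<partial>M"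
    have Yint: "integrable M (\<lambda>\<omega>. indicator A \<omega> * exp (u * Y k \<omega>))" if "u \<le> 1" for u k
      unfolding Y_def by (rule grid_integrable[OF \<tau> st(1) \<delta>(2) A that])
    have Yle: "expect_on A (\<lambda>\<omega>. exp (Y k \<omega>)) \<le> ?I" for k
      unfolding Y_def by (rule grid_supermartingale[OF \<tau> st(1) \<delta>(2) A])
    have I0: "0 \<le> ?I" by (rule integral_nonneg_AE) (intro AE_I2 mult_nonneg_nonneg; simp)
    have "(\<integral>\<^sup>+\<omega>. ennreal (indicator A \<omega> * exp (Z \<omega>)) \<partial>M)
        = (\<integral>\<^sup>+\<omega>. liminf (\<lambda>k. ennreal (indicator A \<omega> * exp (Y k \<omega>))) \<partial>M)"
    proof (rule nn_integral_cong)
      fix \<omega>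
      have "(\<lambda>k. ennreal (indicator A \<omega> * exp (Y k \<omega>))) \<longlonglongrightarrow> ennreal (indicator A \<omega> * exp (Z \<omega>))"
      proof (cases "\<omega> \<in> A")
        case True
        then show ?thesis by (intro tendsto_ennrealI tendsto_mult tendsto_const tendsto_exp Ylim)
      qed simp
      then show "ennreal (indicator A \<omega> * exp (Z \<omega>)) = liminf (\<lambda>k. ennreal (indicator A \<omega> * exp (Y k \<omega>)))"
        by (rule lim_imp_Liminf[OF sequentially_bot, symmetric])
    qed
    also have "\<dots> \<le> liminf (\<lambda>k. \<integral>\<^sup>+\<omega>. ennreal (indicator A \<omega> * exp (Y k \<omega>)) \<partial>M)"
      by (rule nn_integral_liminf) measurable
    also have "\<dots> \<le> liminf (\<lambda>k. ennreal ?I)"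
    proof (intro Liminf_mono always_eventually allI)
      fix k
      have "(\<integral>\<^sup>+\<omega>. ennreal (indicator A \<omega> * exp (Y k \<omega>)) \<partial>M) = ennreal (expect_on A (\<lambda>\<omega>. exp (Y k \<omega>)))"
        using Yint[of 1 k] by (intro nn_integral_eq_integral AE_I2) simp_all
      then show "(\<integral>\<^sup>+\<omega>. ennreal (indicator A \<omega> * exp (Y k \<omega>)) \<partial>M) \<le> ennreal ?I"
        using Yle[of k] by (simp add: ennreal_leI)
    qed
    finally have fin: "(\<integral>\<^sup>+\<omega>. ennreal (indicator A \<omega> * exp (Z \<omega>)) \<partial>M) \<le> ennreal ?I" by (simp add: Liminf_const)
    have Zint: "integrable M (\<lambda>\<omega>. indicator A \<omega> * exp (Z \<omega>))"
      using le_less_trans[OF fin ennreal_less_top] by (intro integrableI_nonneg AE_I2) simp_all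
    have up: "expect_on A (\<lambda>\<omega>. exp (Z \<omega>)) \<le> ?I"
      using fin nn_integral_eq_integral[OF Zint] I0 by simp
    let ?J = "\<integral>\<omega>. indicator A \<omega> * exp (Z \<omega>) \<partial>M"
    have low: "expect_on A (\<lambda>\<omega>. exp (u * X s \<omega>)) - (t - s) * (n * exp n) * (- R u) \<le> ?J"
      if u: "0 < u" "u < 1" for u
    proof -
      have "\<exists>v. 0 < v \<and> v \<le> u \<and> clock v = clock u + \<delta> k" for k using clock_advance[OF u \<delta>(2)[of k]] by metis
      then obtain v where v: "\<And>k. 0 < v k" "\<And>k. v k \<le> u" "\<And>k. clock (v k) = clock u + \<delta> k" by metis
      note rate = clock_rate[OF u v \<delta>(1) \<delta>0]
      have trunc: "expect_on A (\<lambda>\<omega>. exp (u * X s \<omega>)) - (t - s) * (n * exp n) * (- R u)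
          \<le> ?J + exp (- ((1 - u) * c)) * ?I" for c
      proof -
        let ?m = "\<lambda>y. min (exp (u * y)) (exp (u * c))"

        have mint: "integrable M (\<lambda>\<omega>. indicator A \<omega> * ?m (Y k \<omega>))" for k
          by (rule integrable_const_bound[of _ "exp (u * c)"]) (auto simp: indicator_def)
        have 1: "expect_on A (\<lambda>\<omega>. exp (u * X s \<omega>)) - (t - s) * (n * exp n) * ((u - v k) / \<delta> k)
            \<le> expect_on A (\<lambda>\<omega>. ?m (Y k \<omega>)) + exp (- ((1 - u) * c)) * ?I" for k
        proof -
          have e: "real (Suc k) * (n * exp n * (u - v k)) = (t - s) * (n * exp n) * ((u - v k) / \<delta> k)"
            using False st by (simp add: \<delta>_def field_simps)
          have "expect_on A (\<lambda>\<omega>. exp (u * X s \<omega>)) - (t - s) * (n * exp n) * ((u - v k) / \<delta> k)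
              \<le> expect_on A (\<lambda>\<omega>. exp (u * Y k \<omega>))"
            unfolding Y_def e[symmetric] by (rule grid_lower[OF \<tau> st(1) \<delta>(2) A v(1,2) u(2) v(3) n Xn])
          also have "\<dots> \<le> (LINT \<omega>|M. indicator A \<omega> * ?m (Y k \<omega>) + exp (- ((1 - u) * c)) * (indicator A \<omega> * exp (Y k \<omega>)))"
          proof (rule integral_mono)
            show "integrable M (\<lambda>\<omega>. indicator A \<omega> * exp (u * Y k \<omega>))" using u by (intro Yint) simp
            show "integrable M (\<lambda>\<omega>. indicator A \<omega> * ?m (Y k \<omega>) + exp (- ((1 - u) * c)) * (indicator A \<omega> * exp (Y k \<omega>)))"
              using mint[of k] Yint[of 1 k] by (intro Bochner_Integration.integrable_add integrable_mult_right) simp_all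
            show "indicator A \<omega> * exp (u * Y k \<omega>) \<le> indicator A \<omega> * ?m (Y k \<omega>) + exp (- ((1 - u) * c)) * (indicator A \<omega> * exp (Y k \<omega>))" for \<omega>
              using exp_truncation[of u "Y k \<omega>" c] u by (cases "\<omega> \<in> A") simp_all
          qed
          also have "\<dots> = expect_on A (\<lambda>\<omega>. ?m (Y k \<omega>)) + exp (- ((1 - u) * c)) * (expect_on A (\<lambda>\<omega>. exp (Y k \<omega>)))"
            using mint[of k] Yint[of 1 k] by (subst Bochner_Integration.integral_add) simp_all
          also have "\<dots> \<le> expect_on A (\<lambda>\<omega>. ?m (Y k \<omega>)) + exp (- ((1 - u) * c)) * ?I"
            using Yle[of k] by (intro add_left_mono mult_left_mono) simp_all
          finally show ?thesis .
        qed
        have l: "(\<lambda>k. (expect_on A (\<lambda>\<omega>. exp (u * X s \<omega>))) - (t - s) * (n * exp n) * ((u - v k) / \<delta> k))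
            \<longlonglongrightarrow> expect_on A (\<lambda>\<omega>. exp (u * X s \<omega>)) - (t - s) * (n * exp n) * (- R u)"
          by (intro tendsto_diff tendsto_mult tendsto_const rate)
        have "(\<lambda>k. \<integral>\<omega>. indicator A \<omega> * ?m (Y k \<omega>) \<partial>M) \<longlonglongrightarrow> expect_on A (\<lambda>\<omega>. ?m (Z \<omega>))"
        proof (rule integral_dominated_convergence[where w = "\<lambda>_. exp (u * c)"])
          show "AE \<omega> in M. (\<lambda>k. indicator A \<omega> * ?m (Y k \<omega>)) \<longlonglongrightarrow> indicator A \<omega> * ?m (Z \<omega>)"
          proof (rule AE_I2)
            fix \<omega>
            show "(\<lambda>k. indicator A \<omega> * ?m (Y k \<omega>)) \<longlonglongrightarrow> indicator A \<omega> * ?m (Z \<omega>)"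
            proof (cases "\<omega> \<in> A")
              case True
              then show ?thesis by (intro tendsto_mult tendsto_min tendsto_exp tendsto_const Ylim)
            qed simp
          qed
          show "AE \<omega> in M. norm (indicator A \<omega> * ?m (Y k \<omega>)) \<le> exp (u * c)" for k
            by (intro AE_I2) (auto simp: indicator_def)
        qed simp_all
        then have r: "(\<lambda>k. (expect_on A (\<lambda>\<omega>. ?m (Y k \<omega>))) + exp (- ((1 - u) * c)) * ?I)
            \<longlonglongrightarrow> expect_on A (\<lambda>\<omega>. ?m (Z \<omega>)) + exp (- ((1 - u) * c)) * ?I"
          by (intro tendsto_add tendsto_const)
        have "expect_on A (\<lambda>\<omega>. exp (u * X s \<omega>)) - (t - s) * (n * exp n) * (- R u)
            \<le> expect_on A (\<lambda>\<omega>. ?m (Z \<omega>)) + exp (- ((1 - u) * c)) * ?I"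
          by (rule LIMSEQ_le[OF l r]) (use 1 in blast)
        also have "expect_on A (\<lambda>\<omega>. ?m (Z \<omega>)) \<le> ?J"
        proof (rule integral_mono[OF _ Zint])
          show "integrable M (\<lambda>\<omega>. indicator A \<omega> * ?m (Z \<omega>))"
            by (rule integrable_const_bound[of _ "exp (u * c)"]) (auto simp: indicator_def)
          fix \<omega> assume \<omega>: "\<omega> \<in> space M"
          have "u * Z \<omega> \<le> 1 * Z \<omega>"
            unfolding Z_def using u X_nonneg[OF stop_time_nonneg \<omega>] by (intro mult_right_mono) auto
          then have "?m (Z \<omega>) \<le> exp (Z \<omega>)" by (simp add: min_le_iff_disj)
          then show "indicator A \<omega> * ?m (Z \<omega>) \<le> indicator A \<omega> * exp (Z \<omega>)" by (intro mult_left_mono) simp_all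
        qed
        finally show ?thesis by simp
      qed
      have "((\<lambda>c. exp (- ((1 - u) * c))) \<longlongrightarrow> 0) at_top"
      proof (rule filterlim_compose[OF exp_at_bot])
        show "filterlim (\<lambda>c. - ((1 - u) * c)) at_bot at_top"
          using u by (simp add: filterlim_uminus_at_bot filterlim_tendsto_pos_mult_at_top[OF tendsto_const _ filterlim_ident])
      qed
      then have "((\<lambda>c. ?J + exp (- ((1 - u) * c)) * ?I) \<longlongrightarrow> ?J + 0 * ?I) at_top"
        by (intro tendsto_add tendsto_mult tendsto_const)
      then have "expect_on A (\<lambda>\<omega>. exp (u * X s \<omega>)) - (t - s) * (n * exp n) * (- R u) \<le> ?J + 0 * ?I"
        by (rule tendsto_lowerbound) (use trunc in \<open>auto intro!: always_eventually\<close>)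
      then show ?thesis by simp
    qed
    let ?u = "\<lambda>k. 1 - 1 / real (k + 2)"
    have "(\<lambda>k. (expect_on A (\<lambda>\<omega>. exp (?u k * X s \<omega>))) - (t - s) * (n * exp n) * (- R (?u k)))
        \<longlonglongrightarrow> expect_on A (\<lambda>\<omega>. exp (1 * X s \<omega>)) - (t - s) * (n * exp n) * (- R 1)"
    proof (intro tendsto_diff tendsto_mult tendsto_const tendsto_minus)
      show "(\<lambda>k. R (?u k)) \<longlonglongrightarrow> R 1"
      proof -
        have "(R \<circ> ?u) \<longlonglongrightarrow> R 1"
          using riccati_continuous[unfolded continuous_on_sequentially, rule_format, of 1 ?u]
            left_unit_seq less_imp_le by simp
        then show ?thesis by (simp add: o_def)
      qed
      show "(\<lambda>k. \<integral>\<omega>. indicator A \<omega> * exp (?u k * X s \<omega>) \<partial>M) \<longlonglongrightarrow> expect_on A (\<lambda>\<omega>. exp (1 * X s \<omega>))"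
      proof (rule integral_dominated_convergence[OF _ _ exp_X_integrable[OF st(1)]])
        show "AE \<omega> in M. (\<lambda>k. indicator A \<omega> * exp (?u k * X s \<omega>)) \<longlonglongrightarrow> indicator A \<omega> * exp (1 * X s \<omega>)"
          by (intro AE_I2 tendsto_mult tendsto_const tendsto_exp left_unit_seq)
        show "AE \<omega> in M. norm (indicator A \<omega> * exp (?u k * X s \<omega>)) \<le> exp (X s \<omega>)" for k
        proof (rule AE_I2)
          fix \<omega> assume \<omega>: "\<omega> \<in> space M"
          have "?u k * X s \<omega> \<le> 1 * X s \<omega>"
            using less_imp_le[OF left_unit_seq(2)[of k]] X_nonneg[OF st(1) \<omega>] by (rule mult_right_mono)
          then show "norm (indicator A \<omega> * exp (?u k * X s \<omega>)) \<le> exp (X s \<omega>)" by (auto simp: indicator_def)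
        qed
      qed measurable
    qed
    then have "expect_on A (\<lambda>\<omega>. exp (1 * X s \<omega>)) - (t - s) * (n * exp n) * (- R 1) \<le> ?J"
      by (rule LIMSEQ_le_const2) (use low left_unit_seq in blast)
    then have "?I \<le> ?J" by simp
    then show ?thesis using up Zint unfolding Z_def by (intro conjI antisym)
  qed
  then show "integrable M ?Z" "integral\<^sup>L M ?Z = expect_on A (\<lambda>\<omega>. exp (X s \<omega>))" by auto
qed

end

section \<open>Localisation and the equivalence\<close>

context affine_process
begin

definition first_above :: "nat \<Rightarrow> 'a \<Rightarrow> ennreal" where
  "first_above n \<omega> = (INF t\<in>{t. 0 \<le> t \<and> real n < X t \<omega>}. ennreal t)"

lemma first_above_bound:
  assumes "0 \<le> t" "ennreal t < first_above n \<omega>" shows "X t \<omega> \<le> real n"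
proof (rule ccontr)
  assume "\<not> X t \<omega> \<le> real n"
  then have "first_above n \<omega> \<le> ennreal t"
    unfolding first_above_def using assms(1) by (intro INF_lower) auto
  then show False using assms(2) by simp
qed

text \<open>By right-continuity of the paths, a level exceeded before $r$ is exceeded at a rational time
  before $r$.\<close>

lemma first_above_less_sets:
  assumes r: "0 < r" shows "{\<omega> \<in> space M. first_above n \<omega> < ennreal r} \<in> sets (F r)"
proof -
  have eq: "{\<omega> \<in> space M. first_above n \<omega> < ennreal r} =
      (\<Union>q\<in>{q \<in> \<rat>. 0 \<le> q \<and> q < r}. {\<omega> \<in> space M. real n < X q \<omega>})" (is "?L = ?R")
  proof (intro equalityI subsetI)
    fix \<omega> assume "\<omega> \<in> ?L"
    then have \<omega>: "\<omega> \<in> space M" and "first_above n \<omega> < ennreal r" by auto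
    then obtain t where t: "0 \<le> t" "real n < X t \<omega>" "ennreal t < ennreal r"
      unfolding first_above_def by (auto simp: INF_less_iff)
    then have "t < r" by (simp add: ennreal_less_iff)
    have "((\<lambda>t. X t \<omega>) \<longlongrightarrow> X t \<omega>) (at_right t)" using X_cadlag[OF \<omega>] t(1) by (simp add: cadlag_def)
    from order_tendstoD(1)[OF this t(2)] obtain b where b: "t < b" "\<And>y. t < y \<Longrightarrow> y < b \<Longrightarrow> real n < X y \<omega>"
      unfolding eventually_at_right_field by blast
    obtain q where "q \<in> \<rat>" "t < q" "q < min b r" using Rats_dense_in_real[of t "min b r"] b \<open>t < r\<close> by auto
    then show "\<omega> \<in> ?R" using \<omega> b t(1) by auto
  next
    fix \<omega> assume "\<omega> \<in> ?R"
    then obtain q where q: "\<omega> \<in> space M" "0 \<le> q" "q < r" "real n < X q \<omega>" by auto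
    then have "first_above n \<omega> \<le> ennreal q" unfolding first_above_def by (intro INF_lower) auto
    also have "\<dots> < ennreal r" using q by (simp add: ennreal_less_iff)
    finally show "\<omega> \<in> ?L" using q by simp
  qed
  have "{\<omega> \<in> space M. real n < X q \<omega>} \<in> sets (F r)" if "q \<in> {q \<in> \<rat>. 0 \<le> q \<and> q < r}" for q
  proof -
    have q: "0 \<le> q" "q \<le> r" using that by auto
    have [measurable]: "X q \<in> borel_measurable (F q)" by (rule X_adapted[OF q(1)])
    have "{\<omega> \<in> space (F q). real n < X q \<omega>} \<in> sets (F q)" by measurable
    then show ?thesis using F_mono[OF q] F_space[OF q(1)] by auto
  qed
  moreover have "countable {q \<in> \<rat>. 0 \<le> q \<and> q < r}"
    by (rule countable_subset[OF _ countable_rat]) auto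
  ultimately show ?thesis unfolding eq by (intro sets.countable_UN') auto
qed

text \<open>Right-continuity of the filtration turns the strict inequality of \<open>first_above_less_sets\<close> into a
  weak one.\<close>

lemma first_above_stopping: "is_stopping_time M F (first_above n)"
  unfolding is_stopping_time_def
proof (intro allI impI)
  fix t :: real assume t: "0 \<le> t"
  have "{\<omega> \<in> space M. first_above n \<omega> \<le> ennreal t} \<in> sets (F r)" if r: "t < r" for r
  proof -
    let ?r = "\<lambda>m. t + (r - t) / real (Suc m)"
    have rm: "t < ?r m" "?r m \<le> r" for m
    proof -
      have "(r - t) / real (Suc m) \<le> (r - t) / 1" using r by (intro divide_left_mono) auto
      then show "?r m \<le> r" by simp
    qed (use r in simp)
    have "?r \<longlonglongrightarrow> t + (r - t) * 0"
      using tendsto_add[OF tendsto_const tendsto_mult[OF tendsto_const LIMSEQ_inverse_real_of_nat], of t "r - t"]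
      by (simp add: divide_inverse)
    then have lim: "(\<lambda>m. ennreal (?r m)) \<longlonglongrightarrow> ennreal t" by (intro tendsto_ennrealI) simp
    have "{\<omega> \<in> space M. first_above n \<omega> \<le> ennreal t} = (\<Inter>m. {\<omega> \<in> space M. first_above n \<omega> < ennreal (?r m)})"
    proof (intro equalityI subsetI INT_I)
      fix \<omega> m assume "\<omega> \<in> {\<omega> \<in> space M. first_above n \<omega> \<le> ennreal t}"
      then show "\<omega> \<in> {\<omega> \<in> space M. first_above n \<omega> < ennreal (?r m)}"
        using le_less_trans[of _ "ennreal t" "ennreal (?r m)"] rm(1)[of m] t by (simp add: ennreal_less_iff)
    next
      fix \<omega> assume "\<omega> \<in> (\<Inter>m. {\<omega> \<in> space M. first_above n \<omega> < ennreal (?r m)})"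
      then have "\<omega> \<in> space M" "\<And>m. first_above n \<omega> \<le> ennreal (?r m)" by (auto intro: less_imp_le)
      then show "\<omega> \<in> {\<omega> \<in> space M. first_above n \<omega> \<le> ennreal t}"
        using LIMSEQ_le_const[OF lim, of "first_above n \<omega>"] by auto
    qed
    also have "\<dots> \<in> sets (F r)"
    proof (intro sets.countable_INT' image_subsetI)
      fix m :: nat
      have "0 < ?r m" "0 \<le> ?r m" using rm(1)[of m] t by linarith+
      then show "{\<omega> \<in> space M. first_above n \<omega> < ennreal (?r m)} \<in> sets (F r)"
        using first_above_less_sets[of "?r m" n] F_mono[of "?r m" r] rm(2)[of m] by blast
    qed simp_all
    finally show ?thesis .
  qed
  then show "{\<omega> \<in> space M. first_above n \<omega> \<le> ennreal t} \<in> sets (F t)"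
    unfolding F_right_continuous[OF t] by auto
qed

lemma first_above_incseq: "incseq (\<lambda>n. first_above n \<omega>)"
  unfolding first_above_def by (intro incseq_SucI INF_superset_mono) auto

lemma first_above_tendsto:
  assumes \<omega>: "\<omega> \<in> space M" shows "(\<lambda>n. first_above n \<omega>) \<longlonglongrightarrow> \<infinity>"
proof -
  have "\<forall>\<^sub>F n in sequentially. ennreal l < first_above n \<omega>" if l: "0 \<le> l" for l
  proof -
    have l1: "0 \<le> l + 1" using l by simp
    obtain B where B: "\<And>t. 0 \<le> t \<Longrightarrow> t \<le> l + 1 \<Longrightarrow> X t \<omega> \<le> B"
      using cadlag_bounded[OF X_cadlag[OF \<omega>] l1] by metis
    obtain N :: nat where N: "B \<le> real N" using real_arch_simple by blast
    have "ennreal l < first_above n \<omega>" if n: "N \<le> n" for n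
    proof -
      have "ennreal (l + 1) \<le> first_above n \<omega>"
        unfolding first_above_def
      proof (intro INF_greatest ennreal_leI)
        fix t assume "t \<in> {t. 0 \<le> t \<and> real n < X t \<omega>}"
        then show "l + 1 \<le> t" using B[of t] N n by fastforce
      qed
      moreover have "ennreal l < ennreal (l + 1)" using l by (simp add: ennreal_less_iff)
      ultimately show ?thesis by (rule less_le_trans[rotated])
    qed
    then show ?thesis unfolding eventually_sequentially by blast
  qed
  then show ?thesis by (simp add: tendsto_top_iff_ennreal infinity_ennreal_def)
qed

text \<open>An event in $F_s$ is split according to whether $\tau$ has occurred by time $s$. If so, the
  stopped process is constant from $s$ on; if not, \<open>stopped_exp_increment\<close> applies.\<close>

lemma stopped_martingale:
  assumes \<tau>: "is_stopping_time M F \<tau>" and n: "0 \<le> n"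
    and Xn: "\<And>\<omega> r. \<omega> \<in> space M \<Longrightarrow> 0 \<le> r \<Longrightarrow> ennreal r < \<tau> \<omega> \<Longrightarrow> X r \<omega> \<le> n"
  shows "martingale M F (stopped (\<lambda>t \<omega>. exp (X t \<omega>) - 1) \<tau>)"
proof -
  define Z where "Z t \<omega> = X (stop_time \<tau> t \<omega>) \<omega>" for t \<omega>
  have eq: "stopped (\<lambda>t \<omega>. exp (X t \<omega>) - 1) \<tau> = (\<lambda>t \<omega>. exp (Z t \<omega>) - 1)"
    by (simp add: fun_eq_iff stopped_def Z_def stop_time_def)
  have Zm: "Z t \<in> borel_measurable (F t)" if "0 \<le> t" for t
    unfolding Z_def[abs_def] by (rule stopped_X_measurable[OF \<tau> that])
  define late where "late s = {\<omega> \<in> space M. ennreal s < \<tau> \<omega>}" for s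
  define early where "early s = {\<omega> \<in> space M. \<tau> \<omega> \<le> ennreal s}" for s
  have le_sets: "late s \<in> sets (F s)" "early s \<in> sets (F s)" if "0 \<le> s" for s
    unfolding late_def early_def using stopping_time_sets[OF \<tau> that] by auto
  have split: "indicator A \<omega> * z = indicator (A \<inter> late s) \<omega> * z + (indicator (A \<inter> early s) \<omega> * z :: real)"
    if "\<omega> \<in> space M" for A s z \<omega>
    using that by (auto simp: late_def early_def indicator_def not_le)
  have incr: "integrable M (\<lambda>\<omega>. indicator (A \<inter> late s) \<omega> * exp (Z t \<omega>))"
      "expect_on (A \<inter> late s) (\<lambda>\<omega>. exp (Z t \<omega>)) = expect_on (A \<inter> late s) (\<lambda>\<omega>. exp (X s \<omega>))"
    if "0 \<le> s" "s \<le> t" "A \<in> sets (F s)" for s t A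
    unfolding Z_def using that le_sets[OF that(1)]
    by (intro stopped_exp_increment[OF \<tau> that(1,2) _ _ n Xn]; auto simp: late_def)+
  have int: "integrable M (\<lambda>\<omega>. exp (Z t \<omega>))" if t: "0 \<le> t" for t
  proof -
    have "integrable M (\<lambda>\<omega>. indicator (space M \<inter> early 0) \<omega> * exp x0)"
      using F_sets[OF order_refl le_sets(2)[OF order_refl]]
      by (intro integrable_mult_left) (auto simp: less_top[symmetric])
    moreover have "indicator (space M \<inter> early 0) \<omega> * exp x0 = indicator (space M \<inter> early 0) \<omega> * exp (Z t \<omega>)"
      if "\<omega> \<in> space M" for \<omega>
      using stop_time_after[of \<tau> \<omega> t] X_0[OF that] by (auto simp: early_def Z_def indicator_def)
    ultimately have "integrable M (\<lambda>\<omega>. indicator (space M \<inter> early 0) \<omega> * exp (Z t \<omega>))"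
      by (simp cong: Bochner_Integration.integrable_cong)
    with incr(1)[of 0 t "space M"] t sets.top[of "F 0"] F_space[of 0]
    have "integrable M (\<lambda>\<omega>. indicator (space M \<inter> late 0) \<omega> * exp (Z t \<omega>) + indicator (space M \<inter> early 0) \<omega> * exp (Z t \<omega>))"
      by (intro Bochner_Integration.integrable_add) auto
    then have "integrable M (\<lambda>\<omega>. indicator (space M) \<omega> * exp (Z t \<omega>))"
      by (rule Bochner_Integration.integrable_cong[THEN iffD2, rotated 2]) (simp_all only: split[of _ "space M" _ 0])
    then show ?thesis by (rule Bochner_Integration.integrable_cong[THEN iffD1, rotated 2]) auto
  qed
  show ?thesis unfolding eq
  proof (rule martingaleI)
    show "adapted F (\<lambda>t \<omega>. exp (Z t \<omega>) - 1)"
      unfolding adapted_def using Zm by (intro allI impI borel_measurable_diff) auto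
    show "integrable M (\<lambda>\<omega>. exp (Z t \<omega>) - 1)" if "0 \<le> t" for t using int[OF that] by simp
    fix s t A assume st: "0 \<le> s" "s \<le> t" and A: "A \<in> sets (F s)"
    then have t: "0 \<le> t" by simp
    note AM = F_sets[OF st(1) A]
    have lm: "A \<inter> late s \<in> sets M" "A \<inter> early s \<in> sets M"
      using AM F_sets[OF st(1) le_sets(1)[OF st(1)]] F_sets[OF st(1) le_sets(2)[OF st(1)]] by auto
    have sp: "expect_on A (\<lambda>\<omega>. exp (Z r \<omega>)) =
        expect_on (A \<inter> late s) (\<lambda>\<omega>. exp (Z r \<omega>)) + expect_on (A \<inter> early s) (\<lambda>\<omega>. exp (Z r \<omega>))"
      if "0 \<le> r" for r
    proof -
      have "expect_on A (\<lambda>\<omega>. exp (Z r \<omega>)) =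
          (LINT \<omega>|M. indicator (A \<inter> late s) \<omega> * exp (Z r \<omega>) + indicator (A \<inter> early s) \<omega> * exp (Z r \<omega>))"
        by (rule Bochner_Integration.integral_cong[OF refl split])
      then show ?thesis
        using integrable_mult_indicator[OF lm(1) int[OF that]] integrable_mult_indicator[OF lm(2) int[OF that]] by simp
    qed
    have "expect_on (A \<inter> early s) (\<lambda>\<omega>. exp (Z t \<omega>)) = expect_on (A \<inter> early s) (\<lambda>\<omega>. exp (Z s \<omega>))"
    proof (rule Bochner_Integration.integral_cong[OF refl])
      fix \<omega>
      show "indicator (A \<inter> early s) \<omega> * exp (Z t \<omega>) = indicator (A \<inter> early s) \<omega> * exp (Z s \<omega>)"
      proof (cases "\<tau> \<omega> \<le> ennreal s")
        case True
        then have "\<tau> \<omega> \<le> ennreal t" using ennreal_leI[OF st(2)] by (rule order_trans)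
        then show ?thesis using True stop_time_after[of \<tau> \<omega>] by (simp add: Z_def)
      qed (simp add: early_def)
    qed
    then have "expect_on A (\<lambda>\<omega>. exp (Z t \<omega>)) = expect_on A (\<lambda>\<omega>. exp (Z s \<omega>))"
      unfolding sp[OF t] sp[OF st(1)] using incr(2)[OF st A] incr(2)[OF st(1) order_refl A] by simp
    then show "expect_on A (\<lambda>\<omega>. exp (Z t \<omega>) - 1) = expect_on A (\<lambda>\<omega>. exp (Z s \<omega>) - 1)"
      using AM int[OF t] int[OF st(1)] by (simp add: expectation_minus_1)
  qed
qed

lemma local_martingale_exp: "local_martingale M F (\<lambda>t \<omega>. exp (X t \<omega>) - 1)"
  unfolding local_martingale_def
proof (intro conjI ballI exI[of _ first_above] allI)
  show "adapted F (\<lambda>t \<omega>. exp (X t \<omega>) - 1)"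
    unfolding adapted_def using X_adapted by (intro allI impI borel_measurable_diff) auto
  show "cadlag (\<lambda>t. exp (X t \<omega>) - 1)" if \<omega>: "\<omega> \<in> space M" for \<omega>
    unfolding cadlag_def
  proof (intro conjI allI impI)
    fix t :: real
    show "((\<lambda>t. exp (X t \<omega>) - 1) \<longlongrightarrow> exp (X t \<omega>) - 1) (at_right t)" if "0 \<le> t"
      using X_cadlag[OF \<omega>] that unfolding cadlag_def by (intro tendsto_intros) auto
    assume "0 < t"
    then obtain l where "((\<lambda>t. X t \<omega>) \<longlongrightarrow> l) (at_left t)" using X_cadlag[OF \<omega>] unfolding cadlag_def by blast
    then have "((\<lambda>t. exp (X t \<omega>) - 1) \<longlongrightarrow> exp l - 1) (at_left t)" by (intro tendsto_intros)
    then show "\<exists>l. ((\<lambda>t. exp (X t \<omega>) - 1) \<longlongrightarrow> l) (at_left t)" by blast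
  qed
  show "is_stopping_time M F (first_above n)" for n by (rule first_above_stopping)
  show "AE \<omega> in M. incseq (\<lambda>n. first_above n \<omega>) \<and> (\<lambda>n. first_above n \<omega>) \<longlonglongrightarrow> \<infinity>"
    using first_above_incseq first_above_tendsto by (intro AE_I2) blast
  show "martingale M F (stopped (\<lambda>t \<omega>. exp (X t \<omega>) - 1) (first_above n))" for n
    using first_above_bound by (intro stopped_martingale[OF first_above_stopping, of "real n"]) auto
qed

end

theorem theorem2:
  fixes M :: "'a measure" and F :: "real \<Rightarrow> 'a measure"
    and \<mu> :: "real measure" and K :: "real \<Rightarrow> real \<Rightarrow> real measure"
    and X S :: "real \<Rightarrow> 'a \<Rightarrow> real" and x0 :: real
  assumes "usual_filtered_prob_space M F"
    and "levy_measure \<mu>" and "emeasure \<mu> (space \<mu>) \<noteq> 0"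
    and "(\<integral>\<^sup>+\<xi>\<in>{1..}. ennreal (exp \<xi>) \<partial>\<mu>) < \<infinity>"
    and "feller_process M F K X"
    and "generator_with_core K Cc_smooth_nonneg (affine_generator \<mu>)"
    and "x0 > 0" and "\<forall>\<omega>\<in>space M. X 0 \<omega> = x0"
    and "S = (\<lambda>t \<omega>. exp (X t \<omega>) - 1)"
  shows "local_martingale M F S \<and>
    (strict_local_martingale M F S \<longleftrightarrow>
       (\<exists>g h. riccati_solution \<mu> g \<and> riccati_solution \<mu> h \<and> (\<exists>t\<ge>0. g t \<noteq> h t))) \<and>
    ((\<exists>g h. riccati_solution \<mu> g \<and> riccati_solution \<mu> h \<and> (\<exists>t\<ge>0. g t \<noteq> h t)) \<longleftrightarrow>
       (\<exists>\<epsilon>>0. set_integrable lborel {1 - \<epsilon><..<1} (\<lambda>\<eta>. 1 / riccati \<mu> \<eta>)))"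
proof -
  interpret usual_filtered_prob_space M F by (rule assms(1))
  interpret affine_process \<mu> K M F X x0
    using assms by unfold_locales (auto simp: feller_process_def)
  show ?thesis
    unfolding assms(9) strict_local_martingale_def
    using local_martingale_exp martingale_iff clock_bounded_iff_nonunique clock_bounded_iff_integrable by blast
qed

end
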